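(* (1) For the formal potential $\mathcal V_e^{\mathrm{ev}}(x)=\frac{x^2}{2}+\frac12\log(1-tx^2)=\frac{x^2}{2}-\sum_{n\ge1}\frac{t^nx^{2n}}{2n}$, the series $\mathcal R=\mathcal R(t)$, $\mathcal F_0=\mathcal F_0(t)=\sum_{n\ge1}f_nt^n$ and $\mathcal G_0=\mathcal F_0'$ satisfy $$4\mathcal R^2t-\mathcal R(1+4t)+t+1=0,$$ $$64t^3\mathcal G_0^2+(48t^2-24t+2)\mathcal G_0+9t-1=0,$$ $$3+6(4t-1)\mathcal F_0'+2t(8t-1)\mathcal F_0''=0,\quad \mathcal F_0(0)=0,\ \mathcal F_0'(0)=\tfrac12,$$ $$(n+3)(n+1)f_{n+1}-4n(1+2n)f_n=0\quad(n\ge1),\quad f_1=\tfrac12.$$ In addition, $$\mathcal F_0(t)=\sum_{n\ge1}\frac{3(2n-1)!\,2^{n-1}}{n!(n+2)!}t^n,$$ and for large $n$ $$f_n=\frac{3}{4\sqrt\pi}\frac{8^n}{n^{7/2}}\Big(1-\frac{25}{8n}+\frac{945}{128n^2}-\frac{16275}{1024n^3}+O\Big(\frac1{n^4}\Big)\Big).$$ (2) For the formal potential $\mathcal V_e(x)=\frac{x^2}{2}+\log(1-\sqrt t\,x)=\frac{x^2}{2}-\sum_{n\ge1}\frac{t^{n/2}x^n}{n}$, the series $\mathcal S$, $\mathcal R$, $\mathcal F_0=\sum_{n\ge1}f_nt^n$ and $\mathcal G_0=\mathcal F_0'$ satisfy $$3\sqrt t\,\mathcal S^2-\mathcal S+\sqrt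 t=0,$$ $$9t\mathcal R^2-(12t+1)\mathcal R+1=0,$$ $$108t^3\mathcal G_0^2+(108t^2-36t+2)\mathcal G_0+27t-2=0,$$ $$3+3(6t-1)\mathcal F_0'+t(12t-1)\mathcal F_0''=0,\quad\mathcal F_0(0)=0,\ \mathcal F_0'(0)=1,$$ $$(n+3)(n+1)f_{n+1}-6n(1+2n)f_n=0,\quad f_1=1.$$ In addition, $$\mathcal F_0(t)=\sum_{n\ge1}\frac{2(2n-1)!\,3^n}{n!(n+2)!}t^n,$$ and for large $n$ $$f_n=\frac{2}{\sqrt\pi}\frac{12^n}{n^{7/2}}\Big(1-\frac{25}{16n}+\frac{945}{256n^2}-\frac{16275}{2048n^3}+O\Big(\frac1{n^4}\Big)\Big).$$
   Context: For a formal potential $\frac{x^2}2-\sum_{n\ge1}\frac{a_n}{n}x^n$ with indeterminate $a_n$, let $\mathcal A=\mathbb Q[[a_1,a_2,\dots]]$ and let $\mathcal A^+$ be the series with zero constant term. $(\mathcal R,\mathcal S)\in(1+\mathcal A^+)\times\mathcal A^+$ is the unique solution of $$\mathcal R=1+\sum_{n\ge1}a_n\sum_{j\ge1}\binom{n-1}{j-1}\binom{n-j}{j}\mathcal R^j\mathcal S^{n-2j},\qquad \mathcal S=\sum_{n\ge1}a_n\sum_{j\ge0}\binom{n-1}{2j}\binom{2j}{j}\mathcal R^j\mathcal S^{n-2j-1}.$$ With $\mathcal H_N$ the space of $N\times N$ Hermitian matrices, put $$\mathcal Z=\frac{\int_{\mathcal H_N}\exp\big(-N\,\mathrm{Tr}(M^2/2)+N\sum_{n\ge1}\frac{a_n}{n}\mathrm{Tr}(M^n)\big)dM}{\int_{\mathcal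 H_N}\exp(-N\,\mathrm{Tr}(M^2/2))\,dM},$$ expanded in powers of the $a_n$ and integrated coefficientwise against the Gaussian; $\log\mathcal Z=\sum_{g\ge0}N^{2-2g}\mathcal F_g$ with $\mathcal F_g\in\mathcal A$, and $\mathcal F_0$ is the formal planar limit. For a specific potential whose coefficients depend on $t$, the series $\mathcal R(t),\mathcal S(t),\mathcal F_0(t)\in\mathbb Q[[t^{1/2}]]$ are obtained by substituting those coefficients: in (1), $a_{2n}=t^n$ and $a_{2n-1}=0$ for $n\ge1$; in (2), $a_n=t^{n/2}$ for $n\ge1$. Primes denote $d/dt$.
   Formalization: In (2) two printed formulas are false and are corrected: the equation for R reads 9tR²−(12t+1)R+1+4t=0 (since R=1+t+…), and the bracket in the asymptotics of f_n starts with 1/2 instead of 1, as the closed form requires; the recurrence in (2) is stated for n≥1. *)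

theory Defs
  imports
    "HOL-Analysis.Analysis"
    "HOL-Library.Multiset"
    "HOL-Library.Landau_Symbols"
    "HOL-Computational_Algebra.Formal_Power_Series"
    "Jordan_Normal_Form.Matrix"
begin

section \<open>Formal power series in countably many indeterminates\<close>

text \<open>
  The monomials in the indeterminates \<open>a\<^sub>1, a\<^sub>2, \<dots>\<close> are encoded as finite multisets of natural
  numbers, the element \<open>i\<close> standing for the indeterminate with index \<open>i + 1\<close>: the shift makes
  the series exactly the arbitrary coefficient functions, with no spurious \<open>a\<^sub>0\<close>.
\<close>

typedef 'a mfps = "UNIV :: (nat multiset \<Rightarrow> 'a) set"
  morphisms mfps_coeff Abs_mfps
  by simp

lemma mfps_coeff_Abs [simp]: "mfps_coeff (Abs_mfps f) = f"
  by (simp add: Abs_mfps_inverse)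

lemma mfps_eqI: "(\<And>m. mfps_coeff f m = mfps_coeff g m) \<Longrightarrow> f = g"
  by (metis ext mfps_coeff_inject)

lemma finite_submultisets: "finite {k :: 'b multiset. k \<subseteq># m}"
proof (induction m)
  case empty
  show ?case by simp
next
  case (add x m)
  have "k \<in> {k. k \<subseteq># m} \<union> add_mset x ` {k. k \<subseteq># m}" if "k \<subseteq># add_mset x m" for k
  proof (cases "x \<in># k")
    case True
    then obtain k' where "k = add_mset x k'"
      by (meson multi_member_split)
    with that show ?thesis by auto
  next
    case False
    with that have "k \<subseteq># m"
      by (metis add_mset_remove_trivial diff_single_trivial subset_eq_diff_conv
          add_mset_add_single)
    then show ?thesis by simp
  qed
  then have "{k. k \<subseteq># add_mset x m} \<subseteq> {k. k \<subseteq># m} \<union> add_mset x ` {k. k \<subseteq># m}"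
    by blast
  then show ?case
    using add.IH by (meson finite_UnI finite_imageI finite_subset)
qed

lemma finite_splittings: "finite {(k, l). k + l = (m :: 'b multiset)}"
proof (rule finite_subset)
  show "{(k, l). k + l = m} \<subseteq> {k. k \<subseteq># m} \<times> {k. k \<subseteq># m}"
    by auto
qed (simp add: finite_submultisets)

instantiation mfps :: (comm_ring_1) comm_ring_1
begin

definition "0 = Abs_mfps (\<lambda>_. 0)"
definition "1 = Abs_mfps (\<lambda>m. if m = {#} then 1 else 0)"
definition "f + g = Abs_mfps (\<lambda>m. mfps_coeff f m + mfps_coeff g m)"
definition "f - g = Abs_mfps (\<lambda>m. mfps_coeff f m - mfps_coeff g m)"
definition "- f = Abs_mfps (\<lambda>m. - mfps_coeff f m)"
definition "f * g = Abs_mfps (\<lambda>m. \<Sum>(k, l) | k + l = m. mfps_coeff f k * mfps_coeff g l)"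

instance
proof
  fix f g h :: "'a mfps"
  show "f * g = g * f"
  proof (rule mfps_eqI)
    fix m
    show "mfps_coeff (f * g) m = mfps_coeff (g * f) m"
      unfolding times_mfps_def mfps_coeff_Abs
      by (rule sum.reindex_bij_witness[of _ prod.swap prod.swap])
        (auto simp: add.commute mult.commute)
  qed
  show "1 * f = f"
  proof (rule mfps_eqI)
    fix m
    have "mfps_coeff (1 * f) m =
        (\<Sum>(k, l) | k + l = m. if k = {#} then mfps_coeff f l else 0)"
      unfolding times_mfps_def one_mfps_def mfps_coeff_Abs by (rule sum.cong) auto
    also have "\<dots> = (\<Sum>(k, l) \<in> {({#} :: nat multiset, m)}. if k = {#} then mfps_coeff f l else 0)"
      using finite_splittings[of m] by (intro sum.mono_neutral_right) (auto split: if_splits)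
    finally show "mfps_coeff (1 * f) m = mfps_coeff f m"
      by simp
  qed
  show "(f + g) * h = f * h + g * h"
    by (rule mfps_eqI)
      (simp add: times_mfps_def plus_mfps_def case_prod_unfold distrib_right sum.distrib)
  show "f * g * h = f * (g * h)"
  proof (rule mfps_eqI)
    fix m
    let ?f = "mfps_coeff f" and ?g = "mfps_coeff g" and ?h = "mfps_coeff h"
    have "mfps_coeff (f * g * h) m =
        (\<Sum>p | fst p + snd p = m. \<Sum>q | fst q + snd q = fst p.
           ?f (fst q) * ?g (snd q) * ?h (snd p))"
      by (simp add: times_mfps_def case_prod_unfold sum_distrib_right)
    also have "\<dots> = (\<Sum>(p, q) \<in> (SIGMA p:{p. fst p + snd p = m}. {q. fst q + snd q = fst p}).
        ?f (fst q) * ?g (snd q) * ?h (snd p))"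
      using finite_splittings by (subst sum.Sigma) (auto simp: case_prod_unfold)
    also have "\<dots> = (\<Sum>(p, q) \<in> (SIGMA p:{p. fst p + snd p = m}. {q. fst q + snd q = snd p}).
        ?f (fst p) * (?g (fst q) * ?h (snd q)))"
      by (rule sum.reindex_bij_witness
          [of _ "\<lambda>(p, q). ((fst p + fst q, snd q), (fst p, fst q))"
                "\<lambda>(p, q). ((fst q, snd q + snd p), (snd q, snd p))"])
        (auto simp: add.assoc mult.assoc)
    also have "\<dots> = (\<Sum>p | fst p + snd p = m. \<Sum>q | fst q + snd q = snd p.
           ?f (fst p) * (?g (fst q) * ?h (snd q)))"
      using finite_splittings by (subst sum.Sigma) (auto simp: case_prod_unfold)
    also have "\<dots> = mfps_coeff (f * (g * h)) m"
      by (simp add: times_mfps_def case_prod_unfold sum_distrib_left)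
    finally show "mfps_coeff (f * g * h) m = mfps_coeff (f * (g * h)) m" .
  qed
  have "mfps_coeff (0 :: 'a mfps) {#} \<noteq> mfps_coeff 1 {#}"
    by (simp add: zero_mfps_def one_mfps_def)
  then show "(0 :: 'a mfps) \<noteq> 1"
    by metis
qed (auto intro!: mfps_eqI
    simp: zero_mfps_def plus_mfps_def minus_mfps_def uminus_mfps_def add_ac)

end

definition mfps_const :: "'a \<Rightarrow> 'a :: comm_ring_1 mfps" where
  "mfps_const c = Abs_mfps (\<lambda>m. if m = {#} then c else 0)"

text \<open>The indeterminate \<open>a\<^sub>n\<close>, for \<open>n \<ge> 1\<close>.\<close>
definition indet :: "nat \<Rightarrow> 'a :: comm_ring_1 mfps" where
  "indet n = Abs_mfps (\<lambda>m. if m = {#n - 1#} then 1 else 0)"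

text \<open>
  Infinite sums of series are taken coefficientwise.  In every use below only finitely many
  summands contribute to a given coefficient.
\<close>
definition mfps_infsum :: "('i \<Rightarrow> 'a :: comm_ring_1 mfps) \<Rightarrow> 'i set \<Rightarrow> 'a mfps" where
  "mfps_infsum f I = Abs_mfps (\<lambda>m. \<Sum>i | i \<in> I \<and> mfps_coeff (f i) m \<noteq> 0. mfps_coeff (f i) m)"

text \<open>\<open>u(f)\<close> for a univariate series \<open>u\<close> and a series \<open>f\<close> with zero constant term.\<close>
definition mfps_apply :: "'a :: comm_ring_1 fps \<Rightarrow> 'a mfps \<Rightarrow> 'a mfps" where
  "mfps_apply u f = mfps_infsum (\<lambda>k. mfps_const (fps_nth u k) * f ^ k) UNIV"

definition mfps_exp :: "real mfps \<Rightarrow> real mfps" where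
  "mfps_exp f = mfps_apply (fps_exp 1) f"

text \<open>The logarithm of a series with constant term 1; \<open>fps_ln 1\<close> is the expansion of \<open>log (1 + x)\<close>.\<close>
definition mfps_log :: "real mfps \<Rightarrow> real mfps" where
  "mfps_log f = mfps_apply (fps_ln 1) (f - 1)"

text \<open>
  Substitution \<open>a\<^sub>n := c n\<close> for \<open>n \<ge> 1\<close>; it makes sense when every coefficient of the result
  receives finitely many contributions, for instance if \<open>c n\<close> has order at least \<open>n\<close>.
\<close>
definition mfps_subst :: "(nat \<Rightarrow> 'a fps) \<Rightarrow> 'a :: comm_ring_1 mfps \<Rightarrow> 'a fps" where
  "mfps_subst c f =
     (let term = (\<lambda>m k. mfps_coeff f m * fps_nth (\<Prod>i\<in>#m. c (Suc i)) k)
      in Abs_fps (\<lambda>k. \<Sum>m | term m k \<noteq> 0. term m k))"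

section \<open>The series \<open>R\<close> and \<open>S\<close>\<close>

text \<open>
  The inner sums stop where the binomial coefficients begin to vanish, so that all the
  exponents \<open>n - 2j\<close> and \<open>n - 2j - 1\<close> are genuine differences of natural numbers.
\<close>
definition RS_solution :: "rat mfps \<Rightarrow> rat mfps \<Rightarrow> bool" where
  "RS_solution R S \<longleftrightarrow>
     mfps_coeff R {#} = 1 \<and> mfps_coeff S {#} = 0 \<and>
     R = 1 + mfps_infsum (\<lambda>n. indet n *
           (\<Sum>j = 1..n div 2. of_nat (((n - 1) choose (j - 1)) * ((n - j) choose j))
              * R ^ j * S ^ (n - 2 * j))) {1..} \<and>
     S = mfps_infsum (\<lambda>n. indet n *
           (\<Sum>j = 0..(n - 1) div 2. of_nat (((n - 1) choose (2 * j)) * ((2 * j) choose j))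
              * R ^ j * S ^ (n - 2 * j - 1))) {1..}"

section \<open>The formal Hermitian matrix integral\<close>

text \<open>
  The real coordinates on the \<open>N \<times> N\<close> Hermitian matrices are the diagonal entries, the real
  parts \<open>x (i, j)\<close> and the imaginary parts \<open>x (j, i)\<close> of the entries \<open>(i, j)\<close> with \<open>i < j\<close>.
  Another normalisation of the Lebesgue measure would cancel in the partition function.
\<close>
definition herm_mat :: "nat \<Rightarrow> (nat \<times> nat \<Rightarrow> real) \<Rightarrow> complex mat" where
  "herm_mat N x = Matrix.mat N N (\<lambda>(i, j).
     if i = j then complex_of_real (x (i, i))
     else if i < j then Complex (x (i, j)) (x (j, i))
     else Complex (x (j, i)) (- x (i, j)))"

definition herm_measure :: "nat \<Rightarrow> (nat \<times> nat \<Rightarrow> real) measure" where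
  "herm_measure N = (\<Pi>\<^sub>M p \<in> {..<N} \<times> {..<N}. lborel)"

text \<open>\<open>Tr (M\<^sup>n)\<close>, which is real since \<open>M\<close> is Hermitian.\<close>
definition herm_trace_pow :: "nat \<Rightarrow> (nat \<times> nat \<Rightarrow> real) \<Rightarrow> nat \<Rightarrow> real" where
  "herm_trace_pow N x n = Re (\<Sum>i<N. (herm_mat N x ^\<^sub>m n) $$ (i, i))"

definition gauss_weight :: "nat \<Rightarrow> (nat \<times> nat \<Rightarrow> real) \<Rightarrow> real" where
  "gauss_weight N x = exp (- real N * (herm_trace_pow N x 2 / 2))"

definition interaction :: "nat \<Rightarrow> (nat \<times> nat \<Rightarrow> real) \<Rightarrow> real mfps" where
  "interaction N x = mfps_exp (mfps_const (real N) *
     mfps_infsum (\<lambda>n. mfps_const (herm_trace_pow N x n / real n) * indet n) {1..})"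

definition partition_function :: "nat \<Rightarrow> real mfps" where
  "partition_function N = Abs_mfps (\<lambda>m.
     (LINT x|herm_measure N. mfps_coeff (interaction N x) m * gauss_weight N x) /
     (LINT x|herm_measure N. gauss_weight N x))"

text \<open>
  \<open>log Z = \<Sum>\<^sub>g N\<^bsup>2 - 2g\<^esup> F\<^sub>g\<close> coefficientwise, for all matrix sizes.  Letting \<open>N\<close> vary, this
  determines every \<open>F\<^sub>g\<close>.
\<close>
definition genus_expansion :: "(nat \<Rightarrow> rat mfps) \<Rightarrow> bool" where
  "genus_expansion F \<longleftrightarrow> (\<forall>N\<ge>1. \<forall>m.
     (\<lambda>g. real N powi (2 - 2 * int g) * real_of_rat (mfps_coeff (F g) m))
       sums mfps_coeff (mfps_log (partition_function N)) m)"

section \<open>The two specialisations\<close>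

text \<open>
  Elements of \<open>\<rat>[[t\<^bsup>1/2\<^esup>]]\<close> are represented as univariate series whose variable stands for the
  square root of \<open>t\<close>.
\<close>
definition even_weights :: "nat \<Rightarrow> rat fps" where
  "even_weights n = (if even n then fps_X ^ n else 0)"

definition all_weights :: "nat \<Rightarrow> rat fps" where
  "all_weights n = fps_X ^ n"

end

(*
  The Schwinger-Dyson equations of the Gaussian measure, divided by Z and taken to the limit of
  large N (the genus expansion is a hypothesis, so the limits exist), give for the planar moments
  w_n = n dF_0/da_n, w_0 = 1, the loop equation
    w_(p+1) = sum_(i+j=p-1) w_i w_j + sum_(n>=1) a_n w_(p+n-1).
  After the substitution a_n = s^n, s^2 = t (or its even part), the infinite sum telescopes, and
  the generating function W(z) of the w_n satisfies a quadratic equation in W with one unknown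
  series B = sum s^n w_n, which equals 1 + 2t F_0'.  Tutte's quadratic method (evaluation at a
  series z = Z(s) where the derivative of the equation in W vanishes, hence where the discriminant
  has a double root) eliminates W and yields the quadratic equation for F_0'.  Its discriminant is
  a constant times the cube of a linear form in t; the linear differential equation, the recursion
  and the closed form follow from this.

  For R and S, the sums over n are coefficients of z^0 and z^(-1) in a geometric series in
  z + S + R/z, so that S is s divided by the square root of (1 - sS)^2 - 4 s^2 R.
*)
theory Submission
  imports Defs "HOL-Probability.Distributions" "HOL-Real_Asymp.Real_Asymp"
begin

section \<open>Calculus of series in countably many indeterminates\<close>

text \<open>The two hypotheses act separately: the equations for R and S come from
  \<open>RS_solution\<close>, everything about F_0 comes from \<open>genus_expansion\<close>. All
  integrals are taken coefficientwise, hence they are Gaussian integrals of polynomials in the real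
  coordinates; integration by parts is then an identity between one-dimensional moments, and
  derivatives are only computed algebraically. Inserting a trace under the integral amounts to
  differentiating with respect to an indeterminate, so the Schwinger-Dyson equations become
  identities between series. After division by Z a double insertion is the product of two
  expectations plus a connected part with a factor 1/N^2, and that part is what disappears in the
  planar limit. In the quadratic method the coefficient of W^2 vanishes at z = s, so the double root
  is sought as a perturbation of z = s, namely z = s Y with Y(0) = 1 (t Y for the even potential,
  where the variable replaces z^2). This scaling turns the root condition into a fixed point
  equation and makes t and B rational functions of D = Y - 1.\<close>

lemma mfps_coeff_0 [simp]: "mfps_coeff 0 m = 0"
  and mfps_coeff_1: "mfps_coeff 1 m = (if m = {#} then 1 else 0)"
  and mfps_coeff_add [simp]: "mfps_coeff (f + g) m = mfps_coeff f m + mfps_coeff g m"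
  and mfps_coeff_diff [simp]: "mfps_coeff (f - g) m = mfps_coeff f m - mfps_coeff g m"
  and mfps_coeff_minus [simp]: "mfps_coeff (- f) m = - mfps_coeff f m"
  by (simp_all add: zero_mfps_def one_mfps_def plus_mfps_def minus_mfps_def uminus_mfps_def)

lemma mfps_coeff_mult:
  "mfps_coeff (f * g) m = (\<Sum>(k, l) | k + l = m. mfps_coeff f k * mfps_coeff g l)"
  by (simp add: times_mfps_def)

lemma mfps_coeff_sum [simp]: "mfps_coeff (sum f A) m = (\<Sum>i\<in>A. mfps_coeff (f i) m)"
  by (induction A rule: infinite_finite_induct) auto

lemma splittings_empty: "{(k, l). k + l = ({#} :: 'b multiset)} = {({#}, {#})}"
  by auto

lemma mfps_coeff_mult_empty [simp]: "mfps_coeff (f * g) {#} = mfps_coeff f {#} * mfps_coeff g {#}"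
  by (simp add: mfps_coeff_mult splittings_empty)

lemma mfps_coeff_const_mult [simp]: "mfps_coeff (mfps_const c * f) m = c * mfps_coeff f m"
proof -
  have "mfps_coeff (mfps_const c * f) m =
      (\<Sum>(k, l) \<in> {({#} :: nat multiset, m)}. c * mfps_coeff f l)"
    unfolding mfps_coeff_mult using finite_splittings[of m]
    by (intro sum.mono_neutral_cong_right) (auto simp: mfps_const_def split: if_splits)
  then show ?thesis by simp
qed

lemma mfps_of_nat: "of_nat n = mfps_const (of_nat n)"
  by (induction n) (auto intro!: mfps_eqI simp: mfps_const_def mfps_coeff_1)

lemma mfps_coeff_of_nat_mult [simp]: "mfps_coeff (of_nat n * f) m = of_nat n * mfps_coeff f m"
  by (simp add: mfps_of_nat)

lemma mfps_coeff_indet_mult: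
  "mfps_coeff (indet n * g) m = (if n - 1 \<in># m then mfps_coeff g (m - {#n - 1#}) else 0)"
proof (cases "n - 1 \<in># m")
  case True
  have "mfps_coeff (indet n * g) m =
      (\<Sum>(k, l) \<in> {({#n - 1#}, m - {#n - 1#})}. mfps_coeff g l)"
    unfolding mfps_coeff_mult using finite_splittings[of m] True
    by (intro sum.mono_neutral_cong_right) (auto simp: indet_def split: if_splits)
  with True show ?thesis by simp
next
  case False
  then have "mfps_coeff (indet n * g) m = 0"
    unfolding mfps_coeff_mult by (intro sum.neutral) (auto simp: indet_def)
  with False show ?thesis by simp
qed

text \<open>Only the indeterminates that divide the monomial contribute, so the infinite sum is
  finite. It runs over the distinct elements of \<open>m\<close>, each counted once whatever its
  multiplicity.\<close>

lemma mfps_coeff_infsum_indet: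
  "mfps_coeff (mfps_infsum (\<lambda>n. indet n * g n) {1..}) m =
     (\<Sum>i\<in>set_mset m. mfps_coeff (g (Suc i)) (m - {#i#}))"
proof -
  let ?c = "\<lambda>n. mfps_coeff (indet n * g n) m"
  have "mfps_coeff (mfps_infsum (\<lambda>n. indet n * g n) {1..}) m =
      (\<Sum>n | n \<in> {1..} \<and> ?c n \<noteq> 0. ?c n)"
    by (simp add: mfps_infsum_def)
  also have "\<dots> = (\<Sum>n\<in>Suc ` set_mset m. ?c n)"
  proof (rule sum.mono_neutral_left)
    show "{n \<in> {1..}. ?c n \<noteq> 0} \<subseteq> Suc ` set_mset m"
    proof safe
      fix n :: nat assume "n \<ge> 1" "?c n \<noteq> 0"
      then have "n = Suc (n - 1)" "n - 1 \<in># m"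
        by (auto simp: mfps_coeff_indet_mult split: if_splits)
      then show "n \<in> Suc ` set_mset m" by blast
    qed
  qed auto
  also have "\<dots> = (\<Sum>i\<in>set_mset m. mfps_coeff (g (Suc i)) (m - {#i#}))"
    by (simp add: sum.reindex mfps_coeff_indet_mult)
  finally show ?thesis .
qed

text \<open>The index is shifted as in the encoding of monomials: the derivative is with respect to
  the indeterminate \<open>indet (Suc n)\<close>.\<close>
definition mfps_deriv :: "nat \<Rightarrow> 'a :: comm_ring_1 mfps \<Rightarrow> 'a mfps" where
  "mfps_deriv n f = Abs_mfps (\<lambda>m. of_nat (Suc (count m n)) * mfps_coeff f (add_mset n m))"

lemma mfps_coeff_deriv [simp]:
  "mfps_coeff (mfps_deriv n f) m = of_nat (Suc (count m n)) * mfps_coeff f (add_mset n m)"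
  by (simp add: mfps_deriv_def)

text \<open>One half of the Leibniz rule: terms in which \<open>n\<close> does not occur in
  \<open>k\<close> carry the factor 0, and in the others one occurrence of \<open>n\<close> is
  removed from \<open>k\<close>.\<close>

lemma sum_count_splittings:
  "(\<Sum>(k, l) | k + l = add_mset n m. of_nat (count k n) * F k l) =
   (\<Sum>(k, l) | k + l = m. of_nat (Suc (count k n)) * (F (add_mset n k) l :: 'a :: comm_ring_1))"
proof -
  have "(\<Sum>(k, l) | k + l = add_mset n m. of_nat (count k n) * F k l) =
      (\<Sum>(k, l) | k + l = add_mset n m \<and> n \<in># k. of_nat (count k n) * F k l)"
    by (intro sum.mono_neutral_right finite_subset[OF _ finite_splittings[of "add_mset n m"]])
      (auto simp flip: count_greater_zero_iff intro!: Nat.gr0I)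
  also have "\<dots> = (\<Sum>(k, l) | k + l = m. of_nat (Suc (count k n)) * F (add_mset n k) l)"
    by (rule sum.reindex_bij_witness[of _ "\<lambda>(k, l). (add_mset n k, l)" "\<lambda>(k, l). (k - {#n#}, l)"])
      (auto simp: diff_union_single_conv add.commute)
  finally show ?thesis .
qed

text \<open>The multiplicity of \<open>n\<close> in a product of monomials is the sum of its
  multiplicities in the factors; splitting the weight \<open>Suc (count m n)\<close> accordingly
  gives the two terms.\<close>

lemma mfps_deriv_mult: "mfps_deriv n (f * g) = mfps_deriv n f * g + f * mfps_deriv n g"
proof (rule mfps_eqI)
  fix m
  let ?f = "mfps_coeff f" and ?g = "mfps_coeff g" and ?M = "add_mset n m"
  have "mfps_coeff (mfps_deriv n (f * g)) m =
      (\<Sum>(k, l) | k + l = ?M. of_nat (Suc (count m n)) * (?f k * ?g l))"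
    by (simp add: mfps_coeff_mult sum_distrib_left case_prod_unfold)
  also have "\<dots> = (\<Sum>(k, l) | k + l = ?M. of_nat (count k n) * (?f k * ?g l) + of_nat (count l n) * (?f k * ?g l))"
  proof (rule sum.cong[OF refl])
    fix p assume "p \<in> {(k, l). k + l = ?M}"
    then obtain k l where p: "p = (k, l)" "k + l = ?M" by auto
    then have "count (k + l) n = Suc (count m n)" by simp
    then have "Suc (count m n) = count k n + count l n" by simp
    then show "(case p of (k, l) \<Rightarrow> of_nat (Suc (count m n)) * (?f k * ?g l)) =
        (case p of (k, l) \<Rightarrow> of_nat (count k n) * (?f k * ?g l) + of_nat (count l n) * (?f k * ?g l))"
      using p by (simp only: of_nat_add distrib_right prod.case)
  qed
  also have "\<dots> = (\<Sum>(k, l) | k + l = ?M. of_nat (count k n) * (?f k * ?g l)) +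
       (\<Sum>(k, l) | k + l = ?M. of_nat (count l n) * (?f k * ?g l))"
    by (simp add: sum.distrib case_prod_unfold)
  also have "(\<Sum>(k, l) | k + l = ?M. of_nat (count l n) * (?f k * ?g l)) =
       (\<Sum>(k, l) | k + l = ?M. of_nat (count k n) * (?f l * ?g k))"
    by (rule sum.reindex_bij_witness[of _ prod.swap prod.swap]) (auto simp: add.commute)
  also have "\<dots> = (\<Sum>(k, l) | k + l = m. of_nat (Suc (count k n)) * (?f l * ?g (add_mset n k)))"
    by (rule sum_count_splittings)
  also have "\<dots> = mfps_coeff (f * mfps_deriv n g) m"
    unfolding mfps_coeff_mult
    by (rule sum.reindex_bij_witness[of _ prod.swap prod.swap]) (auto simp: add.commute mult_ac)
  also have "(\<Sum>(k, l) | k + l = ?M. of_nat (count k n) * (?f k * ?g l)) =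
      (\<Sum>(k, l) | k + l = m. of_nat (Suc (count k n)) * (?f (add_mset n k) * ?g l))"
    by (rule sum_count_splittings)
  also have "\<dots> = mfps_coeff (mfps_deriv n f * g) m"
    unfolding mfps_coeff_mult by (simp add: mult_ac case_prod_unfold)
  finally show "mfps_coeff (mfps_deriv n (f * g)) m =
      mfps_coeff (mfps_deriv n f * g + f * mfps_deriv n g) m"
    by simp
qed

lemma mfps_deriv_1 [simp]: "mfps_deriv n 1 = 0"
  by (rule mfps_eqI) (simp add: mfps_coeff_1)

lemma mfps_deriv_diff [simp]: "mfps_deriv n (f - g) = mfps_deriv n f - mfps_deriv n g"
  by (rule mfps_eqI) (simp add: algebra_simps)

lemma mfps_deriv_const_mult [simp]:
  "mfps_deriv n (mfps_const c * f) = mfps_const c * mfps_deriv n f"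
  by (rule mfps_eqI) (simp add: mult.left_commute)

lemma mfps_deriv_power: "mfps_deriv n (f ^ Suc k) = of_nat (Suc k) * f ^ k * mfps_deriv n f"
proof (induction k)
  case (Suc k)
  have "mfps_deriv n (f ^ Suc (Suc k)) = mfps_deriv n f * f ^ Suc k + f * mfps_deriv n (f ^ Suc k)"
    by (simp only: power_Suc[of f "Suc k"] mfps_deriv_mult)
  then show ?case using Suc by (simp add: algebra_simps)
qed simp

section \<open>Composition with univariate series, exponential and logarithm\<close>

lemma mfps_coeff_power_eq_0:
  "mfps_coeff f {#} = 0 \<Longrightarrow> size m < k \<Longrightarrow> mfps_coeff (f ^ k) m = 0"
proof (induction k arbitrary: m)
  case (Suc k)
  have "mfps_coeff f a * mfps_coeff (f ^ k) b = 0" if "a + b = m" for a b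
  proof (cases "a = {#}")
    case False
    then have "size b < size m" using that by (auto simp: nonempty_has_size)
    then show ?thesis using Suc by simp
  qed (use Suc in simp)
  then show ?case
    by (auto simp: mfps_coeff_mult intro!: sum.neutral)
qed simp

text \<open>Since \<open>f\<close> has no constant term, \<open>f ^ k\<close> starts in total degree
  \<open>k\<close>. The bound \<open>K\<close> is left free so that all monomials occurring in one
  computation can share it.\<close>

lemma mfps_coeff_apply:
  assumes "mfps_coeff f {#} = 0" "size m \<le> K"
  shows "mfps_coeff (mfps_apply u f) m = (\<Sum>k\<le>K. fps_nth u k * mfps_coeff (f ^ k) m)"
  unfolding mfps_apply_def mfps_infsum_def mfps_coeff_Abs
proof (rule sum.mono_neutral_cong_left)
  show "{i \<in> UNIV. mfps_coeff (mfps_const (fps_nth u i) * f ^ i) m \<noteq> 0} \<subseteq> {..K}"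
  proof safe
    fix k assume *: "mfps_coeff (mfps_const (fps_nth u k) * f ^ k) m \<noteq> 0"
    have "\<not> size m < k" using mfps_coeff_power_eq_0[OF assms(1), of m k] * by auto
    then show "k \<le> K" using assms(2) by simp
  qed
qed auto

lemma mfps_apply_empty: 
  assumes "mfps_coeff f {#} = 0"
  shows "mfps_coeff (mfps_apply u f) {#} = fps_nth u 0"
  using mfps_coeff_apply[OF assms, of "{#}" 0 u] by (simp add: mfps_coeff_1)

lemma mfps_deriv_apply:
  assumes "mfps_coeff f {#} = 0"
  shows "mfps_deriv n (mfps_apply u f) = mfps_apply (fps_deriv u) f * mfps_deriv n f"
proof (rule mfps_eqI)
  fix m :: "nat multiset"
  define K where "K = size m"
  \<comment> \<open>The bound is \<open>Suc K\<close> because the derivative at \<open>m\<close>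
    reads the coefficient at \<open>add_mset n m\<close>; the extra index is used up by the term
    \<open>k = 0\<close>, whose derivative is 0.\<close>
  have "mfps_coeff (mfps_deriv n (mfps_apply u f)) m =
      (\<Sum>k\<le>Suc K. fps_nth u k * mfps_coeff (mfps_deriv n (f ^ k)) m)"
    by (simp add: mfps_coeff_apply[OF assms, of _ "Suc K"] K_def sum_distrib_left algebra_simps)
  also have "\<dots> = (\<Sum>k\<le>K. fps_nth u (Suc k) * mfps_coeff (mfps_deriv n (f ^ Suc k)) m)"
    by (subst sum.atMost_Suc_shift) (simp only: power_0 mfps_deriv_1 mfps_coeff_0 mult_zero_right add_0_left)
  also have "\<dots> = (\<Sum>k\<le>K. \<Sum>(a, b) | a + b = m.
      fps_nth (fps_deriv u) k * mfps_coeff (f ^ k) a * mfps_coeff (mfps_deriv n f) b)"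
    unfolding mfps_deriv_power mult.assoc mfps_coeff_of_nat_mult mfps_coeff_mult[of "f ^ _"]
    by (simp add: sum_distrib_left case_prod_unfold mult_ac)
  also have "\<dots> = (\<Sum>(a, b) | a + b = m. \<Sum>k\<le>K.
      fps_nth (fps_deriv u) k * mfps_coeff (f ^ k) a * mfps_coeff (mfps_deriv n f) b)"
    by (subst sum.swap) (simp add: case_prod_unfold)
  also have "\<dots> = (\<Sum>(a, b) | a + b = m. mfps_coeff (mfps_apply (fps_deriv u) f) a * mfps_coeff (mfps_deriv n f) b)"
    by (intro sum.cong refl) (auto simp: K_def mfps_coeff_apply[OF assms, of _ K] sum_distrib_right)
  also have "\<dots> = mfps_coeff (mfps_apply (fps_deriv u) f * mfps_deriv n f) m"
    by (simp add: mfps_coeff_mult)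
  finally show "mfps_coeff (mfps_deriv n (mfps_apply u f)) m =
      mfps_coeff (mfps_apply (fps_deriv u) f * mfps_deriv n f) m" .
qed

lemma mfps_apply_add: 
  assumes "mfps_coeff f {#} = 0"
  shows "mfps_apply (u + v) f = mfps_apply u f + mfps_apply v f"
  by (rule mfps_eqI) (simp add: mfps_coeff_apply[OF assms order_refl] sum.distrib distrib_right)

lemma mfps_apply_X_mult: 
  assumes "mfps_coeff f {#} = 0"
  shows "mfps_apply (fps_X * u) f = f * mfps_apply u f"
proof (rule mfps_eqI)
  fix m :: "nat multiset"
  define K where "K = size m"
  have "mfps_coeff (mfps_apply (fps_X * u) f) m =
      (\<Sum>k\<le>Suc K. fps_nth (fps_X * u) k * mfps_coeff (f ^ k) m)"
    by (rule mfps_coeff_apply[OF assms]) (simp add: K_def)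
  also have "\<dots> = (\<Sum>k\<le>K. fps_nth u k * mfps_coeff (f ^ Suc k) m)"
    by (subst sum.atMost_Suc_shift) simp
  also have "\<dots> = (\<Sum>k\<le>K. \<Sum>(a, b) | a + b = m. mfps_coeff f a * (fps_nth u k * mfps_coeff (f ^ k) b))"
    by (simp add: mfps_coeff_mult sum_distrib_left case_prod_unfold mult_ac)
  also have "\<dots> = (\<Sum>(a, b) | a + b = m. \<Sum>k\<le>K. mfps_coeff f a * (fps_nth u k * mfps_coeff (f ^ k) b))"
    by (subst sum.swap) (simp add: case_prod_unfold)
  also have "\<dots> = (\<Sum>(a, b) | a + b = m. mfps_coeff f a * mfps_coeff (mfps_apply u f) b)"
    by (intro sum.cong refl) (auto simp: K_def mfps_coeff_apply[OF assms, of _ K] sum_distrib_left)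
  finally show "mfps_coeff (mfps_apply (fps_X * u) f) m = mfps_coeff (f * mfps_apply u f) m"
    by (simp add: mfps_coeff_mult)
qed

lemma mfps_apply_1: 
  assumes "mfps_coeff f {#} = 0"
  shows "mfps_apply 1 f = 1"
  by (rule mfps_eqI) (simp add: mfps_coeff_apply[OF assms order_refl] if_distrib if_distribR cong: if_cong)

lemma mfps_log_empty: "mfps_coeff Z {#} = 1 \<Longrightarrow> mfps_coeff (mfps_log Z) {#} = 0"
  unfolding mfps_log_def by (subst mfps_apply_empty) (auto simp: mfps_coeff_1 fps_ln_def)

text \<open>The derivative u of log(1 + x) satisfies u + x u = 1. Substituting f = Z - 1 gives (1 +
  f) u(f) = 1, so u(f) is the inverse of Z; additivity and multiplication by \<open>fps_X\<close>
  are the composition rules at work.\<close>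

lemma mfps_apply_ln_deriv:
  fixes Z :: "real mfps"
  assumes "mfps_coeff Z {#} = 1"
  shows "Z * mfps_apply (fps_deriv (fps_ln 1)) (Z - 1) = 1"
proof -
  define u :: "real fps" where "u = fps_deriv (fps_ln 1)"
  have u: "u + fps_X * u = 1"
  proof -
    have "u * (1 + fps_X) = 1" unfolding u_def fps_ln_deriv
      using inverse_mult_eq_1[of "1 + fps_X :: real fps"] by simp
    then show ?thesis by (simp add: algebra_simps)
  qed
  define f where "f = Z - 1"
  have f: "mfps_coeff f {#} = 0" using assms by (simp add: f_def mfps_coeff_1)
  have "Z * mfps_apply u f = mfps_apply u f + f * mfps_apply u f"
    by (simp add: f_def algebra_simps)
  also have "\<dots> = mfps_apply (u + fps_X * u) f"
    by (simp add: mfps_apply_add mfps_apply_X_mult f)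
  finally show ?thesis by (simp add: u mfps_apply_1 f flip: u_def f_def)
qed

lemma mfps_unit:
  fixes Z :: "real mfps"
  shows "mfps_coeff Z {#} = 1 \<Longrightarrow> \<exists>V. V * Z = 1"
  using mfps_apply_ln_deriv[of Z] by (metis mult.commute)

lemma mfps_log_deriv:
  assumes "mfps_coeff Z {#} = 1"
  shows "mfps_deriv n Z = Z * mfps_deriv n (mfps_log Z)"
proof -
  have f: "mfps_coeff (Z - 1) {#} = 0" using assms by (simp add: mfps_coeff_1)
  have "Z * mfps_deriv n (mfps_log Z) =
      Z * mfps_apply (fps_deriv (fps_ln 1)) (Z - 1) * mfps_deriv n (Z - 1)"
    unfolding mfps_log_def mfps_deriv_apply[OF f] by (simp only: mult.assoc)
  then show ?thesis by (simp add: mfps_apply_ln_deriv[OF assms])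
qed

lemma mfps_exp_deriv:
  "mfps_coeff f {#} = 0 \<Longrightarrow> mfps_deriv n (mfps_exp f) = mfps_exp f * mfps_deriv n f"
  by (simp add: mfps_exp_def mfps_deriv_apply)

lemma mfps_exp_empty: "mfps_coeff f {#} = 0 \<Longrightarrow> mfps_coeff (mfps_exp f) {#} = 1"
  by (simp add: mfps_exp_def mfps_apply_empty)

section \<open>Weighted degree and the substitution \<open>a_n := e n * fps_X ^ n\<close>\<close>

definition mweight :: "nat multiset \<Rightarrow> nat" where "mweight m = (\<Sum>i\<in>#m. Suc i)"

lemma mweight_simps [simp]:
  "mweight {#} = 0" "mweight (add_mset i m) = Suc i + mweight m" "mweight (k + l) = mweight k + mweight l"
  by (simp_all add: mweight_def)

lemma sum_mset_count:
  fixes f :: "'b \<Rightarrow> 'a :: comm_semiring_1"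
  shows "finite A \<Longrightarrow> set_mset m \<subseteq> A \<Longrightarrow> (\<Sum>i\<in>#m. f i) = (\<Sum>i\<in>A. of_nat (count m i) * f i)"
proof (induction m)
  case (add x m)
  have "(\<Sum>i\<in>A. of_nat (count (add_mset x m) i) * f i) =
      (\<Sum>i\<in>A. of_nat (count m i) * f i + (if i = x then f x else 0))"
    by (intro sum.cong) (auto simp: algebra_simps)
  with add show ?case by (simp only: sum.distrib) (simp add: add.commute)
qed simp

text \<open>In a multiset of weight \<open>k\<close> all elements and all multiplicities are bounded
  by \<open>k\<close>, hence it lies below one fixed multiset \<open>U\<close>. This finiteness
  makes the substitution a finite sum in each degree.\<close>

lemma finite_mweight: "finite {m. mweight m = k}"
proof (rule finite_subset)
  define U where "U = (\<Sum>i<k. replicate_mset k i)"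
  show "{m. mweight m = k} \<subseteq> {m. m \<subseteq># U}"
  proof safe
    fix m assume "k = mweight m"
    have c: "count m i \<le> mweight m \<and> (i \<in># m \<longrightarrow> i < mweight m)" for i
      by (induction m) auto
    have U: "count U i = (if i < k then k else 0)" for i
      unfolding U_def by (simp add: count_sum)
    show "m \<subseteq># U"
    proof (rule mset_subset_eqI)
      fix i show "count m i \<le> count U i"
        using c[of i] \<open>k = _\<close> by (auto simp: U not_in_iff)
    qed
  qed
qed (rule finite_submultisets)

text \<open>Covers both specialisations: \<open>e\<close> is constantly 1 or the indicator of the
  even numbers.\<close>

definition power_weights :: "(nat \<Rightarrow> 'a) \<Rightarrow> nat \<Rightarrow> 'a :: comm_ring_1 fps" where
  "power_weights e n = fps_const (e n) * fps_X ^ n"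

definition mprod :: "(nat \<Rightarrow> 'a) \<Rightarrow> nat multiset \<Rightarrow> 'a :: comm_ring_1" where
  "mprod e m = (\<Prod>i\<in>#m. e (Suc i))"

lemma mprod_simps [simp]:
  "mprod e {#} = 1" "mprod e (add_mset i m) = e (Suc i) * mprod e m" "mprod e (k + l) = mprod e k * mprod e l"
  by (simp_all add: mprod_def)

text \<open>The image of a monomial is a constant times \<open>fps_X ^ mweight m\<close>, so index
  \<open>k\<close> collects exactly the monomials of weight \<open>k\<close>. The homomorphism laws
  below rest on this form.\<close>

lemma fps_nth_subst:
  "fps_nth (mfps_subst (power_weights e) f) k = (\<Sum>m | mweight m = k. mfps_coeff f m * mprod e m)"
proof -
  have p: "(\<Prod>i\<in>#m. power_weights e (Suc i)) = fps_const (mprod e m) * fps_X ^ mweight m" for m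
  proof (induction m)
    case (add i m)
    have "(\<Prod>i\<in>#add_mset i m. power_weights e (Suc i)) =
        power_weights e (Suc i) * (fps_const (mprod e m) * fps_X ^ mweight m)"
      using add.IH by simp
    then show ?case
      by (simp add: power_weights_def power_add mult_ac flip: fps_const_mult)
  qed simp
  have nth: "fps_nth (\<Prod>i\<in>#m. power_weights e (Suc i)) k = (if mweight m = k then mprod e m else 0)" for m
    by (simp only: p fps_mult_left_const_nth fps_X_power_nth) simp
  show ?thesis
    unfolding mfps_subst_def Let_def fps_nth_Abs_fps nth
    by (rule sum.mono_neutral_cong_left) (auto simp: finite_mweight)
qed

lemma mfps_subst_add:
  "mfps_subst (power_weights e) (f + g) = mfps_subst (power_weights e) f + mfps_subst (power_weights e) g"
  by (rule fps_ext) (simp add: fps_nth_subst distrib_right sum.distrib)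

lemma mfps_subst_1: "mfps_subst (power_weights e) 1 = 1"
proof (rule fps_ext)
  fix k
  have "fps_nth (mfps_subst (power_weights e) 1) k = (\<Sum>m | mweight m = k. if m = {#} then 1 else 0)"
    unfolding fps_nth_subst by (rule sum.cong) (auto simp: mfps_coeff_1)
  then show "fps_nth (mfps_subst (power_weights e) 1) k = fps_nth 1 k"
    by (simp add: finite_mweight)
qed

lemma mfps_subst_mult:
  "mfps_subst (power_weights e) (f * g) = mfps_subst (power_weights e) f * mfps_subst (power_weights e) g"
proof (rule fps_ext)
  fix k
  let ?t = "\<lambda>(a, b). (mfps_coeff f a * mprod e a) * (mfps_coeff g b * mprod e b)"
  have "fps_nth (mfps_subst (power_weights e) (f * g)) k =
      (\<Sum>m | mweight m = k. \<Sum>p | fst p + snd p = m. ?t p)"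
    unfolding fps_nth_subst mfps_coeff_mult sum_distrib_right
    by (intro sum.cong refl) (auto simp: mult_ac)
  also have "\<dots> = (\<Sum>(m, p) \<in> (SIGMA m:{m. mweight m = k}. {p. fst p + snd p = m}). ?t p)"
    using finite_splittings by (subst sum.Sigma) (auto simp: finite_mweight case_prod_unfold)
  also have "\<dots> = (\<Sum>(i, a, b) \<in> (SIGMA i:{..k}. {a. mweight a = i} \<times> {b. mweight b = k - i}). ?t (a, b))"
    by (rule sum.reindex_bij_witness[of _ "\<lambda>(i, a, b). (a + b, (a, b))" "\<lambda>(m, p). (mweight (fst p), p)"]) auto
  also have "\<dots> = (\<Sum>i\<le>k. \<Sum>(a, b)\<in>{a. mweight a = i} \<times> {b. mweight b = k - i}. ?t (a, b))"
    by (subst sum.Sigma) (auto simp: finite_mweight case_prod_unfold)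
  also have "\<dots> = fps_nth (mfps_subst (power_weights e) f * mfps_subst (power_weights e) g) k"
    by (simp add: fps_mult_nth fps_nth_subst sum_product sum.cartesian_product atLeast0AtMost)
  finally show "fps_nth (mfps_subst (power_weights e) (f * g)) k =
      fps_nth (mfps_subst (power_weights e) f * mfps_subst (power_weights e) g) k" .
qed

lemma mfps_subst_power: "mfps_subst (power_weights e) (f ^ n) = mfps_subst (power_weights e) f ^ n"
  by (induction n) (simp_all add: mfps_subst_1 mfps_subst_mult)

lemma mfps_subst_0: "mfps_subst (power_weights e) 0 = 0"
  by (rule fps_ext) (simp add: fps_nth_subst)

lemma mfps_subst_sum: "mfps_subst (power_weights e) (sum f A) = (\<Sum>i\<in>A. mfps_subst (power_weights e) (f i))"
  by (induction A rule: infinite_finite_induct) (auto simp: mfps_subst_0 mfps_subst_add)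

lemma mfps_subst_of_nat: "mfps_subst (power_weights e) (of_nat n) = of_nat n"
  by (induction n) (auto simp: mfps_subst_0 mfps_subst_1 mfps_subst_add)

text \<open>A monomial with a chosen element corresponds to the index \<open>n\<close> of that
  element with the remaining monomial, whose weight is lower by \<open>n\<close>.\<close>

lemma fps_nth_subst_infsum:
  "fps_nth (mfps_subst (power_weights e) (mfps_infsum (\<lambda>n. indet n * g n) {1..})) k =
     (\<Sum>n=1..k. e n * fps_nth (mfps_subst (power_weights e) (g n)) (k - n))"
proof -
  let ?t = "\<lambda>(i, a). e (Suc i) * (mfps_coeff (g (Suc i)) a * mprod e a)"
  have "fps_nth (mfps_subst (power_weights e) (mfps_infsum (\<lambda>n. indet n * g n) {1..})) k =
     (\<Sum>m | mweight m = k. \<Sum>i\<in>set_mset m. ?t (i, m - {#i#}))"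
    unfolding fps_nth_subst mfps_coeff_infsum_indet sum_distrib_right
  proof (intro sum.cong refl)
    fix m :: "nat multiset" and i assume "i \<in># m"
    then have "mprod e m = e (Suc i) * mprod e (m - {#i#})"
      using mprod_simps(2)[of e i "m - {#i#}"] by simp
    then show "mfps_coeff (g (Suc i)) (m - {#i#}) * mprod e m = ?t (i, m - {#i#})"
      by (simp add: mult_ac)
  qed
  also have "\<dots> = (\<Sum>(m, i)\<in>(SIGMA m:{m. mweight m = k}. set_mset m). ?t (i, m - {#i#}))"
    by (subst sum.Sigma) (auto simp: finite_mweight)
  also have "\<dots> = (\<Sum>(n, a)\<in>(SIGMA n:{1..k}. {a. mweight a = k - n}). ?t (n - 1, a))"
  proof (rule sum.reindex_bij_witness[of _ "\<lambda>(n, a). (add_mset (n - 1) a, n - 1)" "\<lambda>(m, i). (Suc i, m - {#i#})"])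
    fix p assume "p \<in> (SIGMA m:{m. mweight m = k}. set_mset m)"
    then obtain m i where p: "p = (m, i)" "i \<in># m" "mweight m = k" by auto
    then obtain a where "m = add_mset i a" by (meson multi_member_split)
    with p show "(case case p of (m, i) \<Rightarrow> (Suc i, m - {#i#}) of (n, a) \<Rightarrow> (add_mset (n - 1) a, n - 1)) = p"
      "(case p of (m, i) \<Rightarrow> (Suc i, m - {#i#})) \<in> (SIGMA n:{1..k}. {a. mweight a = k - n})"
      by auto
  qed auto
  also have "\<dots> = (\<Sum>n=1..k. \<Sum>a | mweight a = k - n. ?t (n - 1, a))"
    by (subst sum.Sigma) (auto simp: finite_mweight case_prod_unfold)
  also have "\<dots> = (\<Sum>n=1..k. e n * fps_nth (mfps_subst (power_weights e) (g n)) (k - n))"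
    by (intro sum.cong refl) (auto simp: fps_nth_subst sum_distrib_left)
  finally show ?thesis .
qed

text \<open>Euler's identity for weighted homogeneous series: the sum of n a_n d/da_n multiplies a
  monomial by its weight. It expresses the derivative with respect to \<open>fps_X\<close> through
  the planar moments.\<close>

lemma mfps_subst_euler:
  "of_nat k * fps_nth (mfps_subst (power_weights e) f) k =
     (\<Sum>n=1..k. e n * fps_nth (mfps_subst (power_weights e) (of_nat n * mfps_deriv (n - 1) f)) (k - n))"
proof -
  let ?E = "mfps_infsum (\<lambda>n. indet n * (of_nat n * mfps_deriv (n - 1) f)) {1..}"
  have "mfps_coeff ?E m = of_nat (mweight m) * mfps_coeff f m" for m :: "nat multiset"
  proof -
    have "mfps_coeff ?E m = (\<Sum>i\<in>set_mset m. of_nat (Suc i) * (of_nat (count m i) * mfps_coeff f m))"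
      unfolding mfps_coeff_infsum_indet
      by (intro sum.cong refl) (auto simp flip: of_nat_Suc)
    also have "\<dots> = of_nat (\<Sum>i\<in>set_mset m. Suc i * count m i) * mfps_coeff f m"
      by (simp only: of_nat_sum sum_distrib_right of_nat_mult mult.assoc)
    also have "(\<Sum>i\<in>set_mset m. Suc i * count m i) = mweight m"
      unfolding mweight_def by (subst sum_mset_count[OF finite_set_mset order_refl]) (simp add: mult.commute)
    finally show ?thesis .
  qed
  then have "fps_nth (mfps_subst (power_weights e) ?E) k = of_nat k * fps_nth (mfps_subst (power_weights e) f) k"
    by (simp add: fps_nth_subst sum_distrib_left mult_ac)
  then show ?thesis unfolding fps_nth_subst_infsum by (rule sym)
qed

section \<open>Gaussian integration by parts for Hermitian matrices\<close>

definition gauss_moment :: "real \<Rightarrow> nat \<Rightarrow> real" where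
  "gauss_moment c k = (\<integral>y. y ^ k * exp (- (c * y ^ 2 / 2)) \<partial>lborel)"

text \<open>Rescaling of the moments of the normal density with variance 1/c;
  \<open>has_bochner_integral\<close> records integrability and value together.\<close>

lemma gauss_moment_bochner:
  fixes c :: real
  assumes "c > 0"
  shows "has_bochner_integral lborel (\<lambda>y. y ^ (2 * k) * exp (- (c * y ^ 2 / 2)))
      (sqrt (2 * pi / c) * (fact (2 * k) / ((2 * c) ^ k * fact k)))"
    and "has_bochner_integral lborel (\<lambda>y. y ^ (2 * k + 1) * exp (- (c * y ^ 2 / 2))) 0"
proof -
  define \<sigma> where "\<sigma> = 1 / sqrt c"
  have \<sigma>: "\<sigma> > 0" "\<sigma>\<^sup>2 = 1 / c"
    using assms by (simp_all add: \<sigma>_def power_divide)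
  have e: "sqrt (2 * pi / c) * (normal_density 0 \<sigma> y * f) = f * exp (- (c * y ^ 2 / 2))" for y f
    using assms by (simp add: normal_density_def \<sigma>(2))
  show "has_bochner_integral lborel (\<lambda>y. y ^ (2 * k) * exp (- (c * y ^ 2 / 2)))
      (sqrt (2 * pi / c) * (fact (2 * k) / ((2 * c) ^ k * fact k)))"
    using has_bochner_integral_mult_right[OF normal_moment_even[OF \<sigma>(1), of 0 k], of "sqrt (2 * pi / c)"]
    by (simp add: e \<sigma>(2))
  show "has_bochner_integral lborel (\<lambda>y. y ^ (2 * k + 1) * exp (- (c * y ^ 2 / 2))) 0"
    using has_bochner_integral_mult_right[OF normal_moment_odd[OF \<sigma>(1), of 0 k], of "sqrt (2 * pi / c)"]
    by (simp add: e)
qed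

lemma gauss_moment_integrable:
  fixes c :: real
  assumes "c > 0"
  shows "integrable lborel (\<lambda>y :: real. y ^ k * exp (- (c * y ^ 2 / 2)))"
proof (cases "even k")
  case True
  then obtain j where "k = 2 * j" by (elim evenE)
  then show ?thesis using gauss_moment_bochner(1)[OF assms, of j] by (auto intro: integrable.intros)
next
  case False
  then obtain j where "k = 2 * j + 1" by (elim oddE)
  then show ?thesis using gauss_moment_bochner(2)[OF assms, of j] by (auto intro: integrable.intros)
qed

lemma gauss_moment_even: 
  "c > 0 \<Longrightarrow> gauss_moment c (2 * k) = sqrt (2 * pi / c) * (fact (2 * k) / ((2 * c) ^ k * fact k))"
  unfolding gauss_moment_def by (rule has_bochner_integral_integral_eq[OF gauss_moment_bochner(1)])

lemma gauss_moment_odd: "c > 0 \<Longrightarrow> gauss_moment c (Suc (2 * k)) = 0"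
  unfolding gauss_moment_def using has_bochner_integral_integral_eq[OF gauss_moment_bochner(2)[of c k]] by simp

lemma gauss_moment_0_pos: "c > 0 \<Longrightarrow> gauss_moment c 0 > 0"
  using gauss_moment_even[of c 0] by simp

text \<open>One-dimensional integration by parts, read off from the moment formulas. For
  \<open>k = 0\<close> the truncated \<open>k - 1\<close> is harmless because of the factor
  \<open>real k\<close>.\<close>

lemma gauss_moment_Suc:
  assumes "c > 0"
  shows "c * gauss_moment c (Suc k) = real k * gauss_moment c (k - 1)"
proof (cases "even k")
  case True
  then obtain j where k: "k = 2 * j" by (elim evenE)
  show ?thesis
  proof (cases j)
    case 0
    then show ?thesis using gauss_moment_odd[OF assms, of 0] by (simp add: k)
  next
    case (Suc i)
    then show ?thesis using gauss_moment_odd[OF assms, of j] gauss_moment_odd[OF assms, of i] by (simp add: k)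
  qed
next
  case False
  then obtain j where k: "k = Suc (2 * j)" by (auto elim: oddE)
  have gen: "c * (K * ((2 * a * (m * f)) / ((2 * c * P) * (a * g)))) = m * (K * (f / (P * g)))"
    if "a \<noteq> 0" "P \<noteq> 0" "g \<noteq> 0" for a m f P g K :: real
    using assms that by (simp add: field_simps)
  have f: "(fact (2 * Suc j) :: real) = 2 * real (Suc j) * (real k * fact (2 * j))"
    by (simp add: k algebra_simps)
  have "c * gauss_moment c (2 * Suc j) = real k * gauss_moment c (2 * j)"
    unfolding gauss_moment_even[OF assms] f power_Suc fact_Suc[of j] of_nat_mult of_nat_fact
    by (rule gen) (use assms in auto)
  then show ?thesis by (simp add: k)
qed

context
  fixes N :: nat
  assumes N: "N > 0"
begin

section \<open>Gaussian integrals over the real coordinates of Hermitian matrices\<close>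

definition hidx :: "(nat \<times> nat) set" where "hidx = {..<N} \<times> {..<N}"

text \<open>In Tr M^2 the square of a diagonal coordinate appears once, that of an off-diagonal
  coordinate twice, since the entries (i, j) and (j, i) both contain it.\<close>

definition hprec :: "nat \<times> nat \<Rightarrow> real" where
  "hprec p = (if fst p = snd p then real N else 2 * real N)"

definition hmono :: "(nat \<times> nat \<Rightarrow> nat) \<Rightarrow> (nat \<times> nat \<Rightarrow> real) \<Rightarrow> complex" where
  "hmono \<alpha> x = (\<Prod>p\<in>hidx. of_real (x p ^ \<alpha> p))"

definition hweight :: "(nat \<times> nat \<Rightarrow> real) \<Rightarrow> real" where
  "hweight x = (\<Prod>p\<in>hidx. exp (- (hprec p * x p ^ 2 / 2)))"

definition hint :: "((nat \<times> nat \<Rightarrow> real) \<Rightarrow> complex) \<Rightarrow> complex" where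
  "hint f = (LINT x|herm_measure N. f x * of_real (hweight x))"

lemma finite_hidx [simp]: "finite hidx" by (simp add: hidx_def)

lemma hprec_pos: "hprec p > 0" using N by (simp add: hprec_def)

interpretation lb: product_sigma_finite "\<lambda>_ :: nat \<times> nat. lborel :: real measure"
  by standard

lemma hmono_hweight:
  "hmono \<alpha> x * of_real (hweight x) =
     (\<Prod>p\<in>hidx. complex_of_real (x p ^ \<alpha> p * exp (- (hprec p * x p ^ 2 / 2))))"
  by (simp add: hmono_def hweight_def prod.distrib)

lemma herm_measure_eq: "herm_measure N = Pi\<^sub>M hidx (\<lambda>_. lborel)"
  by (simp add: herm_measure_def hidx_def)

lemma hmono_integrable: "integrable (herm_measure N) (\<lambda>x. hmono \<alpha> x * of_real (hweight x))"
  unfolding hmono_hweight herm_measure_eq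
  using gauss_moment_integrable[OF hprec_pos]
  by (intro lb.product_integrable_prod finite_hidx integrable_of_real)

lemma hint_hmono: "hint (hmono \<alpha>) = (\<Prod>p\<in>hidx. of_real (gauss_moment (hprec p) (\<alpha> p)))"
proof -
  have "hint (hmono \<alpha>) = (\<Prod>p\<in>hidx. \<integral>y. complex_of_real (y ^ \<alpha> p * exp (- (hprec p * y ^ 2 / 2))) \<partial>lborel)"
    unfolding hint_def hmono_hweight herm_measure_eq
    by (intro lb.product_integral_prod finite_hidx integrable_of_real gauss_moment_integrable hprec_pos)
  then show ?thesis by (simp only: integral_complex_of_real gauss_moment_def)
qed

text \<open>Polynomials in the real coordinates with complex coefficients. With monomials and sums
  as the only constructors, additive properties need to be checked on monomials alone, where the
  integral factorises into one-dimensional moments.\<close>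

inductive hpoly :: "((nat \<times> nat \<Rightarrow> real) \<Rightarrow> complex) \<Rightarrow> bool" where
  mono: "hpoly (\<lambda>x. c * hmono \<alpha> x)"
| add: "hpoly f \<Longrightarrow> hpoly g \<Longrightarrow> hpoly (\<lambda>x. f x + g x)"

lemma hpoly_const: "hpoly (\<lambda>_. c)"
  using hpoly.mono[of c "\<lambda>_. 0"] by (simp add: hmono_def)

lemma hmono_mult: "hmono \<alpha> x * hmono \<beta> x = hmono (\<lambda>p. \<alpha> p + \<beta> p) x"
  by (simp add: hmono_def power_add prod.distrib)

lemma hpoly_mult: "hpoly f \<Longrightarrow> hpoly g \<Longrightarrow> hpoly (\<lambda>x. f x * g x)"
proof (induction rule: hpoly.induct)
  case (mono c \<alpha>)
  then show ?case
  proof (induction rule: hpoly.induct)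
    case (mono d \<beta>)
    have "(\<lambda>x. (c * hmono \<alpha> x) * (d * hmono \<beta> x)) = (\<lambda>x. (c * d) * hmono (\<lambda>p. \<alpha> p + \<beta> p) x)"
      by (simp add: hmono_mult[symmetric] mult_ac)
    then show ?case using hpoly.mono by presburger
  next
    case (add f g)
    then show ?case using hpoly.add by (simp add: distrib_left)
  qed
next
  case (add f g)
  then show ?case using hpoly.add by (simp add: distrib_right)
qed

lemma hpoly_sum: "(\<And>i. i \<in> A \<Longrightarrow> hpoly (f i)) \<Longrightarrow> hpoly (\<lambda>x. \<Sum>i\<in>A. f i x)"
  by (induction A rule: infinite_finite_induct) (auto simp: hpoly_const intro: hpoly.add)

lemma hpoly_cmult: "hpoly f \<Longrightarrow> hpoly (\<lambda>x. c * f x)"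
  by (rule hpoly_mult[OF hpoly_const])

lemma hmono_update:
  assumes "p \<in> hidx"
  shows "hmono \<alpha> (x(p := y)) = of_real (y ^ \<alpha> p) * (\<Prod>q\<in>hidx - {p}. of_real (x q ^ \<alpha> q))"
  unfolding hmono_def using assms by (subst prod.remove[of _ p]) auto

lemma hmono_Suc:
  assumes "p \<in> hidx"
  shows "of_real (x p) * hmono \<alpha> x = hmono (\<alpha>(p := Suc (\<alpha> p))) x"
  using hmono_update[OF assms, of \<alpha> x "x p"] hmono_update[OF assms, of "\<alpha>(p := Suc (\<alpha> p))" x "x p"]
  by simp

lemma hpoly_coord: "p \<in> hidx \<Longrightarrow> hpoly (\<lambda>x. of_real (x p))"
  using hmono_Suc[of p _ "\<lambda>_. 0"] hpoly.mono[of 1 "(\<lambda>_. 0)(p := Suc 0)"]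
  by (simp add: hmono_def)

lemma hpoly_integrable: "hpoly f \<Longrightarrow> integrable (herm_measure N) (\<lambda>x. f x * of_real (hweight x))"
proof (induction rule: hpoly.induct)
  case (mono c \<alpha>)
  show ?case using integrable_mult_right[OF hmono_integrable[of \<alpha>], of c] by (simp add: mult.assoc)
next
  case (add f g)
  then show ?case by (simp add: distrib_right)
qed

lemma hint_add: "hpoly f \<Longrightarrow> hpoly g \<Longrightarrow> hint (\<lambda>x. f x + g x) = hint f + hint g"
  unfolding hint_def distrib_right by (intro Bochner_Integration.integral_add hpoly_integrable)

lemma hint_cmult: "hint (\<lambda>x. c * f x) = c * hint f"
  unfolding hint_def mult.assoc by (rule integral_mult_right_zero)

lemma hint_sum: "(\<And>i. i \<in> A \<Longrightarrow> hpoly (f i)) \<Longrightarrow> hint (\<lambda>x. \<Sum>i\<in>A. f i x) = (\<Sum>i\<in>A. hint (f i))"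
proof (induction A rule: infinite_finite_induct)
  case (insert a A)
  then show ?case by (simp add: hint_add hpoly_sum)
qed (auto simp: hint_def)

lemma hint_sum2:
  assumes "\<And>i j. i \<in> A \<Longrightarrow> j \<in> B \<Longrightarrow> hpoly (f i j)"
  shows "hint (\<lambda>x. \<Sum>i\<in>A. \<Sum>j\<in>B. f i j x) = (\<Sum>i\<in>A. \<Sum>j\<in>B. hint (f i j))"
proof -
  have "hint (\<lambda>x. \<Sum>i\<in>A. \<Sum>j\<in>B. f i j x) = (\<Sum>i\<in>A. hint (\<lambda>x. \<Sum>j\<in>B. f i j x))"
    by (intro hint_sum hpoly_sum assms)
  also have "\<dots> = (\<Sum>i\<in>A. \<Sum>j\<in>B. hint (f i j))"
    by (intro sum.cong refl hint_sum assms)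
  finally show ?thesis .
qed

text \<open>On monomials this is \<open>gauss_moment_Suc\<close> in the coordinate \<open>p\<close>.
  The derivative is produced together with its polynomiality because the additive case needs both
  derivatives to be integrable.\<close>

lemma hint_by_parts_ex:
  assumes "hpoly f" "p \<in> hidx"
  shows "\<exists>f'. hpoly f' \<and> (\<forall>x. ((\<lambda>y. f (x(p := y))) has_vector_derivative f' x) (at (x p))) \<and>
    of_real (hprec p) * hint (\<lambda>x. of_real (x p) * f x) = hint f'"
  using assms(1)
proof (induction rule: hpoly.induct)
  case (mono c \<alpha>)
  define a where "a = \<alpha> p"
  define f' where "f' = (\<lambda>x. (c * of_nat a) * hmono (\<alpha>(p := a - 1)) x)"
  have "hpoly f'" unfolding f'_def by (rule hpoly.mono)
  moreover have "((\<lambda>y. c * hmono \<alpha> (x(p := y))) has_vector_derivative f' x) (at (x p))" for x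
  proof -
    let ?P = "(\<Prod>q\<in>hidx - {p}. of_real (x q ^ \<alpha> q)) :: complex"
    have "((\<lambda>y. y ^ a) has_real_derivative real a * x p ^ (a - 1)) (at (x p))"
      by (auto intro!: derivative_eq_intros)
    then have "((\<lambda>y. c * (complex_of_real (y ^ a) * ?P)) has_vector_derivative
        c * (complex_of_real (real a * x p ^ (a - 1)) * ?P)) (at (x p))"
      by (intro has_vector_derivative_mult_right has_vector_derivative_mult_left has_vector_derivative_of_real)
        (simp add: has_real_derivative_iff_has_vector_derivative)
    moreover have "f' x = c * (complex_of_real (real a * x p ^ (a - 1)) * ?P)"
      using hmono_update[OF assms(2), of "\<alpha>(p := a - 1)" x "x p"]
      by (simp add: f'_def)
    ultimately show ?thesis by (simp add: hmono_update[OF assms(2)] a_def)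
  qed
  moreover have "of_real (hprec p) * hint (\<lambda>x. of_real (x p) * (c * hmono \<alpha> x)) = hint f'"
  proof -
    let ?Q = "(\<Prod>q\<in>hidx - {p}. of_real (gauss_moment (hprec q) (\<alpha> q))) :: complex"
    have "hint (\<lambda>x. of_real (x p) * (c * hmono \<alpha> x)) = c * hint (hmono (\<alpha>(p := Suc a)))"
      by (simp add: mult.left_commute[of _ c] hint_cmult hmono_Suc[OF assms(2)] a_def)
    also have "hint (hmono (\<alpha>(p := Suc a))) = of_real (gauss_moment (hprec p) (Suc a)) * ?Q"
      unfolding hint_hmono using assms(2) by (subst prod.remove[of _ p]) auto
    finally have 1: "hint (\<lambda>x. of_real (x p) * (c * hmono \<alpha> x)) = c * (of_real (gauss_moment (hprec p) (Suc a)) * ?Q)" .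
    have "hint f' = c * of_nat a * hint (hmono (\<alpha>(p := a - 1)))"
      by (simp add: f'_def hint_cmult)
    also have "hint (hmono (\<alpha>(p := a - 1))) = of_real (gauss_moment (hprec p) (a - 1)) * ?Q"
      unfolding hint_hmono using assms(2) by (subst prod.remove[of _ p]) auto
    finally have 2: "hint f' = c * of_real (real a * gauss_moment (hprec p) (a - 1)) * ?Q" by simp
    show ?thesis unfolding 1 2 gauss_moment_Suc[OF hprec_pos, symmetric] by simp
  qed
  ultimately show ?case by blast
next
  case (add f g)
  then obtain f' g' where
    f: "hpoly f'" "\<And>x. ((\<lambda>y. f (x(p := y))) has_vector_derivative f' x) (at (x p))"
      "of_real (hprec p) * hint (\<lambda>x. of_real (x p) * f x) = hint f'" and
    g: "hpoly g'" "\<And>x. ((\<lambda>y. g (x(p := y))) has_vector_derivative g' x) (at (x p))"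
      "of_real (hprec p) * hint (\<lambda>x. of_real (x p) * g x) = hint g'"
    by blast
  have "hint (\<lambda>x. of_real (x p) * (f x + g x)) = hint (\<lambda>x. of_real (x p) * f x) + hint (\<lambda>x. of_real (x p) * g x)"
    unfolding distrib_left by (intro hint_add hpoly_mult hpoly_coord assms add.hyps)
  then have "of_real (hprec p) * hint (\<lambda>x. of_real (x p) * (f x + g x)) = hint (\<lambda>x. f' x + g' x)"
    using f g by (simp add: hint_add distrib_left)
  moreover have "hpoly (\<lambda>x. f' x + g' x)" using f g by (intro hpoly.add)
  moreover have "((\<lambda>y. f (x(p := y)) + g (x(p := y))) has_vector_derivative f' x + g' x) (at (x p))" for x
    using f(2) g(2) by (intro has_vector_derivative_add)
  ultimately show ?case by blast
qed

text \<open>Uniqueness of the derivative identifies the polynomial found above with whatever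
  expression for the derivative is at hand.\<close>

lemma hint_by_parts:
  assumes "hpoly f" "p \<in> hidx"
    and "\<And>x. ((\<lambda>y. f (x(p := y))) has_vector_derivative f' x) (at (x p))"
  shows "of_real (hprec p) * hint (\<lambda>x. of_real (x p) * f x) = hint f'"
proof -
  obtain g where g: "\<And>x. ((\<lambda>y. f (x(p := y))) has_vector_derivative g x) (at (x p))"
    "of_real (hprec p) * hint (\<lambda>x. of_real (x p) * f x) = hint g"
    using hint_by_parts_ex[OF assms(1,2)] by blast
  have "g = f'"
    using vector_derivative_unique_at[OF g(1) assms(3)] by (intro ext) 
  with g(2) show ?thesis by simp
qed

section \<open>Derivatives with respect to matrix entries and Wick's formula\<close>

definition hent :: "nat \<Rightarrow> nat \<Rightarrow> (nat \<times> nat \<Rightarrow> real) \<Rightarrow> complex" where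
  "hent i j x = (if i = j then of_real (x (i, i))
     else if i < j then of_real (x (i, j)) + \<i> * of_real (x (j, i))
     else of_real (x (j, i)) - \<i> * of_real (x (i, j)))"

text \<open>\<open>D i j\<close> is the derivative of \<open>f\<close> with respect to the matrix entry \<open>(i, j)\<close>, all entries
  being regarded as independent.\<close>
definition hderiv :: "((nat \<times> nat \<Rightarrow> real) \<Rightarrow> complex) \<Rightarrow> (nat \<Rightarrow> nat \<Rightarrow> (nat \<times> nat \<Rightarrow> real) \<Rightarrow> complex) \<Rightarrow> bool" where
  "hderiv f D \<longleftrightarrow> hpoly f \<and> (\<forall>i<N. \<forall>j<N. hpoly (D i j)) \<and>
     (\<forall>x. \<forall>i<N. ((\<lambda>y. f (x((i, i) := y))) has_vector_derivative D i i x) (at (x (i, i)))) \<and>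
     (\<forall>x. \<forall>j<N. \<forall>i<j. ((\<lambda>y. f (x((i, j) := y))) has_vector_derivative D i j x + D j i x) (at (x (i, j)))) \<and>
     (\<forall>x. \<forall>j<N. \<forall>i<j. ((\<lambda>y. f (x((j, i) := y))) has_vector_derivative \<i> * (D i j x - D j i x)) (at (x (j, i))))"

lemma hderiv_hpoly: "hderiv f D \<Longrightarrow> hpoly f" "hderiv f D \<Longrightarrow> i < N \<Longrightarrow> j < N \<Longrightarrow> hpoly (D i j)"
  by (auto simp: hderiv_def)

lemma hderiv_cong: 
  "hderiv f D \<Longrightarrow> (\<And>i j x. i < N \<Longrightarrow> j < N \<Longrightarrow> D' i j x = D i j x) \<Longrightarrow> hderiv f D'"
proof -
  assume *: "hderiv f D" "\<And>i j x. i < N \<Longrightarrow> j < N \<Longrightarrow> D' i j x = D i j x"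
  have "D' i j = D i j" if "i < N" "j < N" for i j using *(2)[OF that] by auto
  with *(1) show ?thesis unfolding hderiv_def by (auto dest: order.strict_trans)
qed

lemma hpoly_hent: "i < N \<Longrightarrow> j < N \<Longrightarrow> hpoly (hent i j)"
proof -
  assume ij: "i < N" "j < N"
  have "hpoly (\<lambda>x. of_real (x (i, j)))" "hpoly (\<lambda>x. of_real (x (j, i)))"
    using ij by (auto intro!: hpoly_coord simp: hidx_def)
  note p = this hpoly_cmult[OF this(1)] hpoly_cmult[OF this(2)]
  have "hpoly (\<lambda>x. of_real (x (i, j)) + \<i> * of_real (x (j, i)))"
    "hpoly (\<lambda>x. of_real (x (j, i)) + (-\<i>) * of_real (x (i, j)))"
    by (intro hpoly.add p)+
  then show ?thesis using p(1) unfolding hent_def[abs_def] by (cases "i = j"; cases "i < j") auto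
qed

lemma hderiv_const: "hderiv (\<lambda>_. c) (\<lambda>_ _ _. 0)"
  by (auto simp: hderiv_def hpoly_const)

lemma hderiv_hent:
  assumes "k < N" "l < N"
  shows "hderiv (hent k l) (\<lambda>i j _. if i = k \<and> j = l then 1 else 0)"
proof -
  have d: "((\<lambda>y. complex_of_real ((x(p := y)) q)) has_vector_derivative (if p = q then 1 else 0)) (at (x p))"
    for x :: "nat \<times> nat \<Rightarrow> real" and p q
    using has_vector_derivative_of_real[OF DERIV_ident[of "at (x p)"]] by auto
  define dM :: "nat \<times> nat \<Rightarrow> complex" where "dM p =
     (if k = l then (if p = (k, k) then 1 else 0)
       else if k < l then (if p = (k, l) then 1 else 0) + \<i> * (if p = (l, k) then 1 else 0)
       else (if p = (l, k) then 1 else 0) - \<i> * (if p = (k, l) then 1 else 0))" for p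
  have dh: "((\<lambda>y. hent k l (x(p := y))) has_vector_derivative dM p) (at (x p))" for x p
  proof -
    consider "k = l" | "k < l" | "l < k" by linarith
    then show ?thesis
    proof cases
      assume "k = l"
      then have "hent k l z = of_real (z (k, k))" "dM p = (if p = (k, k) then 1 else 0)" for z
        by (simp_all add: hent_def dM_def)
      then show ?thesis using d by presburger
    next
      assume "k < l"
      then have *: "hent k l z = of_real (z (k, l)) + \<i> * of_real (z (l, k))"
        "dM p = (if p = (k, l) then 1 else 0) + \<i> * (if p = (l, k) then 1 else 0)" for z
        unfolding hent_def dM_def by auto
      show ?thesis unfolding * by (intro has_vector_derivative_add has_vector_derivative_mult_right d)
    next
      assume "l < k"
      then have *: "hent k l z = of_real (z (l, k)) - \<i> * of_real (z (k, l))"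
        "dM p = (if p = (l, k) then 1 else 0) - \<i> * (if p = (k, l) then 1 else 0)" for z
        unfolding hent_def dM_def by auto
      show ?thesis unfolding * by (intro has_vector_derivative_diff has_vector_derivative_mult_right d)
    qed
  qed
  have eq: "((\<lambda>y. hent k l (x(p := y))) has_vector_derivative c) (at (x p))" if "c = dM p" for x p c
    using dh[of x p] that by simp
  show ?thesis
    unfolding hderiv_def
    by (intro conjI allI impI hpoly_const hpoly_hent assms eq) (auto simp: dM_def)
qed

lemma hderivI:
  assumes "hpoly f" "\<And>i j. i < N \<Longrightarrow> j < N \<Longrightarrow> hpoly (D i j)"
    "\<And>x i. i < N \<Longrightarrow> ((\<lambda>y. f (x((i, i) := y))) has_vector_derivative D i i x) (at (x (i, i)))"
    "\<And>x i j. j < N \<Longrightarrow> i < j \<Longrightarrow> ((\<lambda>y. f (x((i, j) := y))) has_vector_derivative D i j x + D j i x) (at (x (i, j)))"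
    "\<And>x i j. j < N \<Longrightarrow> i < j \<Longrightarrow> ((\<lambda>y. f (x((j, i) := y))) has_vector_derivative \<i> * (D i j x - D j i x)) (at (x (j, i)))"
  shows "hderiv f D"
  unfolding hderiv_def by (intro conjI allI impI assms)

lemma hderivD:
  assumes "hderiv f D"
  shows "i < N \<Longrightarrow> ((\<lambda>y. f (x((i, i) := y))) has_vector_derivative D i i x) (at (x (i, i)))"
    "j < N \<Longrightarrow> i < j \<Longrightarrow> ((\<lambda>y. f (x((i, j) := y))) has_vector_derivative D i j x + D j i x) (at (x (i, j)))"
    "j < N \<Longrightarrow> i < j \<Longrightarrow> ((\<lambda>y. f (x((j, i) := y))) has_vector_derivative \<i> * (D i j x - D j i x)) (at (x (j, i)))"
  using assms unfolding hderiv_def by blast+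

lemma hderiv_add:
  assumes "hderiv f D" "hderiv g E"
  shows "hderiv (\<lambda>x. f x + g x) (\<lambda>i j x. D i j x + E i j x)"
proof -
  have *: "((\<lambda>y. f (x(p := y)) + g (x(p := y))) has_vector_derivative c) (at (x p))"
    if "((\<lambda>y. f (x(p := y))) has_vector_derivative a) (at (x p))"
      "((\<lambda>y. g (x(p := y))) has_vector_derivative b) (at (x p))" "c = a + b" for x p a b c
    using has_vector_derivative_add[OF that(1,2)] that(3) by simp
  show ?thesis
  proof (rule hderivI)
    show "hpoly (\<lambda>x. f x + g x)" using assms by (intro hpoly.add hderiv_hpoly(1))
    show "hpoly (\<lambda>x. D i j x + E i j x)" if "i < N" "j < N" for i j
      using assms that by (intro hpoly.add hderiv_hpoly(2))
  qed (rule *[OF hderivD(1)[OF assms(1)] hderivD(1)[OF assms(2)]], assumption+, simp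
      | rule *[OF hderivD(2)[OF assms(1)] hderivD(2)[OF assms(2)]], assumption+, simp
      | rule *[OF hderivD(3)[OF assms(1)] hderivD(3)[OF assms(2)]], assumption+, simp add: algebra_simps)+
qed

lemma hderiv_sum:
  "(\<And>k. k \<in> A \<Longrightarrow> hderiv (f k) (D k)) \<Longrightarrow> hderiv (\<lambda>x. \<Sum>k\<in>A. f k x) (\<lambda>i j x. \<Sum>k\<in>A. D k i j x)"
proof (induction A rule: infinite_finite_induct)
  case (insert a A)
  then have "hderiv (\<lambda>x. f a x + (\<Sum>k\<in>A. f k x)) (\<lambda>i j x. D a i j x + (\<Sum>k\<in>A. D k i j x))"
    by (intro hderiv_add) auto
  with insert.hyps show ?case by simp
qed (simp_all add: hderiv_const)

lemma hderiv_mult: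
  assumes "hderiv f D" "hderiv g E"
  shows "hderiv (\<lambda>x. f x * g x) (\<lambda>i j x. D i j x * g x + f x * E i j x)"
proof -
  have *: "((\<lambda>y. f (x(p := y)) * g (x(p := y))) has_vector_derivative c) (at (x p))"
    if "((\<lambda>y. f (x(p := y))) has_vector_derivative a) (at (x p))"
      "((\<lambda>y. g (x(p := y))) has_vector_derivative b) (at (x p))" "c = f x * b + a * g x" for x p a b c
    using has_vector_derivative_mult[OF that(1,2)] that(3) by simp
  show ?thesis
  proof (rule hderivI)
    show "hpoly (\<lambda>x. f x * g x)" using assms by (intro hpoly_mult hderiv_hpoly(1))
    show "hpoly (\<lambda>x. D i j x * g x + f x * E i j x)" if "i < N" "j < N" for i j
      using assms that by (intro hpoly.add hpoly_mult hderiv_hpoly)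
  qed (rule *[OF hderivD(1)[OF assms(1)] hderivD(1)[OF assms(2)]], assumption+, simp
      | rule *[OF hderivD(2)[OF assms(1)] hderivD(2)[OF assms(2)]], assumption+, simp add: algebra_simps
      | rule *[OF hderivD(3)[OF assms(1)] hderivD(3)[OF assms(2)]], assumption+, simp add: algebra_simps)+
qed

lemma hderiv_cmult: "hderiv f D \<Longrightarrow> hderiv (\<lambda>x. c * f x) (\<lambda>i j x. c * D i j x)"
  using hderiv_mult[OF hderiv_const[of c], of f D] by simp

text \<open>For a < b the two real integrations by parts give \<open>D a b + D b a\<close> and
  \<open>\<i> * (D a b - D b a)\<close>; in the combination x + \<open>\<i>\<close> y the terms with
  \<open>D a b\<close> cancel. The transposed index reflects the Gaussian covariance E(M_ij M_kl) =
  delta_il delta_jk / N.\<close>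

theorem hint_wick:
  assumes f: "hderiv f D" and ij: "i < N" "j < N"
  shows "of_nat N * hint (\<lambda>x. hent i j x * f x) = hint (D j i)"
proof -
  note hp = hderiv_hpoly[OF f]
  have c: "hpoly (\<lambda>x. of_real (x (a, b)) * f x)" if "a < N" "b < N" for a b
    using that by (intro hpoly_mult hpoly_coord hp) (auto simp: hidx_def)
  have off: "2 * of_nat N * hint (\<lambda>x. of_real (x (a, b)) * f x) = hint (D a b) + hint (D b a)"
    "2 * of_nat N * hint (\<lambda>x. of_real (x (b, a)) * f x) = \<i> * (hint (D a b) - hint (D b a))"
    if "a < b" "b < N" for a b
  proof -
    have ab: "a < N" using that by simp
    have "of_real (hprec (a, b)) * hint (\<lambda>x. of_real (x (a, b)) * f x) = hint (\<lambda>x. D a b x + D b a x)"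
      using f that ab by (intro hint_by_parts hp) (auto simp: hderiv_def hidx_def)
    also have "\<dots> = hint (D a b) + hint (D b a)"
      using that ab by (intro hint_add hp)
    finally show "2 * of_nat N * hint (\<lambda>x. of_real (x (a, b)) * f x) = hint (D a b) + hint (D b a)"
      using that by (simp add: hprec_def)
    have "of_real (hprec (b, a)) * hint (\<lambda>x. of_real (x (b, a)) * f x) = hint (\<lambda>x. \<i> * (D a b x - D b a x))"
      using f that ab by (intro hint_by_parts hp) (auto simp: hderiv_def hidx_def)
    also have "(\<lambda>x. \<i> * (D a b x - D b a x)) = (\<lambda>x. \<i> * D a b x + (- \<i>) * D b a x)"
      by (simp add: algebra_simps)
    also have "hint \<dots> = \<i> * (hint (D a b) - hint (D b a))"
      using that ab by (subst hint_add) (auto intro!: hpoly_cmult hp simp only: hint_cmult, simp add: algebra_simps)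
    finally show "2 * of_nat N * hint (\<lambda>x. of_real (x (b, a)) * f x) = \<i> * (hint (D a b) - hint (D b a))"
      using that by (simp add: hprec_def)
  qed
  consider "i = j" | "i < j" | "j < i" by linarith
  then show ?thesis
  proof cases
    assume "i = j"
    have "of_real (hprec (i, i)) * hint (\<lambda>x. of_real (x (i, i)) * f x) = hint (D i i)"
      using f ij by (intro hint_by_parts hp) (auto simp: hderiv_def hidx_def)
    then show ?thesis using \<open>i = j\<close> by (simp add: hprec_def hent_def)
  next
    assume "i < j"
    have "hint (\<lambda>x. hent i j x * f x) = hint (\<lambda>x. of_real (x (i, j)) * f x + \<i> * (of_real (x (j, i)) * f x))"
      using \<open>i < j\<close> by (simp add: hent_def algebra_simps)
    also have "\<dots> = hint (\<lambda>x. of_real (x (i, j)) * f x) + \<i> * hint (\<lambda>x. of_real (x (j, i)) * f x)"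
      using ij by (simp add: hint_add hpoly_cmult c hint_cmult)
    finally have h: "hint (\<lambda>x. hent i j x * f x) = \<dots>" .
    have "2 * (of_nat N * hint (\<lambda>x. hent i j x * f x)) =
      2 * of_nat N * hint (\<lambda>x. of_real (x (i, j)) * f x) + \<i> * (2 * of_nat N * hint (\<lambda>x. of_real (x (j, i)) * f x))"
      unfolding h by (simp add: distrib_left right_diff_distrib mult_ac)
    also have "\<dots> = 2 * hint (D j i)"
      unfolding off[OF \<open>i < j\<close> ij(2)] by (simp add: algebra_simps flip: mult.assoc)
    finally show ?thesis by simp
  next
    assume "j < i"
    have "hint (\<lambda>x. hent i j x * f x) = hint (\<lambda>x. of_real (x (j, i)) * f x + (- \<i>) * (of_real (x (i, j)) * f x))"
      using \<open>j < i\<close> by (simp add: hent_def algebra_simps)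
    also have "\<dots> = hint (\<lambda>x. of_real (x (j, i)) * f x) + (- \<i>) * hint (\<lambda>x. of_real (x (i, j)) * f x)"
      using ij by (simp only: hint_add hpoly_cmult c hint_cmult)
    finally have h: "hint (\<lambda>x. hent i j x * f x) = \<dots>" .
    have "2 * (of_nat N * hint (\<lambda>x. hent i j x * f x)) =
      2 * of_nat N * hint (\<lambda>x. of_real (x (j, i)) * f x) - \<i> * (2 * of_nat N * hint (\<lambda>x. of_real (x (i, j)) * f x))"
      unfolding h by (simp add: distrib_left right_diff_distrib mult_ac)
    also have "\<dots> = 2 * hint (D j i)"
      unfolding off[OF \<open>j < i\<close> ij(1)] by (simp add: algebra_simps flip: mult.assoc)
    finally show ?thesis by simp
  qed
qed

section \<open>Matrix powers, traces and the Schwinger-Dyson equations\<close>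

definition hpow :: "nat \<Rightarrow> nat \<Rightarrow> nat \<Rightarrow> (nat \<times> nat \<Rightarrow> real) \<Rightarrow> complex" where
  "hpow n i j x = (herm_mat N x ^\<^sub>m n) $$ (i, j)"

lemma herm_mat_carrier: "herm_mat N x \<in> carrier_mat N N"
  by (simp add: herm_mat_def)

lemma herm_mat_index: "i < N \<Longrightarrow> j < N \<Longrightarrow> herm_mat N x $$ (i, j) = hent i j x"
  by (simp add: herm_mat_def hent_def Complex_eq)

lemma hpow_0: "i < N \<Longrightarrow> j < N \<Longrightarrow> hpow 0 i j x = (if i = j then 1 else 0)"
  using herm_mat_carrier[of x] by (simp add: hpow_def)

lemma hpow_Suc: "i < N \<Longrightarrow> j < N \<Longrightarrow> hpow (Suc n) i j x = (\<Sum>k<N. hpow n i k x * hent k j x)"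
  using herm_mat_carrier[of x] pow_carrier_mat[OF herm_mat_carrier[of x], of n]
  by (simp add: hpow_def scalar_prod_def herm_mat_index atLeast0LessThan)

lemma hpow_add: 
  "i < N \<Longrightarrow> j < N \<Longrightarrow> hpow (m + n) i j x = (\<Sum>k<N. hpow m i k x * hpow n k j x)"
proof (induction n arbitrary: j)
  case 0
  then show ?case by (simp add: hpow_0 if_distrib cong: if_cong)
next
  case (Suc n)
  have "hpow (m + Suc n) i j x = (\<Sum>l<N. \<Sum>k<N. hpow m i k x * hpow n k l x * hent l j x)"
    using Suc by (simp add: hpow_Suc sum_distrib_right)
  also have "\<dots> = (\<Sum>k<N. \<Sum>l<N. hpow m i k x * hpow n k l x * hent l j x)"
    by (rule sum.swap)
  also have "\<dots> = (\<Sum>k<N. hpow m i k x * hpow (Suc n) k j x)"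
    using Suc.prems by (simp add: hpow_Suc sum_distrib_left mult.assoc)
  finally show ?case .
qed

lemma hpow_1: "i < N \<Longrightarrow> j < N \<Longrightarrow> hpow 1 i j x = hent i j x"
  by (simp add: hpow_Suc hpow_0 if_distrib if_distribR cong: if_cong)

lemma cnj_hpow: "i < N \<Longrightarrow> j < N \<Longrightarrow> cnj (hpow n i j x) = hpow n j i x"
proof (induction n arbitrary: i j)
  case (Suc n)
  have "cnj (hent k j x) = hent j k x" for k
    by (simp add: hent_def)
  then have "cnj (hpow (Suc n) i j x) = (\<Sum>k<N. hent j k x * hpow n k i x)"
    using Suc by (simp add: hpow_Suc mult.commute)
  also have "\<dots> = (\<Sum>k<N. hpow 1 j k x * hpow n k i x)"
    using Suc.prems by (intro sum.cong refl) (simp only: hpow_1 lessThan_iff)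
  also have "\<dots> = hpow (1 + n) j i x"
    using Suc.prems by (intro hpow_add[symmetric])
  finally show ?case by simp
qed (simp add: hpow_0)

definition htr :: "nat \<Rightarrow> (nat \<times> nat \<Rightarrow> real) \<Rightarrow> complex" where
  "htr n x = (\<Sum>i<N. hpow n i i x)"

lemma htr_eq: "htr n x = of_real (herm_trace_pow N x n)"
proof -
  have "cnj (htr n x) = htr n x" by (simp add: htr_def cnj_hpow)
  then have "htr n x \<in> \<real>" by (simp add: Reals_cnj_iff)
  then have "htr n x = of_real (Re (htr n x))" by simp
  then show ?thesis by (simp add: htr_def hpow_def herm_trace_pow_def)
qed

lemma gauss_weight_eq: "gauss_weight N x = hweight x"
proof -
  \<comment> \<open>The squared modulus of the entry (i, k) is \<open>h (i, k) + h (k, i)\<close>;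
    on the diagonal the two summands coincide, whence the half.\<close>
  define h where "h = (\<lambda>(i, j). if i = j then x (i, j) ^ 2 / 2 else x (i, j) ^ 2)"
  have "complex_of_real (herm_trace_pow N x 2) = (\<Sum>i<N. \<Sum>k<N. hent i k x * hent k i x)"
    using hpow_add[of _ _ 1 1 x]
    by (simp add: htr_eq[symmetric] htr_def numeral_2_eq_2 hpow_1[unfolded One_nat_def])
  also have "\<dots> = (\<Sum>i<N. \<Sum>k<N. of_real (h (i, k) + h (k, i)))"
    by (intro sum.cong refl) (auto simp: hent_def h_def power2_eq_square algebra_simps)
  finally have "herm_trace_pow N x 2 = (\<Sum>i<N. \<Sum>k<N. h (i, k) + h (k, i))"
    by (simp only: of_real_sum[symmetric] of_real_eq_iff)
  also have "\<dots> = 2 * (\<Sum>i<N. \<Sum>k<N. h (i, k))"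
    using sum.swap[of "\<lambda>i k. h (k, i)" "{..<N}" "{..<N}"] by (simp add: sum.distrib)
  also have "(\<Sum>i<N. \<Sum>k<N. h (i, k)) = (\<Sum>p\<in>hidx. h p)"
    by (simp add: hidx_def sum.cartesian_product)
  finally have ht: "herm_trace_pow N x 2 = 2 * (\<Sum>p\<in>hidx. h p)" .
  have "- real N * (herm_trace_pow N x 2 / 2) = - (real N * (\<Sum>p\<in>hidx. h p))"
    unfolding ht by simp
  also have "\<dots> = (\<Sum>p\<in>hidx. - (real N * h p))"
    by (simp only: sum_distrib_left sum_negf)
  also have "\<dots> = (\<Sum>p\<in>hidx. - (hprec p * x p ^ 2 / 2))"
    by (intro sum.cong refl) (auto simp: h_def hprec_def)
  finally show ?thesis
    by (simp only: gauss_weight_def hweight_def exp_sum finite_hidx)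
qed

text \<open>The noncommutative Leibniz rule: the differential of M^n is the sum of M^k dM
  M^(n-1-k).\<close>

lemma hderiv_hpow:
  "i < N \<Longrightarrow> j < N \<Longrightarrow> hderiv (hpow n i j) (\<lambda>a b x. \<Sum>k<n. hpow k i a x * hpow (n - 1 - k) b j x)"
proof (induction n arbitrary: j)
  case 0
  have "hpow 0 i j = (\<lambda>_. if i = j then 1 else 0)" using 0 by (auto simp: hpow_0)
  then show ?case using hderiv_const by simp
next
  case (Suc n)
  have eq: "hpow (Suc n) i j = (\<lambda>x. \<Sum>c<N. hpow n i c x * hent c j x)"
    using Suc.prems by (auto simp: hpow_Suc)
  have "hderiv (\<lambda>x. \<Sum>c<N. hpow n i c x * hent c j x)
      (\<lambda>a b x. \<Sum>c<N. (\<Sum>k<n. hpow k i a x * hpow (n - 1 - k) b c x) * hent c j x +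
         hpow n i c x * (if a = c \<and> b = j then 1 else 0))"
    using Suc by (intro hderiv_sum hderiv_mult hderiv_hent) auto
  then show ?case
    unfolding eq
  proof (rule hderiv_cong)
    fix a b x assume ab: "a < N" "b < N"
    have "(\<Sum>c<N. (\<Sum>k<n. hpow k i a x * hpow (n - 1 - k) b c x) * hent c j x) =
        (\<Sum>k<n. hpow k i a x * (\<Sum>c<N. hpow (n - 1 - k) b c x * hent c j x))"
      unfolding sum_distrib_left sum_distrib_right mult.assoc by (rule sum.swap)
    also have "\<dots> = (\<Sum>k<n. hpow k i a x * hpow (Suc n - 1 - k) b j x)"
    proof (intro sum.cong refl)
      fix k assume "k \<in> {..<n}"
      then have "Suc n - 1 - k = Suc (n - 1 - k)" by simp
      then show "hpow k i a x * (\<Sum>c<N. hpow (n - 1 - k) b c x * hent c j x) =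
          hpow k i a x * hpow (Suc n - 1 - k) b j x"
        using ab Suc.prems by (simp only: hpow_Suc)
    qed
    also have "(\<Sum>c<N. hpow n i c x * (if a = c \<and> b = j then 1 else 0)) = hpow n i a x * hpow 0 b j x"
      using ab Suc.prems by (cases "b = j") (simp_all add: hpow_0 if_distrib cong: if_cong)
    ultimately show "(\<Sum>k<Suc n. hpow k i a x * hpow (Suc n - 1 - k) b j x) =
        (\<Sum>c<N. (\<Sum>k<n. hpow k i a x * hpow (n - 1 - k) b c x) * hent c j x +
         hpow n i c x * (if a = c \<and> b = j then 1 else 0))"
      by (simp add: sum.distrib)
  qed
qed

text \<open>Summation over the diagonal joins M^(n-1-k) and M^k to M^(n-1), the same matrix for each
  of the n values of k.\<close>

lemma hderiv_htr: "hderiv (htr n) (\<lambda>a b x. of_nat n * hpow (n - 1) b a x)"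
proof -
  have "hderiv (\<lambda>x. \<Sum>i<N. hpow n i i x) (\<lambda>a b x. \<Sum>i<N. \<Sum>k<n. hpow k i a x * hpow (n - 1 - k) b i x)"
    by (intro hderiv_sum hderiv_hpow) auto
  then show ?thesis
    unfolding htr_def[abs_def]
  proof (rule hderiv_cong)
    fix a b x assume ab: "a < N" "b < N"
    have "(\<Sum>i<N. \<Sum>k<n. hpow k i a x * hpow (n - 1 - k) b i x) =
        (\<Sum>k<n. \<Sum>i<N. hpow (n - 1 - k) b i x * hpow k i a x)"
      by (subst sum.swap) (simp add: mult.commute)
    also have "\<dots> = (\<Sum>k<n. hpow (n - 1) b a x)"
      using ab by (intro sum.cong refl) (simp flip: hpow_add)
    finally show "of_nat n * hpow (n - 1) b a x = (\<Sum>i<N. \<Sum>k<n. hpow k i a x * hpow (n - 1 - k) b i x)"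
      by simp
  qed
qed

text \<open>\<open>mfact m\<close> times the coefficient of the interaction at the monomial
  \<open>m\<close>, by \<open>interaction_coeff\<close>. The denominator \<open>Suc i\<close>
  cancels the exponent that differentiation of the trace produces.\<close>

definition htp :: "nat multiset \<Rightarrow> (nat \<times> nat \<Rightarrow> real) \<Rightarrow> complex" where
  "htp m x = (\<Prod>i\<in>#m. of_nat N / of_nat (Suc i) * htr (Suc i) x)"

lemma htp_simps: "htp {#} x = 1" "htp (add_mset i m) x = of_nat N / of_nat (Suc i) * htr (Suc i) x * htp m x"
  by (simp_all add: htp_def)

lemma hderiv_htp:
  "hderiv (htp m) (\<lambda>a b x. \<Sum>i\<in>#m. of_nat N * hpow i b a x * htp (m - {#i#}) x)"
proof (induction m)
  case empty
  have "htp {#} = (\<lambda>_. 1)" by (simp add: fun_eq_iff htp_simps)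
  then show ?case using hderiv_const by simp
next
  case (add n m)
  have eq: "htp (add_mset n m) = (\<lambda>x. of_nat N / of_nat (Suc n) * htr (Suc n) x * htp m x)"
    by (simp add: fun_eq_iff htp_simps)
  have "hderiv (\<lambda>x. of_nat N / of_nat (Suc n) * htr (Suc n) x * htp m x)
     (\<lambda>a b x. of_nat N / of_nat (Suc n) * (of_nat (Suc n) * hpow (Suc n - 1) b a x) * htp m x +
        of_nat N / of_nat (Suc n) * htr (Suc n) x * (\<Sum>i\<in>#m. of_nat N * hpow i b a x * htp (m - {#i#}) x))"
    by (intro hderiv_mult hderiv_cmult hderiv_htr add.IH)
  then show ?case
    unfolding eq
  proof (rule hderiv_cong)
    fix a b x assume ab: "a < N" "b < N"
    have "(\<Sum>i\<in>#m. of_nat N * hpow i b a x * htp (add_mset n m - {#i#}) x) =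
       (\<Sum>i\<in>#m. of_nat N / of_nat (Suc n) * htr (Suc n) x * (of_nat N * hpow i b a x * htp (m - {#i#}) x))"
    proof (intro arg_cong[of _ _ sum_mset] image_mset_cong)
      fix i assume "i \<in># m"
      then have "add_mset n m - {#i#} = add_mset n (m - {#i#})" using diff_union_single_conv[of i m "{#n#}"] by simp
      then show "of_nat N * hpow i b a x * htp (add_mset n m - {#i#}) x =
          of_nat N / of_nat (Suc n) * htr (Suc n) x * (of_nat N * hpow i b a x * htp (m - {#i#}) x)"
        by (simp only: htp_simps mult_ac)
    qed
    then show "(\<Sum>i\<in>#add_mset n m. of_nat N * hpow i b a x * htp (add_mset n m - {#i#}) x) =
      of_nat N / of_nat (Suc n) * (of_nat (Suc n) * hpow (Suc n - 1) b a x) * htp m x +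
        of_nat N / of_nat (Suc n) * htr (Suc n) x * (\<Sum>i\<in>#m. of_nat N * hpow i b a x * htp (m - {#i#}) x)"
      by (simp add: sum_mset_distrib_left multiset.map_comp o_def del: of_nat_Suc)
  qed
qed

lemma hpoly_htr: "hpoly (htr n)" by (rule hderiv_hpoly(1)[OF hderiv_htr])
lemma hpoly_htp: "hpoly (htp m)" by (rule hderiv_hpoly(1)[OF hderiv_htp])
lemma hpoly_hpow: "i < N \<Longrightarrow> j < N \<Longrightarrow> hpoly (hpow n i j)" by (rule hderiv_hpoly(1)[OF hderiv_hpow])

lemma hpoly_sum_mset: "(\<And>i. i \<in># m \<Longrightarrow> hpoly (f i)) \<Longrightarrow> hpoly (\<lambda>x. \<Sum>i\<in>#m. f i x)"
  by (induction m) (auto simp: hpoly_const intro!: hpoly.add)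

lemma hint_sum_mset:
  "(\<And>i. i \<in># m \<Longrightarrow> hpoly (f i)) \<Longrightarrow> hint (\<lambda>x. \<Sum>i\<in>#m. f i x) = (\<Sum>i\<in>#m. hint (f i))"
  by (induction m) (simp_all add: hint_add hpoly_sum_mset, simp add: hint_def)

text \<open>Wick's formula for the first factor of M M^p under the trace: a derivative falling on
  M^p cuts the trace into two, and one falling on a trace of \<open>htp m\<close> merges it with the
  first.\<close>

theorem schwinger_dyson:
  "of_nat N * hint (\<lambda>x. htr (Suc p) x * htp m x) =
     (\<Sum>k<p. hint (\<lambda>x. htr k x * htr (p - 1 - k) x * htp m x)) +
     (\<Sum>i\<in>#m. of_nat N * hint (\<lambda>x. htr (p + i) x * htp (m - {#i#}) x))"
proof -
  define D where "D i j a b x = (\<Sum>k<p. hpow k i a x * hpow (p - 1 - k) b j x) * htp m x +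
      hpow p i j x * (\<Sum>l\<in>#m. of_nat N * hpow l b a x * htp (m - {#l#}) x)" for i j a b x
  have D: "hderiv (\<lambda>x. hpow p i j x * htp m x) (D i j)" if "i < N" "j < N" for i j
    unfolding D_def using that by (intro hderiv_mult hderiv_hpow hderiv_htp)
  have "of_nat N * hint (\<lambda>x. htr (Suc p) x * htp m x) =
      of_nat N * hint (\<lambda>x. \<Sum>i<N. \<Sum>j<N. hent j i x * (hpow p i j x * htp m x))"
    by (simp add: htr_def hpow_Suc sum_distrib_right sum_distrib_left mult_ac)
  also have "\<dots> = (\<Sum>i<N. \<Sum>j<N. of_nat N * hint (\<lambda>x. hent j i x * (hpow p i j x * htp m x)))"
    by (subst hint_sum2) (auto intro!: hpoly_mult hpoly_hent hpoly_hpow hpoly_htp simp: sum_distrib_left)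
  also have "\<dots> = (\<Sum>i<N. \<Sum>j<N. hint (D i j i j))"
    by (intro sum.cong refl hint_wick D) auto
  also have "\<dots> = hint (\<lambda>x. \<Sum>i<N. \<Sum>j<N. D i j i j x)"
    by (rule hint_sum2[symmetric]) (auto intro!: hderiv_hpoly(2)[OF D])
  also have "(\<lambda>x. \<Sum>i<N. \<Sum>j<N. D i j i j x) =
      (\<lambda>x. (\<Sum>k<p. htr k x * htr (p - 1 - k) x * htp m x) +
         (\<Sum>l\<in>#m. of_nat N * (htr (p + l) x * htp (m - {#l#}) x)))"
  proof
    fix x
    have "(\<Sum>i<N. \<Sum>j<N. (\<Sum>k<p. hpow k i i x * hpow (p - 1 - k) j j x) * htp m x) =
        (\<Sum>k<p. \<Sum>i<N. \<Sum>j<N. hpow k i i x * hpow (p - 1 - k) j j x * htp m x)"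
      unfolding sum_distrib_right
      by (subst sum.swap[of _ "{..<p}"], subst sum.swap[of _ "{..<p}"]) (rule refl)
    also have "\<dots> = (\<Sum>k<p. htr k x * htr (p - 1 - k) x * htp m x)"
      by (simp only: htr_def sum_product) (simp only: sum_distrib_right)
    finally have 1: "(\<Sum>i<N. \<Sum>j<N. (\<Sum>k<p. hpow k i i x * hpow (p - 1 - k) j j x) * htp m x) = \<dots>" .
    have "(\<Sum>i<N. \<Sum>j<N. hpow p i j x * (\<Sum>l\<in>#M. of_nat N * hpow l j i x * htp (m - {#l#}) x)) =
       (\<Sum>l\<in>#M. of_nat N * (htr (p + l) x * htp (m - {#l#}) x))" for M
    proof (induction M)
      case (add l M)
      have "(\<Sum>i<N. \<Sum>j<N. hpow p i j x * (of_nat N * hpow l j i x * htp (m - {#l#}) x)) =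
          of_nat N * (htr (p + l) x * htp (m - {#l#}) x)"
        by (simp add: htr_def hpow_add sum_distrib_left sum_distrib_right mult_ac)
      with add show ?case by (simp add: distrib_left sum.distrib)
    qed simp
    with 1 show "(\<Sum>i<N. \<Sum>j<N. D i j i j x) = (\<Sum>k<p. htr k x * htr (p - 1 - k) x * htp m x) +
         (\<Sum>l\<in>#m. of_nat N * (htr (p + l) x * htp (m - {#l#}) x))"
      by (simp add: D_def sum.distrib)
  qed
  also have "hint \<dots> = (\<Sum>k<p. hint (\<lambda>x. htr k x * htr (p - 1 - k) x * htp m x)) +
     (\<Sum>i\<in>#m. of_nat N * hint (\<lambda>x. htr (p + i) x * htp (m - {#i#}) x))"
  proof -
    have h: "hpoly (\<lambda>x. htr k x * htr (p - 1 - k) x * htp m x)"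
      "hpoly (\<lambda>x. of_nat N * (htr (p + i) x * htp (m - {#i#}) x))" for k i
      by (intro hpoly_mult hpoly_const hpoly_htr hpoly_htp)+
    show ?thesis
      unfolding hint_add[OF hpoly_sum[OF h(1)] hpoly_sum_mset[OF h(2)]]
        hint_sum[OF h(1)] hint_sum_mset[OF h(2)] hint_cmult ..
  qed
  finally show ?thesis .
qed

end

section \<open>Loop equations and their planar limit\<close>

text \<open>The denominators of the multivariate exponential series; multiplication by them turns
  coefficients into integrals of products of traces.\<close>

definition mfact :: "nat multiset \<Rightarrow> nat" where
  "mfact m = (\<Prod>i\<in>set_mset m. fact (count m i))"

lemma mfact_empty [simp]: "mfact {#} = 1" by (simp add: mfact_def)

lemma mfact_add: "mfact (add_mset n m) = Suc (count m n) * mfact m"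
proof -
  let ?A = "insert n (set_mset m)"
  have m: "mfact m = (\<Prod>i\<in>?A. fact (count m i))"
    unfolding mfact_def by (rule prod.mono_neutral_left) (auto simp: not_in_iff)
  have "mfact (add_mset n m) = (\<Prod>i\<in>?A. fact (count (add_mset n m) i))"
    by (simp only: mfact_def set_mset_add_mset_insert)
  also have "\<dots> = fact (Suc (count m n)) * (\<Prod>i\<in>?A - {n}. fact (count m i))"
    by (subst prod.remove[of _ n]) (auto intro!: prod.cong)
  also have "\<dots> = Suc (count m n) * mfact m"
    unfolding m by (subst prod.remove[of ?A n]) (auto simp: algebra_simps)
  finally show ?thesis .
qed

lemma mfact_pos: "mfact m > 0" by (simp add: mfact_def)

lemma mfact_remove: "i \<in># m \<Longrightarrow> mfact m = count m i * mfact (m - {#i#})"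
  using mfact_add[of i "m - {#i#}"] by simp

lemma mfps_infsum_indet_cmult:
  "mfps_infsum (\<lambda>n. indet n * (c * g n)) {1..} = c * mfps_infsum (\<lambda>n. indet n * g n) {1..}"
proof (rule mfps_eqI)
  fix m :: "nat multiset"
  let ?t = "\<lambda>i k l. mfps_coeff c k * mfps_coeff (g (Suc i)) l"
  have "mfps_coeff (mfps_infsum (\<lambda>n. indet n * (c * g n)) {1..}) m =
      (\<Sum>i\<in>set_mset m. \<Sum>p | fst p + snd p = m - {#i#}. ?t i (fst p) (snd p))"
    unfolding mfps_coeff_infsum_indet mfps_coeff_mult by (simp add: case_prod_unfold)
  also have "\<dots> = (\<Sum>(i, p)\<in>(SIGMA i:set_mset m. {p. fst p + snd p = m - {#i#}}). ?t i (fst p) (snd p))"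
    using finite_splittings by (subst sum.Sigma) (auto simp: case_prod_unfold)
  also have "\<dots> = (\<Sum>(q, i)\<in>(SIGMA q:{q. fst q + snd q = m}. set_mset (snd q)). ?t i (fst q) (snd q - {#i#}))"
  proof (rule sum.reindex_bij_witness[of _ "\<lambda>(q, i). (i, (fst q, snd q - {#i#}))"
        "\<lambda>(i, p). ((fst p, add_mset i (snd p)), i)"], goal_cases)
    case (2 x)
    then obtain i k l where x: "x = (i, (k, l))" "i \<in># m" "k + l = m - {#i#}"
      by (cases x) auto
    then have "k + add_mset i l = m" by simp
    with x show ?case by simp
  next
    case (3 y)
    then show ?case by (cases y) auto
  next
    case (4 y)
    then obtain k l i where y: "y = ((k, l), i)" "i \<in># l" "k + l = m"
      by (cases y) auto
    then have "k + (l - {#i#}) = m - {#i#}" "i \<in># m"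
      by (auto simp only: diff_union_single_conv[symmetric] union_iff)
    with y show ?case by simp
  qed (simp_all add: case_prod_unfold)
  also have "\<dots> = (\<Sum>q | fst q + snd q = m. \<Sum>i\<in>set_mset (snd q). ?t i (fst q) (snd q - {#i#}))"
    using finite_splittings by (subst sum.Sigma) (auto simp: case_prod_unfold)
  also have "\<dots> = mfps_coeff (c * mfps_infsum (\<lambda>n. indet n * g n) {1..}) m"
    unfolding mfps_coeff_mult mfps_coeff_infsum_indet by (simp add: sum_distrib_left case_prod_unfold)
  finally show "mfps_coeff (mfps_infsum (\<lambda>n. indet n * (c * g n)) {1..}) m =
      mfps_coeff (c * mfps_infsum (\<lambda>n. indet n * g n) {1..}) m" .
qed

section \<open>Coefficients of the interaction and of the partition function\<close>

lemma mfps_const_nth: "mfps_coeff (mfps_const c) m = (if m = {#} then c else 0)"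
  by (simp add: mfps_const_def)

lemma mfps_const_mult_const: "mfps_const a * mfps_const b = mfps_const (a * b)"
  by (rule mfps_eqI) (simp add: mfps_const_nth)

lemma
  fixes c :: "nat \<Rightarrow> 'a :: comm_ring_1"
  shows linear_form_empty: "mfps_coeff (mfps_infsum (\<lambda>n. mfps_const (c n) * indet n) {1..}) {#} = 0"
    and linear_form_deriv: "mfps_deriv n (mfps_infsum (\<lambda>n. mfps_const (c n) * indet n) {1..}) = mfps_const (c (Suc n))"
proof -
  note * = mfps_coeff_infsum_indet[of "\<lambda>n. mfps_const (c n)"]
  show "mfps_coeff (mfps_infsum (\<lambda>n. mfps_const (c n) * indet n) {1..}) {#} = 0"
    using *[of "{#}"] by (simp add: mult.commute)
  show "mfps_deriv n (mfps_infsum (\<lambda>n. mfps_const (c n) * indet n) {1..}) = mfps_const (c (Suc n))"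
  proof (rule mfps_eqI)
    fix m
    have t: "mfps_coeff (mfps_const (c (Suc i))) (add_mset n m - {#i#}) = (if m = {#} then c (Suc n) else 0)"
      if "i \<in> insert n (set_mset m)" for i
    proof (cases "m = {#}")
      case False
      have "size (add_mset n m - {#i#}) = size m"
        using that by (subst size_Diff_singleton) auto
      then have "add_mset n m - {#i#} \<noteq> {#}" using False by (metis size_eq_0_iff_empty)
      then show ?thesis using False by (simp add: mfps_const_nth)
    qed (use that in \<open>simp add: mfps_const_nth\<close>)
    have "mfps_coeff (mfps_infsum (\<lambda>n. mfps_const (c n) * indet n) {1..}) (add_mset n m) =
        (\<Sum>i\<in>insert n (set_mset m). if m = {#} then c (Suc n) else 0)"
      using *[of "add_mset n m"] unfolding mult.commute[of "indet _"] set_mset_add_mset_insert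
      by (simp only: t cong: sum.cong)
    then show "mfps_coeff (mfps_deriv n (mfps_infsum (\<lambda>n. mfps_const (c n) * indet n) {1..})) m =
        mfps_coeff (mfps_const (c (Suc n))) m"
      by (simp add: mfps_const_nth)
  qed
qed

lemma interaction_empty: "mfps_coeff (interaction N x) {#} = 1"
  unfolding interaction_def by (rule mfps_exp_empty) (simp only: mfps_coeff_mult_empty linear_form_empty mult_zero_right)

lemma interaction_deriv:
  "mfps_deriv n (interaction N x) =
     interaction N x * mfps_const (real N * (herm_trace_pow N x (Suc n) / real (Suc n)))"
proof -
  have "mfps_deriv n (interaction N x) = interaction N x * mfps_deriv n (mfps_const (real N) *
     mfps_infsum (\<lambda>n. mfps_const (herm_trace_pow N x n / real n) * indet n) {1..})"
    unfolding interaction_def by (rule mfps_exp_deriv) (simp only: mfps_coeff_mult_empty linear_form_empty mult_zero_right)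
  then show ?thesis
    by (simp only: mfps_deriv_const_mult linear_form_deriv mfps_const_mult_const)
qed

text \<open>Each partial derivative multiplies the interaction by a constant, so the coefficients
  are found by adding one indeterminate to the monomial at a time.\<close>

lemma interaction_coeff:
  assumes "N > 0"
  shows "complex_of_real (of_nat (mfact m) * mfps_coeff (interaction N x) m) = htp N m x"
proof (induction m)
  case empty
  show ?case by (simp add: interaction_empty htp_simps[OF assms])
next
  case (add n m)
  have "real (Suc (count m n)) * mfps_coeff (interaction N x) (add_mset n m) =
      mfps_coeff (mfps_deriv n (interaction N x)) m"
    by simp
  also have "\<dots> = real N * (herm_trace_pow N x (Suc n) / real (Suc n)) * mfps_coeff (interaction N x) m"
    unfolding interaction_deriv mult.commute[of "interaction N x"] by (rule mfps_coeff_const_mult)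
  finally have "real (mfact (add_mset n m)) * mfps_coeff (interaction N x) (add_mset n m) =
      real N * (herm_trace_pow N x (Suc n) / real (Suc n)) * (real (mfact m) * mfps_coeff (interaction N x) m)"
    unfolding mfact_add of_nat_mult by (simp only: mult_ac)
  then have "complex_of_real (of_nat (mfact (add_mset n m)) * mfps_coeff (interaction N x) (add_mset n m)) =
      of_real (real N * (herm_trace_pow N x (Suc n) / real (Suc n))) * htp N m x"
    using add.IH by (simp only: of_real_mult)
  then show ?case
    by (simp add: htp_simps[OF assms] htr_eq[OF assms])
qed

lemma hint_1_nonzero:
  assumes "N > 0"
  shows "hint N (\<lambda>_. 1) \<noteq> 0"
proof -
  have "hmono N (\<lambda>_. 0) = (\<lambda>_. 1)" by (simp add: fun_eq_iff hmono_def[OF assms])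
  then have "hint N (\<lambda>_. 1) = (\<Prod>p\<in>hidx N. of_real (gauss_moment (hprec N p) 0))"
    using hint_hmono[OF assms, of "\<lambda>_. 0"] by simp
  moreover have "gauss_moment (hprec N p) 0 \<noteq> 0" for p
    using gauss_moment_0_pos[OF hprec_pos[OF assms, of p]] by simp
  ultimately show ?thesis by (simp add: finite_hidx[OF assms])
qed

lemma partition_function_coeff:
  assumes "N > 0"
  shows "of_nat (mfact m) * complex_of_real (mfps_coeff (partition_function N) m) =
     hint N (htp N m) / hint N (\<lambda>_. 1)"
proof -
  have "hint N (htp N m) = complex_of_real (of_nat (mfact m) * (LINT x|herm_measure N. mfps_coeff (interaction N x) m * gauss_weight N x))"
    unfolding hint_def[OF assms] interaction_coeff[OF assms, symmetric] gauss_weight_eq[OF assms]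
    by (simp add: mult.assoc flip: integral_complex_of_real)
  moreover have "hint N (\<lambda>_. 1) = complex_of_real (LINT x|herm_measure N. gauss_weight N x)"
    unfolding hint_def[OF assms] gauss_weight_eq[OF assms] by (simp flip: integral_complex_of_real)
  ultimately show ?thesis by (simp add: partition_function_def)
qed

lemma partition_function_empty:
  assumes "N > 0"
  shows "mfps_coeff (partition_function N) {#} = 1"
proof -
  have "htp N {#} = (\<lambda>_. 1)" using assms by (simp add: fun_eq_iff htp_simps[OF assms])
  then have "complex_of_real (mfps_coeff (partition_function N) {#}) = 1"
    using partition_function_coeff[OF assms, of "{#}"] hint_1_nonzero[OF assms] by simp
  then show ?thesis by (simp only: of_real_eq_1_iff)
qed

text \<open>Inserting \<open>Tr (M\<^bsup>n\<^esup>)\<close> into the integrals that define the coefficients of a series.\<close>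
definition trace_op :: "nat \<Rightarrow> nat \<Rightarrow> real mfps \<Rightarrow> real mfps" where
  "trace_op N n f = (if n = 0 then mfps_const (real N) * f
     else mfps_const (real n / real N) * mfps_deriv (n - 1) f)"

text \<open>The prefix \<open>g\<close> is arbitrary so that the rule can be applied twice, as the
  products of two traces in the Schwinger-Dyson equations demand. For \<open>n = 0\<close> the trace
  of the identity gives the factor \<open>N\<close>.\<close>

lemma trace_op_coeff:
  assumes "N > 0"
    and G: "\<And>m. of_nat (mfact m) * complex_of_real (mfps_coeff f m) = hint N (\<lambda>x. g x * htp N m x) / hint N (\<lambda>_. 1)"
  shows "of_nat (mfact m) * complex_of_real (mfps_coeff (trace_op N n f) m) =
     hint N (\<lambda>x. g x * htr N n x * htp N m x) / hint N (\<lambda>_. 1)"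
proof (cases n)
  case 0
  have "htr N 0 x = of_nat N" for x
    using assms(1) by (simp add: htr_def[OF assms(1)] hpow_0[OF assms(1)])
  then have "hint N (\<lambda>x. g x * htr N 0 x * htp N m x) = of_nat N * hint N (\<lambda>x. g x * htp N m x)"
    by (simp add: mult_ac hint_cmult[OF assms(1)] flip: hint_cmult[OF assms(1)])
  then show ?thesis using G[of m] 0 by (simp add: trace_op_def mult.left_commute)
next
  case (Suc k)
  have "htp N (add_mset k m) x = of_nat N / of_nat n * (htr N n x * htp N m x)" for x
    using assms(1) by (simp add: htp_simps[OF assms(1)] Suc)
  moreover have "of_nat n \<noteq> (0 :: complex)" "of_nat N \<noteq> (0 :: complex)"
    using assms(1) Suc by (simp_all del: of_nat_Suc)
  ultimately have "g x * htr N n x * htp N m x = of_nat n / of_nat N * (g x * htp N (add_mset k m) x)" for x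
    by (simp only:) (simp add: field_simps)
  then have "hint N (\<lambda>x. g x * htr N n x * htp N m x) = of_nat n / of_nat N * hint N (\<lambda>x. g x * htp N (add_mset k m) x)"
    by (simp only: hint_cmult[OF assms(1)])
  then have "hint N (\<lambda>x. g x * htr N n x * htp N m x) / hint N (\<lambda>_. 1) =
      of_nat n / of_nat N * (of_nat (mfact (add_mset k m)) * complex_of_real (mfps_coeff f (add_mset k m)))"
    by (simp only: G times_divide_eq_right)
  moreover have "mfps_coeff (trace_op N n f) m =
      real n / real N * (real (Suc (count m k)) * mfps_coeff f (add_mset k m))"
    by (simp add: trace_op_def Suc)
  ultimately show ?thesis
    by (simp add: mfact_add algebra_simps)
qed

text \<open>The sum over the multiset \<open>m\<close> counts \<open>i\<close> with multiplicity
  \<open>count m i\<close>. This factor is absorbed by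
  \<open>mfact m = count m i * mfact (m - {#i#})\<close>, and what remains is multiplication by an
  indeterminate.\<close>

lemma schwinger_dyson_mfps:
  fixes N p :: nat
  assumes N: "N > 0"
  defines "Z \<equiv> partition_function N"
  shows "mfps_const (real N) * trace_op N (Suc p) Z =
    (\<Sum>k<p. trace_op N k (trace_op N (p - 1 - k) Z)) +
    mfps_const (real N) * mfps_infsum (\<lambda>n. indet n * trace_op N (p + n - 1) Z) {1..}"
proof (rule mfps_eqI)
  fix m
  let ?h = "hint N (\<lambda>_. 1)"
  have 0: "of_nat (mfact m) * complex_of_real (mfps_coeff Z m) = hint N (\<lambda>x. 1 * htp N m x) / ?h" for m
    using partition_function_coeff[OF N, of m] by (simp add: Z_def)
  have 1: "of_nat (mfact m) * complex_of_real (mfps_coeff (trace_op N n Z) m) = hint N (\<lambda>x. htr N n x * htp N m x) / ?h" for n m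
    using trace_op_coeff[OF N 0, of m n] by simp
  have 2: "of_nat (mfact m) * complex_of_real (mfps_coeff (trace_op N k (trace_op N n Z)) m) =
      hint N (\<lambda>x. htr N k x * htr N n x * htp N m x) / ?h" for k n m
    using trace_op_coeff[OF N 1, of m k n] by (simp add: mult.commute[of "htr N n _"])
  have 3: "of_nat (mfact m) * complex_of_real (mfps_coeff (mfps_infsum (\<lambda>n. indet n * trace_op N (p + n - 1) Z) {1..}) m) =
     (\<Sum>i\<in>#m. hint N (\<lambda>x. htr N (p + i) x * htp N (m - {#i#}) x)) / ?h"
  proof -
    have "of_nat (mfact m) * complex_of_real (mfps_coeff (mfps_infsum (\<lambda>n. indet n * trace_op N (p + n - 1) Z) {1..}) m) =
      (\<Sum>i\<in>set_mset m. of_nat (mfact m) * complex_of_real (mfps_coeff (trace_op N (p + i) Z) (m - {#i#})))"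
      unfolding mfps_coeff_infsum_indet by (simp add: sum_distrib_left)
    also have "\<dots> = (\<Sum>i\<in>set_mset m. of_nat (count m i) * (hint N (\<lambda>x. htr N (p + i) x * htp N (m - {#i#}) x) / ?h))"
    proof (intro sum.cong refl)
      fix i assume "i \<in># m"
      show "of_nat (mfact m) * complex_of_real (mfps_coeff (trace_op N (p + i) Z) (m - {#i#})) =
          of_nat (count m i) * (hint N (\<lambda>x. htr N (p + i) x * htp N (m - {#i#}) x) / ?h)"
        unfolding mfact_remove[OF \<open>i \<in># m\<close>] of_nat_mult mult.assoc 1 by (rule refl)
    qed
    also have "\<dots> = (\<Sum>i\<in>#m. hint N (\<lambda>x. htr N (p + i) x * htp N (m - {#i#}) x)) / ?h"
      unfolding sum_mset_count[OF finite_set_mset order_refl] by (simp add: sum_divide_distrib)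
    finally show ?thesis .
  qed
  have "of_nat (mfact m) * complex_of_real (mfps_coeff (mfps_const (real N) * trace_op N (Suc p) Z) m) =
     of_nat N * (hint N (\<lambda>x. htr N (Suc p) x * htp N m x) / ?h)"
    by (simp add: mult.left_commute flip: 1)
  also have "\<dots> = ((\<Sum>k<p. hint N (\<lambda>x. htr N k x * htr N (p - 1 - k) x * htp N m x)) +
     of_nat N * (\<Sum>i\<in>#m. hint N (\<lambda>x. htr N (p + i) x * htp N (m - {#i#}) x))) / ?h"
    using schwinger_dyson[OF N, of p m] by (simp add: sum_mset_distrib_left multiset.map_comp o_def)
  also have "\<dots> = (\<Sum>k<p. hint N (\<lambda>x. htr N k x * htr N (p - 1 - k) x * htp N m x) / ?h) +
     of_nat N * ((\<Sum>i\<in>#m. hint N (\<lambda>x. htr N (p + i) x * htp N (m - {#i#}) x)) / ?h)"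
    by (simp add: add_divide_distrib sum_divide_distrib)
  also have "\<dots> = of_nat (mfact m) * complex_of_real (mfps_coeff ((\<Sum>k<p. trace_op N k (trace_op N (p - 1 - k) Z)) +
    mfps_const (real N) * mfps_infsum (\<lambda>n. indet n * trace_op N (p + n - 1) Z) {1..}) m)"
    by (simp only: 2[symmetric] 3[symmetric] mfps_coeff_add mfps_coeff_sum mfps_coeff_const_mult)
      (simp add: distrib_left sum_distrib_left mult.left_commute)
  finally show "mfps_coeff (mfps_const (real N) * trace_op N (Suc p) Z) m =
      mfps_coeff ((\<Sum>k<p. trace_op N k (trace_op N (p - 1 - k) Z)) +
    mfps_const (real N) * mfps_infsum (\<lambda>n. indet n * trace_op N (p + n - 1) Z) {1..}) m"
    using mfact_pos[of m] by (simp only: mult_cancel_left of_real_eq_iff of_nat_eq_0_iff) simp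
qed

text \<open>The expectation of Tr (M^n) / N in the interacting ensemble; taking the logarithm
  performs the division of the Gaussian integrals by Z.\<close>

definition resolvent_coeff :: "nat \<Rightarrow> nat \<Rightarrow> real mfps" where
  "resolvent_coeff N n = (if n = 0 then 1
     else mfps_const (real n / real N ^ 2) * mfps_deriv (n - 1) (mfps_log (partition_function N)))"

text \<open>A double insertion into Z is N^2 Z times the product of the expectations plus a
  connected part with the factor \<open>k / N^2\<close>. The whole equation thus carries the factor
  N^2 Z, which is cancelled by its inverse.\<close>

lemma finite_loop_equation:
  assumes N: "N > 0"
  shows "resolvent_coeff N (Suc p) =
    (\<Sum>k<p. resolvent_coeff N k * resolvent_coeff N (p - 1 - k) +
       mfps_const (real k / real N ^ 2) * mfps_deriv (k - 1) (resolvent_coeff N (p - 1 - k))) +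
    mfps_infsum (\<lambda>n. indet n * resolvent_coeff N (p + n - 1)) {1..}"
proof -
  let ?w = "resolvent_coeff N" and ?C = "mfps_const (real N)"
  define Z where "Z = partition_function N"
  have Z1: "mfps_coeff Z {#} = 1" unfolding Z_def by (rule partition_function_empty[OF N])
  note dZ = mfps_log_deriv[OF Z1]
  have L: "trace_op N n Z = ?C * Z * ?w n" for n
  proof (cases n)
    case (Suc k)
    have "mfps_const (real n / real N) = ?C * mfps_const (real n / real N ^ 2)"
      using N by (simp add: mfps_const_mult_const power2_eq_square)
    then show ?thesis by (simp add: Suc trace_op_def dZ resolvent_coeff_def mult_ac flip: Z_def)
  qed (simp add: trace_op_def resolvent_coeff_def)
  have LL: "trace_op N k (trace_op N j Z) = ?C * ?C * Z * (?w k * ?w j + mfps_const (real k / real N ^ 2) * mfps_deriv (k - 1) (?w j))" for k j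
  proof (cases k)
    case 0
    \<comment> \<open>For \<open>k = 0\<close> the connected part has to vanish: its derivative has
      the truncated index \<open>k - 1\<close>, but its factor is 0.\<close>
    have "mfps_const (0 :: real) = 0" by (rule mfps_eqI) (simp add: mfps_const_nth)
    moreover have "trace_op N k (trace_op N j Z) = ?C * (?C * Z * ?w j)"
      unfolding L[of j] 0 by (simp add: trace_op_def)
    moreover have "?w 0 = 1" by (simp add: resolvent_coeff_def)
    ultimately show ?thesis by (simp add: 0 mult_ac)
  next
    case (Suc i)
    have c: "mfps_const (real k / real N) = ?C * mfps_const (real k / real N ^ 2)"
      using N by (simp add: mfps_const_mult_const power2_eq_square)
    have "trace_op N k (trace_op N j Z) = mfps_const (real k / real N) * (?C * (mfps_deriv i (Z * ?w j)))"
      unfolding L[of j] trace_op_def[of N k] by (simp add: Suc mult.assoc)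
    also have "\<dots> = ?C * ?C * Z * (mfps_const (real k / real N ^ 2) * mfps_deriv i (mfps_log Z) * ?w j +
        mfps_const (real k / real N ^ 2) * mfps_deriv i (?w j))"
      unfolding c mfps_deriv_mult dZ by (simp add: algebra_simps)
    finally show ?thesis by (simp add: Suc resolvent_coeff_def[of N "Suc i"] Z_def)
  qed
  obtain V where V: "V * Z = 1" using mfps_unit[OF Z1] by blast
  define c where "c = V * mfps_const (1 / real N) * mfps_const (1 / real N)"
  have "mfps_const (1 / real N) * ?C = 1"
    using N by (intro mfps_eqI) (simp add: mfps_const_mult_const mfps_const_nth mfps_coeff_1)
  then have c: "c * (?C * ?C * Z) = 1"
    using V unfolding c_def by (metis (no_types, opaque_lifting) mult.assoc mult.commute mult.right_neutral)
  have "?C * ?C * Z * ?w (Suc p) = ?C * ?C * Z * ((\<Sum>k<p. ?w k * ?w (p - 1 - k) +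
       mfps_const (real k / real N ^ 2) * mfps_deriv (k - 1) (?w (p - 1 - k))) +
      mfps_infsum (\<lambda>n. indet n * ?w (p + n - 1)) {1..})"
    using schwinger_dyson_mfps[OF N, of p]
    unfolding Z_def[symmetric] LL unfolding L mfps_infsum_indet_cmult
    by (simp only: distrib_left sum_distrib_left mult.assoc)
  then have "c * (?C * ?C * Z) * ?w (Suc p) = c * (?C * ?C * Z) * ((\<Sum>k<p. ?w k * ?w (p - 1 - k) +
       mfps_const (real k / real N ^ 2) * mfps_deriv (k - 1) (?w (p - 1 - k))) +
      mfps_infsum (\<lambda>n. indet n * ?w (p + n - 1)) {1..})"
    by (simp only: mult.assoc)
  then show ?thesis unfolding c by simp
qed

text \<open>For fixed \<open>m\<close> the expansion is a power series in \<open>1 / N\<^bsup>2\<^esup>\<close> which converges at \<open>N = 1\<close>, so that it is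
  continuous at \<open>0\<close>.\<close>
lemma genus_expansion_planar_limit:
  assumes "genus_expansion F"
  shows "(\<lambda>N. mfps_coeff (mfps_log (partition_function N)) m / real N ^ 2)
    \<longlonglongrightarrow> real_of_rat (mfps_coeff (F 0) m)"
proof -
  define c where "c g = real_of_rat (mfps_coeff (F g) m)" for g
  define P where "P x = (\<Sum>g. c g * x ^ g)" for x
  have s: "(\<lambda>g. real N powi (2 - 2 * int g) * c g) sums mfps_coeff (mfps_log (partition_function N)) m" if "N \<ge> 1" for N
    using assms that unfolding genus_expansion_def c_def by blast
  have "summable (\<lambda>g. c g * 1 ^ g)"
    using s[of 1] by (auto simp: summable_def)
  then have "isCont P 0" unfolding P_def by (rule isCont_powser) simp
  moreover have "(\<lambda>N. 1 / real N ^ 2) \<longlonglongrightarrow> 0"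
    by (rule tendsto_divide_0[OF tendsto_const filterlim_at_top_imp_at_infinity])
      (intro filterlim_pow_at_top filterlim_real_sequentially; simp)
  ultimately have "(\<lambda>N. P (1 / real N ^ 2)) \<longlonglongrightarrow> P 0"
    by (rule isCont_tendsto_compose)
  moreover have "P 0 = real_of_rat (mfps_coeff (F 0) m)" by (simp add: P_def c_def)
  ultimately have "(\<lambda>N. P (1 / real N ^ 2)) \<longlonglongrightarrow> real_of_rat (mfps_coeff (F 0) m)" by simp
  moreover have "P (1 / real N ^ 2) = mfps_coeff (mfps_log (partition_function N)) m / real N ^ 2" if "N \<ge> 1" for N
  proof -
    have "(\<lambda>g. real N powi (2 - 2 * int g) * c g / real N ^ 2) sums (mfps_coeff (mfps_log (partition_function N)) m / real N ^ 2)"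
      by (intro sums_divide s that)
    moreover have "real N powi (2 - 2 * int g) * c g / real N ^ 2 = c g * (1 / real N ^ 2) ^ g" for g
      using that by (simp add: power_int_diff power_int_mult field_simps flip: power_mult)
    ultimately show ?thesis by (simp add: P_def sums_iff)
  qed
  then have "eventually (\<lambda>N. P (1 / real N ^ 2) = mfps_coeff (mfps_log (partition_function N)) m / real N ^ 2) sequentially"
    by (intro eventually_sequentiallyI[of 1])
  ultimately show ?thesis
    by (rule Lim_transform_eventually)
qed

section \<open>Planar moments and their loop equation\<close>

definition planar_moment :: "(nat \<Rightarrow> rat mfps) \<Rightarrow> nat \<Rightarrow> rat mfps" where
  "planar_moment F n = (if n = 0 then 1 else of_nat n * mfps_deriv (n - 1) (F 0))"

lemma planar_empty:
  assumes "genus_expansion F"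
  shows "mfps_coeff (F 0) {#} = 0"
proof -
  have "(\<lambda>N. mfps_coeff (mfps_log (partition_function N)) {#} / real N ^ 2) \<longlonglongrightarrow> 0"
    by (rule tendsto_eventually, rule eventually_sequentiallyI[of 1])
      (simp add: mfps_log_empty partition_function_empty)
  from LIMSEQ_unique[OF this genus_expansion_planar_limit[OF assms]] show ?thesis by simp
qed

text \<open>At a fixed monomial the finite loop equation involves finitely many coefficients, so the
  limit is taken term by term. The connected part dies because its factor tends to 0 while the
  coefficient converges. The limit is an identity of reals, and injectivity of
  \<open>real_of_rat\<close> brings it back to rationals.\<close>

theorem planar_loop_equation:
  assumes "genus_expansion F"
  defines "W \<equiv> planar_moment F"
  shows "W (Suc p) = (\<Sum>k<p. W k * W (p - 1 - k)) + mfps_infsum (\<lambda>n. indet n * W (p + n - 1)) {1..}"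
proof (rule mfps_eqI)
  fix m
  let ?r = real_of_rat and ?w = resolvent_coeff
  have w: "(\<lambda>N. mfps_coeff (?w N n) m) \<longlonglongrightarrow> ?r (mfps_coeff (W n) m)" for n m
  proof (cases n)
    case (Suc k)
    have "(\<lambda>N. real n * (real (Suc (count m k)) * (mfps_coeff (mfps_log (partition_function N)) (add_mset k m) / real N ^ 2)))
      \<longlonglongrightarrow> real n * (real (Suc (count m k)) * ?r (mfps_coeff (F 0) (add_mset k m)))"
      by (intro tendsto_intros genus_expansion_planar_limit assms)
    moreover have "mfps_coeff (?w N n) m =
        real n * (real (Suc (count m k)) * (mfps_coeff (mfps_log (partition_function N)) (add_mset k m) / real N ^ 2))" for N
      by (simp add: resolvent_coeff_def Suc del: of_nat_Suc)
    moreover have "?r (mfps_coeff (W n) m) = real n * (real (Suc (count m k)) * ?r (mfps_coeff (F 0) (add_mset k m)))"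
      by (simp add: W_def planar_moment_def Suc of_rat_mult del: of_nat_Suc)
    ultimately show ?thesis by (simp only:)
  qed (simp add: resolvent_coeff_def W_def planar_moment_def mfps_coeff_1)
  have inv: "(\<lambda>N. real k / real N ^ 2) \<longlonglongrightarrow> 0" for k
    by (rule tendsto_divide_0[OF tendsto_const filterlim_at_top_imp_at_infinity])
      (intro filterlim_pow_at_top filterlim_real_sequentially; simp)
  have "(\<lambda>N. (\<Sum>k<p. (\<Sum>(a, b) | a + b = m. mfps_coeff (?w N k) a * mfps_coeff (?w N (p - 1 - k)) b) +
       real k / real N ^ 2 * (real (Suc (count m (k - 1))) * mfps_coeff (?w N (p - 1 - k)) (add_mset (k - 1) m))) +
     (\<Sum>i\<in>set_mset m. mfps_coeff (?w N (p + i)) (m - {#i#})))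
   \<longlonglongrightarrow> (\<Sum>k<p. (\<Sum>(a, b) | a + b = m. ?r (mfps_coeff (W k) a) * ?r (mfps_coeff (W (p - 1 - k)) b)) +
       0 * (real (Suc (count m (k - 1))) * ?r (mfps_coeff (W (p - 1 - k)) (add_mset (k - 1) m)))) +
     (\<Sum>i\<in>set_mset m. ?r (mfps_coeff (W (p + i)) (m - {#i#})))"
    unfolding case_prod_unfold
    by (intro tendsto_add tendsto_sum tendsto_mult w inv tendsto_const)
  moreover have "eventually (\<lambda>N. (\<Sum>k<p. (\<Sum>(a, b) | a + b = m. mfps_coeff (?w N k) a * mfps_coeff (?w N (p - 1 - k)) b) +
       real k / real N ^ 2 * (real (Suc (count m (k - 1))) * mfps_coeff (?w N (p - 1 - k)) (add_mset (k - 1) m))) +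
     (\<Sum>i\<in>set_mset m. mfps_coeff (?w N (p + i)) (m - {#i#})) = mfps_coeff (?w N (Suc p)) m) sequentially"
  proof (rule eventually_sequentiallyI[of 1])
    fix N :: nat assume "1 \<le> N"
    then have "N > 0" by simp
    show "(\<Sum>k<p. (\<Sum>(a, b) | a + b = m. mfps_coeff (?w N k) a * mfps_coeff (?w N (p - 1 - k)) b) +
       real k / real N ^ 2 * (real (Suc (count m (k - 1))) * mfps_coeff (?w N (p - 1 - k)) (add_mset (k - 1) m))) +
     (\<Sum>i\<in>set_mset m. mfps_coeff (?w N (p + i)) (m - {#i#})) = mfps_coeff (?w N (Suc p)) m"
      unfolding finite_loop_equation[OF \<open>N > 0\<close>, of p] mfps_coeff_add mfps_coeff_sum mfps_coeff_infsum_indet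
        mfps_coeff_const_mult mfps_coeff_deriv
      by (simp add: mfps_coeff_mult)
  qed
  ultimately have "(\<lambda>N. mfps_coeff (?w N (Suc p)) m) \<longlonglongrightarrow>
     (\<Sum>k<p. (\<Sum>(a, b) | a + b = m. ?r (mfps_coeff (W k) a) * ?r (mfps_coeff (W (p - 1 - k)) b)) +
       0 * (real (Suc (count m (k - 1))) * ?r (mfps_coeff (W (p - 1 - k)) (add_mset (k - 1) m)))) +
     (\<Sum>i\<in>set_mset m. ?r (mfps_coeff (W (p + i)) (m - {#i#})))"
    by (rule Lim_transform_eventually)
  from LIMSEQ_unique[OF w this]
  have "?r (mfps_coeff (W (Suc p)) m) = ?r (mfps_coeff ((\<Sum>k<p. W k * W (p - 1 - k)) +
      mfps_infsum (\<lambda>n. indet n * W (p + n - 1)) {1..}) m)"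
    unfolding mfps_coeff_add mfps_coeff_infsum_indet
    by (simp add: mfps_coeff_mult of_rat_add of_rat_sum of_rat_mult case_prod_unfold)
  then show "mfps_coeff (W (Suc p)) m = mfps_coeff ((\<Sum>k<p. W k * W (p - 1 - k)) +
      mfps_infsum (\<lambda>n. indet n * W (p + n - 1)) {1..}) m"
    by (simp only: of_rat_eq_iff)
qed

section \<open>Algebraic equations for \<open>R\<close> and \<open>S\<close>\<close>

text \<open>The value at \<open>Z\<close> of a series in an outer variable whose coefficients are
  series. For \<open>Z\<close> without constant term \<open>Z ^ p\<close> starts in degree
  \<open>p\<close>, so cutting the sum at \<open>k\<close> loses nothing.\<close>

definition fps_eval :: "'a :: comm_ring_1 fps fps \<Rightarrow> 'a fps \<Rightarrow> 'a fps" where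
  "fps_eval W Z = Abs_fps (\<lambda>k. \<Sum>p\<le>k. fps_nth (fps_nth W p * Z ^ p) k)"

lemma fps_nth_mult_power_eq_0:
  assumes "fps_nth Z 0 = (0 :: 'a :: comm_ring_1)" "k < p"
  shows "fps_nth (f * Z ^ p) k = 0"
proof -
  have "Z = fps_X * fps_shift 1 Z"
    using assms(1) by (intro fps_ext) auto
  then have "f * Z ^ p = fps_X ^ p * (f * fps_shift 1 Z ^ p)"
    by (metis mult.left_commute power_mult_distrib)
  then show ?thesis using assms(2) by (simp only: fps_X_power_mult_nth) simp
qed

lemma fps_nth_eval:
  assumes "fps_nth Z 0 = 0" "k \<le> n"
  shows "fps_nth (fps_eval W Z) k = (\<Sum>p\<le>n. fps_nth (fps_nth W p * Z ^ p) k)"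
  unfolding fps_eval_def fps_nth_Abs_fps using assms
  by (intro sum.mono_neutral_left) (auto intro!: fps_nth_mult_power_eq_0)

lemma fps_eval_add: "fps_eval (V + W) Z = fps_eval V Z + fps_eval W Z"
  by (rule fps_ext) (simp add: fps_eval_def distrib_right sum.distrib)

lemma fps_eval_diff: "fps_eval (V - W) Z = fps_eval V Z - fps_eval W Z"
  by (rule fps_ext) (simp add: fps_eval_def left_diff_distrib sum_subtractf)

lemma fps_eval_const [simp]: "fps_eval (fps_const c) Z = c"
proof (rule fps_ext)
  fix k
  have "fps_nth (fps_eval (fps_const c) Z) k = (\<Sum>p\<in>{0}. fps_nth (fps_nth (fps_const c) p * Z ^ p) k)"
    unfolding fps_eval_def fps_nth_Abs_fps by (intro sum.mono_neutral_right) auto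
  then show "fps_nth (fps_eval (fps_const c) Z) k = fps_nth c k" by simp
qed

lemma fps_eval_1 [simp]: "fps_eval 1 Z = 1"
  using fps_eval_const[of 1 Z] by simp

lemma fps_eval_numeral [simp]: "fps_eval (numeral n) Z = numeral n"
  using fps_eval_const[of "numeral n" Z] by (simp add: numeral_fps_const)

lemma fps_eval_X [simp]: "fps_nth Z 0 = 0 \<Longrightarrow> fps_eval fps_X Z = Z"
proof (rule fps_ext)
  fix k assume "fps_nth Z 0 = 0"
  then have "fps_nth (fps_eval fps_X Z) k = (\<Sum>p\<le>Suc k. fps_nth (fps_nth fps_X p * Z ^ p) k)"
    by (intro fps_nth_eval) auto
  also have "\<dots> = (\<Sum>p\<in>{1}. fps_nth (fps_nth fps_X p * Z ^ p) k)"
    by (intro sum.mono_neutral_right) auto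
  finally show "fps_nth (fps_eval fps_X Z) k = fps_nth Z k" by simp
qed

text \<open>The triangle i + j \<le> k may be enlarged to a square because the added terms have
  order above \<open>k\<close>; over the square the double sum factorises.\<close>

lemma fps_eval_mult:
  assumes "fps_nth Z 0 = 0"
  shows "fps_eval (V * W) Z = fps_eval V Z * fps_eval W Z"
proof (rule fps_ext)
  fix k
  let ?t = "\<lambda>i j. fps_nth (fps_nth V i * fps_nth W j * Z ^ (i + j)) k"
  have "fps_nth (fps_eval (V * W) Z) k = (\<Sum>p\<le>k. \<Sum>i\<le>p. ?t i (p - i))"
    by (simp add: fps_eval_def fps_mult_nth[of V W] sum_distrib_right fps_sum_nth atLeast0AtMost)
  also have "\<dots> = (\<Sum>(i, j)\<in>{(i, j). i + j \<le> k}. ?t i j)"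
    by (simp add: sum.triangle_reindex_eq)
  also have "\<dots> = (\<Sum>(i, j)\<in>{..k} \<times> {..k}. ?t i j)"
    by (rule sum.mono_neutral_left) (auto intro!: fps_nth_mult_power_eq_0 assms)
  also have "\<dots> = (\<Sum>i\<le>k. \<Sum>j\<le>k. fps_nth ((fps_nth V i * Z ^ i) * (fps_nth W j * Z ^ j)) k)"
    unfolding sum.cartesian_product by (simp add: power_add mult_ac)
  also have "\<dots> = (\<Sum>i\<le>k. \<Sum>j\<le>k. \<Sum>a\<le>k. fps_nth (fps_nth V i * Z ^ i) a * fps_nth (fps_nth W j * Z ^ j) (k - a))"
    by (subst fps_mult_nth) (simp add: atLeast0AtMost)
  also have "\<dots> = (\<Sum>a\<le>k. (\<Sum>i\<le>k. fps_nth (fps_nth V i * Z ^ i) a) * (\<Sum>j\<le>k. fps_nth (fps_nth W j * Z ^ j) (k - a)))"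
    unfolding sum_product
    by (subst sum.swap[of _ "{..k}" "{..k}"], subst sum.swap) (rule refl)
  also have "\<dots> = fps_nth (fps_eval V Z * fps_eval W Z) k"
    by (simp add: fps_mult_nth[of "fps_eval V Z"] fps_nth_eval[OF assms, of _ k] atLeast0AtMost)
  finally show "fps_nth (fps_eval (V * W) Z) k = fps_nth (fps_eval V Z * fps_eval W Z) k" .
qed

lemma fps_eval_power:
  "fps_nth Z 0 = 0 \<Longrightarrow> fps_eval (V ^ n) Z = fps_eval V Z ^ n"
  by (induction n) (simp_all add: fps_eval_mult)

lemmas fps_eval_simps = fps_eval_add fps_eval_diff fps_eval_mult fps_eval_power

lemma fps_compose_shift_sum:
  assumes "fps_nth y 0 = (0 :: 'a :: comm_ring_1)"
  shows "fps_nth (f * (g oo y)) n = (\<Sum>j\<le>n. fps_nth g j * fps_nth (f * y ^ j) n)"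
proof -
  have *: "fps_nth (g oo y) i = (\<Sum>j\<le>n. fps_nth g j * fps_nth (y ^ j) i)" if "i \<le> n" for i
    unfolding fps_compose_nth using that fps_nth_mult_power_eq_0[OF assms, of i _ 1]
    by (intro sum.mono_neutral_left) auto
  have "fps_nth (f * (g oo y)) n = (\<Sum>i\<le>n. fps_nth f i * (\<Sum>j\<le>n. fps_nth g j * fps_nth (y ^ j) (n - i)))"
    by (simp add: fps_mult_nth * atLeast0AtMost)
  also have "\<dots> = (\<Sum>i\<le>n. \<Sum>j\<le>n. fps_nth g j * (fps_nth f i * fps_nth (y ^ j) (n - i)))"
    by (simp add: sum_distrib_left mult_ac)
  also have "\<dots> = (\<Sum>j\<le>n. \<Sum>i\<le>n. fps_nth g j * (fps_nth f i * fps_nth (y ^ j) (n - i)))"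
    by (rule sum.swap)
  finally show ?thesis
    by (simp add: fps_mult_nth sum_distrib_left atLeast0AtMost)
qed

section \<open>Generating functions of trinomial coefficients\<close>

definition central_binomial_fps :: "'a :: comm_ring_1 fps" where
  "central_binomial_fps = Abs_fps (\<lambda>n. of_nat (2 * n choose n))"

lemma central_binomial_Suc: "Suc n * (2 * Suc n choose Suc n) = 2 * (2 * n + 1) * (2 * n choose n)"
proof -
  have "Suc n * (2 * Suc n choose Suc n) = 2 * Suc n * (Suc (2 * n) choose n)"
    using Suc_times_binomial_eq[of "Suc (2 * n)" n] by simp
  also have "Suc (2 * n) choose n = (Suc (2 * n) choose Suc n)"
    using binomial_symmetric[of n "Suc (2 * n)"] by simp
  also have "2 * Suc n * (Suc (2 * n) choose Suc n) = 2 * (Suc n * (Suc (2 * n) choose Suc n))"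
    by (simp only: mult.assoc)
  also have "Suc n * (Suc (2 * n) choose Suc n) = Suc (2 * n) * (2 * n choose n)"
    using Suc_times_binomial_eq[of "2 * n" n] by (simp only: mult.commute)
  finally show ?thesis by simp
qed

text \<open>The recursion of the central binomial coefficients reads (1 - 4X) C' = 2C, so C^2 (1 -
  4X) has derivative 0 and equals its constant term.\<close>

lemma central_binomial_fps_square:
  "(central_binomial_fps :: 'a :: {idom, semiring_char_0} fps) ^ 2 * (1 - 4 * fps_X) = 1"
proof -
  let ?C = "central_binomial_fps :: 'a fps"
  have ode: "(1 - 4 * fps_X) * fps_deriv ?C = 2 * ?C"
  proof (rule fps_ext)
    fix n
    have c: "of_nat (Suc n) * fps_nth ?C (Suc n) = 2 * (2 * of_nat n + 1) * fps_nth ?C n"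
      using arg_cong[OF central_binomial_Suc[of n], of "of_nat :: nat \<Rightarrow> 'a"]
      by (simp add: central_binomial_fps_def algebra_simps del: binomial_Suc_Suc)
    have "fps_nth ((1 - 4 * fps_X) * fps_deriv ?C) n =
        of_nat (Suc n) * fps_nth ?C (Suc n) - 4 * (of_nat n * fps_nth ?C n)"
      by (cases n) (simp_all add: algebra_simps numeral_fps_const fps_X_mult_nth)
    then show "fps_nth ((1 - 4 * fps_X) * fps_deriv ?C) n = fps_nth (2 * ?C) n"
      unfolding c by (simp add: algebra_simps numeral_fps_const)
  qed
  have "fps_deriv (?C ^ 2 * (1 - 4 * fps_X)) = 2 * ?C * ((1 - 4 * fps_X) * fps_deriv ?C) - 4 * ?C ^ 2"
    by (simp add: power2_eq_square algebra_simps)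
  also have "\<dots> = 0" unfolding ode by (simp add: power2_eq_square algebra_simps)
  finally have "?C ^ 2 * (1 - 4 * fps_X) = fps_const (fps_nth (?C ^ 2 * (1 - 4 * fps_X)) 0)"
    by (simp only: fps_deriv_eq_0_iff)
  moreover have "fps_nth (?C ^ 2 * (1 - 4 * fps_X)) 0 = 1"
    by (simp add: central_binomial_fps_def power2_eq_square)
  ultimately show ?thesis by (metis fps_const_1_eq_1)
qed

text \<open>The expansion of 1 / (1 - cX)^(m + 1).\<close>

definition neg_binomial_fps :: "nat \<Rightarrow> 'a \<Rightarrow> 'a :: comm_ring_1 fps" where
  "neg_binomial_fps m c = Abs_fps (\<lambda>n. of_nat (n + m choose m) * c ^ n)"

lemma neg_binomial_fps_0: "(1 - fps_const c * fps_X) * neg_binomial_fps 0 c = 1"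
proof (rule fps_ext)
  fix n show "fps_nth ((1 - fps_const c * fps_X) * neg_binomial_fps 0 c) n = fps_nth 1 n"
    by (cases n) (simp_all add: neg_binomial_fps_def algebra_simps binomial_eq_0)
qed

lemma neg_binomial_fps_Suc: "(1 - fps_const c * fps_X) * neg_binomial_fps (Suc m) c = neg_binomial_fps m c"
proof (rule fps_ext)
  fix n show "fps_nth ((1 - fps_const c * fps_X) * neg_binomial_fps (Suc m) c) n = fps_nth (neg_binomial_fps m c) n"
    by (cases n) (simp_all add: neg_binomial_fps_def algebra_simps binomial_eq_0)
qed

lemma neg_binomial_fps_power: "neg_binomial_fps 0 c ^ Suc m = neg_binomial_fps m c"
proof (induction m)
  case (Suc m)
  have "neg_binomial_fps 0 c ^ Suc (Suc m) = neg_binomial_fps 0 c * neg_binomial_fps m c"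
    using Suc by simp
  also have "\<dots> = ((1 - fps_const c * fps_X) * neg_binomial_fps 0 c) * neg_binomial_fps (Suc m) c"
    by (simp only: neg_binomial_fps_Suc[of c m, symmetric] mult_ac)
  finally show ?case by (simp add: neg_binomial_fps_0)
qed simp

text \<open>The coefficient of index \<open>n\<close> is that of \<open>z\<^bsup>0\<^esup>\<close> in \<open>(z + q + r / z)\<^bsup>n\<^esup>\<close> for \<open>trinom0\<close>, and
  that of \<open>z\<^bsup>-1\<^esup>\<close> in \<open>(z + q + r / z)\<^bsup>n - 1\<^esup>\<close> for \<open>trinom1\<close>.\<close>
definition trinom0 :: "'a \<Rightarrow> 'a \<Rightarrow> 'a :: comm_ring_1 fps" where
  "trinom0 r q = Abs_fps (\<lambda>n. \<Sum>j=0..n div 2. of_nat ((n choose (2 * j)) * (2 * j choose j)) * r ^ j * q ^ (n - 2 * j))"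

definition trinom1 :: "'a \<Rightarrow> 'a \<Rightarrow> 'a :: comm_ring_1 fps" where
  "trinom1 r q = Abs_fps (\<lambda>n. \<Sum>j=1..n div 2. of_nat (((n - 1) choose (j - 1)) * ((n - j) choose j)) * r ^ j * q ^ (n - 2 * j))"

text \<open>Pascal's rule in row \<open>n\<close>, with the middle coefficient of row
  \<open>2 * j\<close> written as twice a coefficient of the row before. The remaining product is
  the trinomial coefficient with parts j - 1, j and n - 2j.\<close>

lemma trinom1_binomial:
  assumes "1 \<le> j" "2 * j \<le> n"
  shows "2 * (((n - 1) choose (j - 1)) * ((n - j) choose j)) + ((n - 1) choose (2 * j)) * (2 * j choose j) = (n choose (2 * j)) * (2 * j choose j)"
proof -
  obtain i where j: "j = Suc i" using assms by (cases j) auto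
  obtain n' where n: "n = Suc n'" using assms by (cases n) auto
  have s: "2 * j choose j = 2 * (Suc (2 * i) choose i)"
  proof -
    have "Suc (2 * i) choose Suc i = Suc (2 * i) choose i"
      using binomial_symmetric[of i "Suc (2 * i)"] by simp
    then show ?thesis by (simp add: j)
  qed
  have "(n' choose (Suc (2 * i))) * (Suc (2 * i) choose i) = (n' choose i) * ((n' - i) choose (Suc i))"
    using choose_mult[of i "Suc (2 * i)" n'] assms by (simp add: j n)
  moreover have "n choose (2 * j) = (n' choose (Suc (2 * i))) + (n' choose (2 * j))"
    by (simp add: n j)
  ultimately have "(n choose (2 * j)) * (2 * j choose j) =
      2 * ((n' choose i) * ((n' - i) choose (Suc i))) + (n' choose (2 * j)) * (2 * j choose j)"
    unfolding s by (simp add: algebra_simps)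
  then show ?thesis by (simp add: n j)
qed

text \<open>In the coefficient of z^0, split one factor z + q + r/z off the n-th power: q gives the
  term with \<open>trinom0\<close>, while z and r/z contribute equally by the symmetry that
  exchanges them. In terms of binomials this is \<open>trinom1_binomial\<close>.\<close>

lemma trinom1_trinom0:
  "2 * trinom1 r q = trinom0 r q - 1 - fps_const q * fps_X * (trinom0 r q :: 'a :: comm_ring_1 fps)"
proof (rule fps_ext)
  fix n
  show "fps_nth (2 * trinom1 r q) n = fps_nth (trinom0 r q - 1 - fps_const q * fps_X * trinom0 r q) n"
  proof (cases n)
    case 0
    then show ?thesis by (simp add: trinom0_def trinom1_def)
  next
    case (Suc n')
    let ?a = "\<lambda>n j. of_nat ((n choose (2 * j)) * (2 * j choose j)) * r ^ j * q ^ (n - 2 * j)"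
    let ?b = "\<lambda>j. of_nat (((n - 1) choose (j - 1)) * ((n - j) choose j)) * r ^ j * q ^ (n - 2 * j)"
    let ?c = "\<lambda>j. of_nat ((n' choose (2 * j)) * (2 * j choose j)) * r ^ j * q ^ (n - 2 * j)"
    have e: "q * (\<Sum>j=0..n' div 2. ?a n' j) = (\<Sum>j=0..n div 2. ?c j)"
    proof -
      have "q * (\<Sum>j=0..n' div 2. ?a n' j) = (\<Sum>j=0..n' div 2. ?c j)"
        unfolding sum_distrib_left
      proof (rule sum.cong[OF refl])
        fix j assume "j \<in> {0..n' div 2}"
        then have "n - 2 * j = Suc (n' - 2 * j)" using Suc by auto
        then show "q * ?a n' j = ?c j" by (simp add: mult_ac)
      qed
      also have "\<dots> = (\<Sum>j=0..n div 2. ?c j)"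
      proof (rule sum.mono_neutral_left)
        show "\<forall>j\<in>{0..n div 2} - {0..n' div 2}. ?c j = 0"
        proof
          fix j assume "j \<in> {0..n div 2} - {0..n' div 2}"
          then have "n' < 2 * j" by auto
          then show "?c j = 0" by (simp add: binomial_eq_0)
        qed
      qed (auto simp: Suc)
      finally show ?thesis .
    qed
    have "2 * (\<Sum>j=1..n div 2. ?b j) + (\<Sum>j=0..n div 2. ?c j) = (\<Sum>j=0..n div 2. ?a n j)"
    proof -
      have "2 * ?b j + ?c j = ?a n j" if "j \<in> {1..n div 2}" for j
      proof -
        have "?a n j = of_nat (2 * (((n - 1) choose (j - 1)) * ((n - j) choose j)) + ((n - 1) choose (2 * j)) * (2 * j choose j)) * r ^ j * q ^ (n - 2 * j)"
          by (subst trinom1_binomial) (use that in auto)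
        then show ?thesis using Suc by (simp add: algebra_simps)
      qed
      then have "(\<Sum>j=1..n div 2. 2 * ?b j + ?c j) = (\<Sum>j=1..n div 2. ?a n j)"
        by (intro sum.cong) auto
      moreover have "(\<Sum>j=0..n div 2. f j) = f 0 + (\<Sum>j=1..n div 2. f j)" for f :: "nat \<Rightarrow> 'a"
        by (simp add: sum.atLeast_Suc_atMost)
      ultimately show ?thesis
        by (simp add: sum.distrib sum_distrib_left)
    qed
    then show ?thesis using e Suc
      by (simp add: trinom0_def trinom1_def numeral_fps_const mult.assoc algebra_simps)
  qed
qed

text \<open>With u = 1 / (1 - qX), summing over n for fixed j gives r^j X^(2j) u^(2j+1), so
  \<open>trinom0 r q\<close> is u C(y) with y = r X^2 u^2 and C the central binomial series; then
  C^2 (1 - 4y) = 1 applies.\<close>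

lemma trinom0_square:
  fixes r q :: "'a :: {idom, semiring_char_0}"
  shows "trinom0 r q ^ 2 * ((1 - fps_const q * fps_X) ^ 2 - 4 * fps_const r * fps_X ^ 2) = 1"
proof -
  define u where "u = neg_binomial_fps 0 q"
  define y where "y = fps_const r * fps_X ^ 2 * u ^ 2"
  have u: "(1 - fps_const q * fps_X) * u = 1" unfolding u_def by (rule neg_binomial_fps_0)
  have y0: "fps_nth y 0 = 0" by (simp add: y_def)
  have "trinom0 r q = u * (central_binomial_fps oo y)"
  proof (rule fps_ext)
    fix n
    have uy: "fps_nth (u * y ^ j) n = (if 2 * j \<le> n then of_nat (n choose (2 * j)) * r ^ j * q ^ (n - 2 * j) else 0)" for j
    proof -
      have "u * y ^ j = fps_const (r ^ j) * (fps_X ^ (2 * j) * u ^ Suc (2 * j))"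
        by (simp add: y_def power_mult_distrib mult_ac flip: fps_const_power power_mult)
      also have "u ^ Suc (2 * j) = neg_binomial_fps (2 * j) q"
        unfolding u_def by (rule neg_binomial_fps_power)
      finally show ?thesis
        by (simp add: fps_X_power_mult_nth neg_binomial_fps_def mult_ac)
    qed
    have "fps_nth (u * (central_binomial_fps oo y)) n =
        (\<Sum>j\<le>n. of_nat (2 * j choose j) * (if 2 * j \<le> n then of_nat (n choose (2 * j)) * r ^ j * q ^ (n - 2 * j) else 0))"
      unfolding fps_compose_shift_sum[OF y0] uy by (simp add: central_binomial_fps_def)
    also have "\<dots> = (\<Sum>j=0..n div 2. of_nat ((n choose (2 * j)) * (2 * j choose j)) * r ^ j * q ^ (n - 2 * j))"
      by (rule sum.mono_neutral_cong_right) (auto simp: mult_ac)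
    finally show "fps_nth (trinom0 r q) n = fps_nth (u * (central_binomial_fps oo y)) n"
      by (simp add: trinom0_def)
  qed
  moreover have "(central_binomial_fps oo y) ^ 2 * (1 - 4 * y) = 1"
    using arg_cong[OF central_binomial_fps_square, of "\<lambda>f. f oo y"]
    by (simp add: fps_compose_mult_distrib[OF y0] fps_compose_sub_distrib fps_compose_power[OF y0, symmetric] y0)
  ultimately have "trinom0 r q ^ 2 * (1 - 4 * y) = u ^ 2"
    by (simp add: power_mult_distrib mult.assoc)
  then have "((1 - fps_const q * fps_X) * u) ^ 2 = trinom0 r q ^ 2 * (1 - 4 * y) * (1 - fps_const q * fps_X) ^ 2"
    by (simp add: power_mult_distrib mult_ac)
  also have "\<dots> = trinom0 r q ^ 2 * ((1 - fps_const q * fps_X) ^ 2 - 4 * fps_const r * fps_X ^ 2 * ((1 - fps_const q * fps_X) * u) ^ 2)"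
    by (simp only: y_def power_mult_distrib)
      (simp only: right_diff_distrib left_diff_distrib mult_1_right mult_1_left mult_ac)
  finally show ?thesis by (simp add: u)
qed

section \<open>Equations for the specialised R and S\<close>

lemma fps_nth_eval_X:
  "fps_nth (fps_eval W fps_X) k = (\<Sum>p\<le>k. fps_nth (fps_nth W p) (k - p))"
  unfolding fps_eval_def fps_nth_Abs_fps
  by (intro sum.cong refl) (simp add: fps_X_power_mult_right_nth)

lemma all_weights_eq: "all_weights = power_weights (\<lambda>_. 1)"
  by (simp add: fun_eq_iff all_weights_def power_weights_def)

lemma even_weights_eq: "even_weights = power_weights (\<lambda>n. if even n then 1 else 0)"
  by (simp add: fun_eq_iff even_weights_def power_weights_def)

lemma RS_subst:
  fixes e
  assumes "RS_solution R S"
  defines "r \<equiv> mfps_subst (power_weights e) R" and "q \<equiv> mfps_subst (power_weights e) S"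
  shows "fps_nth r k = (if k = 0 then 1 else 0) + (\<Sum>n=1..k. e n * fps_nth (fps_nth (trinom1 r q) n) (k - n))"
    and "fps_nth q k = (\<Sum>n=1..k. e n * fps_nth (fps_nth (trinom0 r q) (n - 1)) (k - n))"
proof -
  let ?s = "mfps_subst (power_weights e)"
  have *: "?s (of_nat c * f ^ i * g ^ j) = of_nat c * ?s f ^ i * ?s g ^ j" for c f i g j
    by (simp only: mfps_subst_mult mfps_subst_of_nat mfps_subst_power)
  have R: "R = 1 + mfps_infsum (\<lambda>n. indet n *
           (\<Sum>j = 1..n div 2. of_nat (((n - 1) choose (j - 1)) * ((n - j) choose j))
              * R ^ j * S ^ (n - 2 * j))) {1..}" (is "R = ?R")
    using assms(1) unfolding RS_solution_def by (elim conjE)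
  have "fps_nth r k = fps_nth (?s ?R) k"
    unfolding r_def by (subst R) (rule refl)
  also have "\<dots> = (if k = 0 then 1 else 0) + (\<Sum>n=1..k. e n * fps_nth (fps_nth (trinom1 r q) n) (k - n))"
    unfolding mfps_subst_add mfps_subst_1 fps_add_nth fps_one_nth fps_nth_subst_infsum mfps_subst_sum *
    by (simp add: trinom1_def r_def q_def)
  finally show "fps_nth r k = (if k = 0 then 1 else 0) + (\<Sum>n=1..k. e n * fps_nth (fps_nth (trinom1 r q) n) (k - n))" .
  have S: "S = mfps_infsum (\<lambda>n. indet n *
           (\<Sum>j = 0..(n - 1) div 2. of_nat (((n - 1) choose (2 * j)) * ((2 * j) choose j))
              * R ^ j * S ^ (n - 2 * j - 1))) {1..}" (is "S = ?S")
    using assms(1) unfolding RS_solution_def by (elim conjE)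
  have "fps_nth q k = fps_nth (?s ?S) k"
    unfolding q_def by (subst S) (rule refl)
  also have "\<dots> = (\<Sum>n=1..k. e n * fps_nth (fps_nth (trinom0 r q) (n - 1)) (k - n))"
    unfolding fps_nth_subst_infsum mfps_subst_sum *
    by (simp add: trinom0_def r_def q_def diff_commute)
  finally show "fps_nth q k = (\<Sum>n=1..k. e n * fps_nth (fps_nth (trinom0 r q) (n - 1)) (k - n))" .
qed

text \<open>Evaluating the outer variable at \<open>fps_X\<close> sums over n with a_n = s^n, so the
  identities between the trinomial series become equations between \<open>r\<close>,
  \<open>q\<close> and the inverse square root \<open>a\<close>.\<close>

lemma trinom_eval:
  fixes r q :: "rat fps"
  assumes "r = 1 + fps_eval (trinom1 r q) fps_X"
  defines "a \<equiv> fps_eval (trinom0 r q) fps_X"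
  shows "2 * r = 1 + a - q * fps_X * a" "a ^ 2 * ((1 - q * fps_X) ^ 2 - 4 * r * fps_X ^ 2) = 1" "fps_nth a 0 = 1"
proof -
  have "fps_eval (2 * trinom1 r q) fps_X = a - 1 - q * fps_X * a"
    unfolding trinom1_trinom0 by (simp add: fps_eval_simps a_def)
  then have "2 * fps_eval (trinom1 r q) fps_X = a - 1 - q * fps_X * a"
    by (simp add: fps_eval_simps)
  moreover have "2 * r = 2 + 2 * fps_eval (trinom1 r q) fps_X"
    by (subst assms(1)) (simp add: algebra_simps)
  ultimately show "2 * r = 1 + a - q * fps_X * a" by simp
  show "a ^ 2 * ((1 - q * fps_X) ^ 2 - 4 * r * fps_X ^ 2) = 1"
    using arg_cong[OF trinom0_square[of r q], of "\<lambda>W. fps_eval W fps_X"]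
    by (simp add: fps_eval_simps a_def)
  show "fps_nth a 0 = 1" by (simp add: a_def fps_nth_eval_X trinom0_def)
qed

lemma fps_eval_X_shift:
  "fps_nth (fps_X * fps_eval W fps_X) k = (\<Sum>n=1..k. fps_nth (fps_nth W (n - 1)) (k - n))"
proof (cases k)
  case (Suc k')
  have "(\<Sum>n=1..Suc k'. fps_nth (fps_nth W (n - 1)) (Suc k' - n)) = (\<Sum>p\<le>k'. fps_nth (fps_nth W p) (k' - p))"
    by (rule sum.reindex_bij_witness[of _ Suc "\<lambda>n. n - 1"]) auto
  then show ?thesis by (simp add: Suc fps_nth_eval_X)
qed simp

lemma fps_eval_X_trinom1:
  "fps_nth (fps_eval (trinom1 r q) fps_X) k = (\<Sum>n=1..k. fps_nth (fps_nth (trinom1 r q) n) (k - n))"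
  unfolding fps_nth_eval_X by (rule sum.mono_neutral_right) (auto simp: trinom1_def not_less_eq_eq)

text \<open>Eliminating \<open>a\<close> and \<open>r\<close> leaves a quartic equation in
  \<open>q\<close> that splits into two quadratic factors; the lowest order decides which one
  vanishes.\<close>

lemma RS_all:
  assumes "RS_solution R S"
  defines "r \<equiv> mfps_subst all_weights R" and "q \<equiv> mfps_subst all_weights S" and "s \<equiv> fps_X :: rat fps"
  shows "3 * s * q ^ 2 - q + s = 0" "9 * s ^ 2 * r ^ 2 - (12 * s ^ 2 + 1) * r + 4 * s ^ 2 + 1 = 0"
proof -
  define a where "a = fps_eval (trinom0 r q) fps_X"
  have r: "r = 1 + fps_eval (trinom1 r q) fps_X"
    using RS_subst(1)[OF assms(1), where e = "\<lambda>_. 1"]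
    by (intro fps_ext) (simp add: fps_eval_X_trinom1 r_def q_def all_weights_eq)
  have q: "q = s * a"
    using RS_subst(2)[OF assms(1), where e = "\<lambda>_. 1"] unfolding a_def s_def
    by (intro fps_ext) (simp only: fps_eval_X_shift r_def q_def all_weights_eq mult_1)
  note t = trinom_eval[OF r, folded a_def s_def]
  have sr: "2 * s * r = q + s - s * q ^ 2"
  proof -
    have "2 * s * r = s * (2 * r)" by simp
    also have "\<dots> = s + s * a - s * q * (s * a)" unfolding t(1) by (simp add: algebra_simps)
    finally have "2 * s * r = s + s * a - s * q * (s * a)" .
    then have "2 * s * r = s + q - s * q * q" unfolding q[symmetric] .
    then show ?thesis by (simp add: power2_eq_square algebra_simps)
  qed
  have "q ^ 2 * ((1 - s * q) ^ 2 - 2 * s * (2 * s * r)) = s ^ 2 * (a ^ 2 * ((1 - q * s) ^ 2 - 4 * r * s ^ 2))"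
    by (subst q) (simp add: power2_eq_square algebra_simps)
  then have "q ^ 2 * ((1 - s * q) ^ 2 - 2 * s * (q + s - s * q ^ 2)) = s ^ 2"
    unfolding sr t(2) by simp
  moreover have "(3 * s * q ^ 2 - q + s) * (s * q ^ 2 - q - s) =
      q ^ 2 * ((1 - s * q) ^ 2 - 2 * s * (q + s - s * q ^ 2)) - s ^ 2"
    by (simp add: power2_eq_square algebra_simps)
  ultimately have "(3 * s * q ^ 2 - q + s) * (s * q ^ 2 - q - s) = 0"
    by simp
  \<comment> \<open>After insertion of \<open>q = s * a\<close> and division by \<open>s\<close>,
    this factor has constant term -2, because \<open>a\<close> starts with 1.\<close>
  moreover have "s * q ^ 2 - q - s \<noteq> 0"
  proof
    assume "s * q ^ 2 - q - s = 0"
    then have "s * (s * q * a - a - 1) = 0" 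
      by (simp add: q power2_eq_square algebra_simps)
    then have "s * q * a - a - 1 = 0" by (simp add: s_def)
    then have "fps_nth (s * q * a - a - 1) 0 = 0" by simp
    then show False using t(3) by (simp add: s_def)
  qed
  ultimately show 1: "3 * s * q ^ 2 - q + s = 0" by simp
  \<comment> \<open>On the chosen branch the quadratic term of \<open>sr\<close> can be removed, so
    \<open>q\<close> is linear in \<open>r\<close>. Substituting it back gives the equation for
    \<open>r\<close>, whose constant term \<open>4 * s ^ 2 + 1\<close> agrees with r = 1 + s^2 +
    ....\<close>
  have "2 * (q - s * (3 * r - 2)) =
      (3 * s * q ^ 2 - q + s) - 3 * (2 * s * r - (q + s - s * q ^ 2))"
    by (simp add: algebra_simps)
  then have "q = s * (3 * r - 2)"
    by (simp add: 1 sr)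
  moreover have "3 * s * (s * (3 * r - 2)) ^ 2 - s * (3 * r - 2) + s =
      3 * (s * (9 * s ^ 2 * r ^ 2 - (12 * s ^ 2 + 1) * r + 4 * s ^ 2 + 1))"
    by (simp add: power2_eq_square algebra_simps)
  ultimately have "3 * (s * (9 * s ^ 2 * r ^ 2 - (12 * s ^ 2 + 1) * r + 4 * s ^ 2 + 1)) = 0"
    using 1 by simp
  then show "9 * s ^ 2 * r ^ 2 - (12 * s ^ 2 + 1) * r + 4 * s ^ 2 + 1 = 0"
    by (simp add: s_def)
qed

text \<open>For even weights every term of the equation for S contains an odd power of S besides a
  positive power of \<open>s\<close>, which forces S = 0 by comparison of lowest orders. Then the
  odd coefficients of \<open>trinom1\<close> vanish, so the restriction to even \<open>n\<close> may
  be dropped.\<close>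

lemma RS_even:
  assumes "RS_solution R S"
  defines "r \<equiv> mfps_subst even_weights R" and "s \<equiv> fps_X :: rat fps"
  shows "4 * r ^ 2 * s ^ 2 - r * (1 + 4 * s ^ 2) + s ^ 2 + 1 = 0"
proof -
  define e :: "nat \<Rightarrow> rat" where "e n = (if even n then 1 else 0)" for n
  define q where "q = mfps_subst even_weights S"
  have ev: "even_weights = power_weights e" by (simp add: even_weights_eq e_def[abs_def])
  note rs = RS_subst[OF assms(1), where e = e, folded ev, folded r_def q_def]
  have odd: "q dvd fps_nth (trinom0 r q) n" if "odd n" for n
    unfolding trinom0_def fps_nth_Abs_fps
  proof (intro dvd_sum dvd_mult)
    fix j assume "j \<in> {0..n div 2}"
    with that have "0 < n - 2 * j" by (auto elim!: oddE)
    then show "q dvd q ^ (n - 2 * j)" by (simp add: dvd_power)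
  qed
  have q0: "q = 0"
  proof (rule ccontr)
    assume "q \<noteq> 0"
    define d where "d = subdegree q"
    have z: "fps_nth f i = 0" if "q dvd f" "i < d" for f i
    proof -
      obtain g where "f = q * g" using \<open>q dvd f\<close> by (elim dvdE)
      moreover have "fps_nth q x = 0" if "x \<le> i" for x
        using that \<open>i < d\<close> unfolding d_def by (intro nth_less_subdegree_zero) simp
      ultimately show ?thesis by (simp add: fps_mult_nth)
    qed
    have "fps_nth q d = 0"
      unfolding rs(2)[of d] by (rule sum.neutral) (auto simp: e_def intro!: z odd)
    with \<open>q \<noteq> 0\<close> show False by (simp add: d_def)
  qed
  have odd1: "fps_nth (trinom1 r q) n = 0" if "odd n" for n
  proof -
    have "2 * fps_nth (trinom1 r q) n = fps_nth (2 * trinom1 r q) n" by (simp add: numeral_fps_const)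
    also have "\<dots> = 0"
      unfolding trinom1_trinom0 using odd[OF that] that by (auto simp: q0 intro!: Nat.gr0I)
    finally show ?thesis by simp
  qed
  have r: "r = 1 + fps_eval (trinom1 r q) fps_X"
  proof (rule fps_ext)
    fix k show "fps_nth r k = fps_nth (1 + fps_eval (trinom1 r q) fps_X) k"
      unfolding rs(1)[of k] fps_add_nth fps_one_nth fps_eval_X_trinom1
      by (intro arg_cong2[of _ _ _ _ "(+)"] sum.cong refl) (auto simp: e_def odd1)
  qed
  note t = trinom_eval[OF r, unfolded q0, simplified]
  have a: "fps_eval (trinom0 r 0) fps_X = 2 * r - 1" using t(1) by (simp add: algebra_simps)
  have "4 * r * (4 * r ^ 2 * s ^ 2 - r * (1 + 4 * s ^ 2) + s ^ 2 + 1) = 1 - (2 * r - 1) ^ 2 * (1 - 4 * r * s ^ 2)"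
    by (simp add: power2_eq_square algebra_simps)
  also have "(2 * r - 1) ^ 2 * (1 - 4 * r * s ^ 2) = 1"
    using t(2) unfolding a s_def by (simp only: mult.assoc)
  finally have "4 * r * (4 * r ^ 2 * s ^ 2 - r * (1 + 4 * s ^ 2) + s ^ 2 + 1) = 0"
    by simp
  moreover have "r \<noteq> 0"
  proof
    assume "r = 0"
    then have "fps_nth r 0 = 0" by simp
    then show False unfolding rs(1)[of 0] by simp
  qed
  ultimately show ?thesis by simp
qed

section \<open>The quadratic method\<close>

text \<open>Completing the square: the discriminant is the square of \<open>2 * a * W + b\<close>,
  and a square vanishes doubly where its root vanishes.\<close>

lemma discriminant_double_root:
  fixes W a b c :: "'a :: comm_ring_1 fps fps"
  assumes q: "a * W ^ 2 + b * W + c = 0" and Z: "fps_nth Z 0 = 0"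
    and root: "fps_eval (2 * a * W + b) Z = 0"
  shows "fps_eval (b ^ 2 - 4 * a * c) Z = 0" "fps_eval (fps_deriv (b ^ 2 - 4 * a * c)) Z = 0"
proof -
  define V where "V = 2 * a * W + b"
  have "V ^ 2 = 4 * a * (a * W ^ 2 + b * W + c) + (b ^ 2 - 4 * a * c)"
    by (simp add: V_def power2_eq_square algebra_simps)
  then have V: "b ^ 2 - 4 * a * c = V * V"
    unfolding q by (simp add: power2_eq_square)
  have "fps_eval V Z = 0" using root by (simp add: V_def)
  then show "fps_eval (b ^ 2 - 4 * a * c) Z = 0" "fps_eval (fps_deriv (b ^ 2 - 4 * a * c)) Z = 0"
    unfolding V by (simp_all add: fps_eval_mult[OF Z] fps_eval_add)
qed

section \<open>Fixed point equations for power series\<close>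

definition fps_agree :: "nat \<Rightarrow> 'a :: zero fps \<Rightarrow> 'a fps \<Rightarrow> bool" where
  "fps_agree k f g \<longleftrightarrow> (\<forall>i\<le>k. fps_nth f i = fps_nth g i)"

lemma fps_agree_refl [simp]: "fps_agree k f f"
  by (simp add: fps_agree_def)

lemma fps_agree_add: "fps_agree k f g \<Longrightarrow> fps_agree k f' g' \<Longrightarrow> fps_agree k (f + f') (g + g')"
  by (simp add: fps_agree_def)

lemma fps_agree_diff: "fps_agree k f g \<Longrightarrow> fps_agree k f' g' \<Longrightarrow> fps_agree k (f - f') (g - g' :: 'a :: group_add fps)"
  by (simp add: fps_agree_def)

lemma fps_agree_mult: "fps_agree k f g \<Longrightarrow> fps_agree k f' g' \<Longrightarrow> fps_agree k (f * f') (g * g' :: 'a :: comm_ring_1 fps)"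
  by (auto simp: fps_agree_def fps_mult_nth intro!: sum.cong)

lemma fps_agree_power: "fps_agree k f g \<Longrightarrow> fps_agree k (f ^ n) (g ^ n :: 'a :: comm_ring_1 fps)"
  by (induction n) (auto intro: fps_agree_mult)

lemma fps_agree_eval: "fps_agree k f g \<Longrightarrow> fps_agree k (fps_eval W f) (fps_eval W g)"
proof -
  assume *: "fps_agree k f g"
  have "fps_agree k (fps_nth W p * f ^ p) (fps_nth W p * g ^ p)" for p
    by (intro fps_agree_mult fps_agree_power fps_agree_refl *)
  then show ?thesis unfolding fps_agree_def fps_eval_def by (auto intro!: sum.cong)
qed

lemmas fps_agree_intros = fps_agree_refl fps_agree_add fps_agree_diff fps_agree_mult fps_agree_power fps_agree_eval

text \<open>A contraction in the X-adic sense: \<open>\<Psi>\<close> preserves agreement up to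
  degree \<open>k\<close>, and the factor \<open>fps_X\<close> gains one degree. The coefficient of
  index \<open>k\<close> is therefore stable after \<open>Suc k\<close> iterations.\<close>

lemma fps_fixed_point:
  fixes \<Psi> :: "'a :: comm_ring_1 fps \<Rightarrow> 'a fps"
  assumes "\<And>k f g. fps_agree k f g \<Longrightarrow> fps_agree k (\<Psi> f) (\<Psi> g)"
  shows "\<exists>Y. Y = c + fps_X * \<Psi> Y"
proof -
  define \<Phi> where "\<Phi> Y = c + fps_X * \<Psi> Y" for Y
  define Y where "Y = Abs_fps (\<lambda>k. fps_nth ((\<Phi> ^^ Suc k) 0) k)"
  have step: "fps_nth (\<Phi> f) k = fps_nth (\<Phi> g) k" if "\<forall>i<k. fps_nth f i = fps_nth g i" for f g k
  proof (cases k)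
    case (Suc j)
    then have "fps_agree j f g" using that by (simp add: fps_agree_def)
    from assms[OF this] show ?thesis by (simp add: \<Phi>_def Suc fps_agree_def)
  qed (simp add: \<Phi>_def)
  have stable: "\<forall>i<n. fps_nth ((\<Phi> ^^ Suc n) 0) i = fps_nth ((\<Phi> ^^ n) 0) i" for n
  proof (induction n)
    case (Suc n)
    show ?case
    proof (intro allI impI)
      fix i assume "i < Suc n"
      then have "\<forall>j<i. fps_nth ((\<Phi> ^^ Suc n) 0) j = fps_nth ((\<Phi> ^^ n) 0) j" using Suc by auto
      from step[OF this] show "fps_nth ((\<Phi> ^^ Suc (Suc n)) 0) i = fps_nth ((\<Phi> ^^ Suc n) 0) i" by simp
    qed
  qed simp
  have lim: "i < n \<Longrightarrow> fps_nth ((\<Phi> ^^ n) 0) i = fps_nth Y i" for i n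
  proof (induction n)
    case (Suc n)
    show ?case
    proof (cases "i < n")
      case True
      then show ?thesis using Suc.IH stable[of n] by simp
    next
      case False
      then have "i = n" using Suc.prems by simp
      then show ?thesis by (simp add: Y_def)
    qed
  qed simp
  have "Y = \<Phi> Y"
  proof (rule fps_ext)
    fix k
    have "fps_nth (\<Phi> Y) k = fps_nth (\<Phi> ((\<Phi> ^^ k) 0)) k"
      by (rule step) (simp add: lim)
    then show "fps_nth Y k = fps_nth (\<Phi> Y) k" using lim[of k "Suc k"] by simp
  qed
  then show ?thesis by (auto simp: \<Phi>_def)
qed

section \<open>The specialised loop equations\<close>

lemma sum_Icc_Suc_shift:
  fixes g :: "nat \<Rightarrow> 'a :: comm_monoid_add"
  shows "(\<Sum>n=1..Suc k. g n) = g 1 + (\<Sum>n=1..k. g (Suc n))"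
  by (induction k) (simp_all add: add.assoc)

text \<open>The planar loop equation after the substitution \<open>a\<^sub>n = e\<^sub>n s\<^bsup>n\<^esup>\<close>, where \<open>s\<close> is the square root
  of \<open>t\<close>; \<open>w\<^sub>n\<close> is the planar limit of \<open>Tr (M\<^bsup>n\<^esup>) / N\<close>.\<close>
locale planar_recursion =
  fixes e :: "nat \<Rightarrow> rat" and w :: "nat \<Rightarrow> rat fps" and T :: "nat \<Rightarrow> rat fps"
  assumes w0: "w 0 = 1"
    and w_Suc: "w (Suc p) = (\<Sum>i<p. w i * w (p - 1 - i)) + T p"
    and T_nth: "fps_nth (T p) k = (\<Sum>n=1..k. e n * fps_nth (w (p + n - 1)) (k - n))"
begin

text \<open>This is the symmetry under simultaneous change of sign of M and s. \<open>T p\<close>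
  involves moments of possibly larger index but strictly lower order, so the induction is on the
  order first and on the index second.\<close>

lemma parity: "odd (p + k) \<Longrightarrow> fps_nth (w p) k = 0"
proof (induction k arbitrary: p rule: less_induct)
  case (less k)
  note IHk = less.IH
  show ?case using less.prems
  proof (induction p rule: less_induct)
    case (less p)
    show ?case
    proof (cases p)
      case 0
      then show ?thesis using less.prems by (auto simp: w0 intro!: Nat.gr0I)
    next
      case (Suc p')
      have z: "fps_nth (w i) a = 0" if "odd (i + a)" "a \<le> k" "i < p" for i a
        using that IHk[of a i] less.IH[of i] by (cases "a = k") auto
      have "fps_nth (w i * w (p' - 1 - i)) k = 0" if "i < p'" for i
        unfolding fps_mult_nth
      proof (rule sum.neutral, rule ballI)
        fix a assume a: "a \<in> {0..k}"
        have "(i + a) + ((p' - 1 - i) + (k - a)) + 2 = p + k"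
          using a that Suc by auto
        then have "odd ((i + a) + ((p' - 1 - i) + (k - a)))"
          using less.prems by (metis even_add even_numeral)
        then have "odd (i + a) \<or> odd ((p' - 1 - i) + (k - a))"
          using odd_add by blast
        then show "fps_nth (w i) a * fps_nth (w (p' - 1 - i)) (k - a) = 0"
        proof
          assume "odd (i + a)"
          then have "fps_nth (w i) a = 0" using a that Suc by (intro z) auto
          then show ?thesis by simp
        next
          assume "odd ((p' - 1 - i) + (k - a))"
          then have "fps_nth (w (p' - 1 - i)) (k - a) = 0" using a that Suc by (intro z) auto
          then show ?thesis by simp
        qed
      qed
      moreover have "fps_nth (T p') k = 0"
        unfolding T_nth
      proof (rule sum.neutral, rule ballI)
        fix n assume n: "n \<in> {1..k}"
        then have "(p' + n - 1) + (k - n) + 2 = p + k" using Suc by auto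
        then have "odd ((p' + n - 1) + (k - n))"
          using less.prems by (metis even_add even_numeral)
        then have "fps_nth (w (p' + n - 1)) (k - n) = 0" using n by (intro IHk) auto
        then show "e n * fps_nth (w (p' + n - 1)) (k - n) = 0" by simp
      qed
      ultimately show ?thesis
        unfolding Suc w_Suc by (simp add: fps_sum_nth)
    qed
  qed
qed

lemma parity_T: "odd k \<Longrightarrow> fps_nth (T 1) k = 0"
  unfolding T_nth by (rule sum.neutral) (auto intro!: parity)

end

text \<open>\<open>P\<close> and \<open>E\<close> are the values of the coefficients b and c at the
  double root up to a factor s; \<open>h\<close> and \<open>h'\<close> say that the discriminant and
  its derivative vanish there. They give the parametrisation t = D (1 - 2D) / (1 + D)^2, B = (1 +
  D)(1 - 3D) / (1 - 2D)^2, after which the claim is a polynomial identity in D.\<close>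

lemma double_root_elim_all:
  fixes t Y D P E B :: "'a :: idom"
  assumes Y: "Y = D + 1" and P: "P = t * Y ^ 2 - D" and E: "E = D - t * Y * B"
    and h: "P ^ 2 = 4 * t * Y ^ 2 * D * E"
    and h': "P * (2 * t * Y - 1) = 2 * t * ((2 * Y * D + Y ^ 2) * E + Y ^ 2 * D * (1 - t * B))"
    and nz: "t * Y ^ 2 + D \<noteq> 0" "D \<noteq> 0" "Y \<noteq> 0" "1 - 2 * D \<noteq> 0" "(2 :: 'a) \<noteq> 0"
  shows "27 * t ^ 2 * B ^ 2 + (1 - 18 * t) * B + 16 * t - 1 = 0"
proof -
  define Q where "Q = t * Y ^ 2"
  have Q: "Q = P + D" by (simp add: Q_def P)
  \<comment> \<open>Multiplication by \<open>2 * Y * D\<close> makes the product 4 t Y^2 D E appear,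
    which \<open>h\<close> replaces by \<open>P ^ 2\<close>. Then only P and D are left, and their
    relation factorises.\<close>
  have "2 * Y * D * (2 * t * ((2 * Y * D + Y ^ 2) * E + Y ^ 2 * D * (1 - t * B))) =
      4 * Q * D * ((2 * D + Y) * E + D * (Y - t * Y * B))"
    unfolding Q_def by (simp add: power2_eq_square algebra_simps)
  also have "Y - t * Y * B = E + 1" by (simp add: E Y)
  also have "4 * Q * D * ((2 * D + Y) * E + D * (E + 1)) = (4 * D + 1) * (4 * t * Y ^ 2 * D * E) + 4 * Q * D ^ 2"
    unfolding Q_def by (simp add: Y power2_eq_square algebra_simps)
  also have "\<dots> = (4 * D + 1) * P ^ 2 + 4 * Q * D ^ 2" unfolding h ..
  finally have "2 * Y * D * (P * (2 * t * Y - 1)) = (4 * D + 1) * P ^ 2 + 4 * Q * D ^ 2"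
    unfolding h' .
  moreover have "2 * Y * D * (P * (2 * t * Y - 1)) = 2 * D * P * (2 * Q - Y)"
    unfolding Q_def by (simp add: power2_eq_square algebra_simps)
  ultimately have "(P + 2 * D) * (P + 2 * D ^ 2) = 0"
    unfolding Q Y by (simp add: power2_eq_square algebra_simps)
  moreover have "P + 2 * D \<noteq> 0" using nz(1) by (simp add: P add.commute)
  ultimately have P2: "P + 2 * D ^ 2 = 0" by simp
  define u where "u = 1 - 2 * D"
  have tY: "t * Y ^ 2 = D * u"
    using P2 by (simp add: P u_def power2_eq_square algebra_simps)
  have P3: "P = - (2 * D ^ 2)" using P2 by (simp add: eq_neg_iff_add_eq_0)
  have four: "(4 :: 'a) \<noteq> 0"
  proof
    assume "(4 :: 'a) = 0"
    then have "(2 :: 'a) * 2 = 0" by simp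
    then show False using nz(5) by (simp only: mult_eq_0_iff simp_thms)
  qed
  have "4 * D ^ 2 * (D ^ 2 - u * E) = P ^ 2 - 4 * (D * u) * D * E"
    unfolding P3 by (simp add: power2_eq_square algebra_simps)
  also have "\<dots> = 0" unfolding h tY[symmetric] by (simp add: mult.assoc)
  finally have uE: "u * E = D ^ 2" using nz(2) four by auto
  have "D * (u ^ 2 * B) = u * (t * Y ^ 2 * B)" unfolding tY by (simp add: power2_eq_square algebra_simps)
  also have "\<dots> = u * (Y * (D - E))" by (simp add: E power2_eq_square algebra_simps)
  also have "\<dots> = Y * (u * D - u * E)" by (simp add: algebra_simps)
  also have "\<dots> = D * (Y * (1 - 3 * D))" unfolding uE by (simp add: u_def power2_eq_square algebra_simps)
  finally have uB: "u ^ 2 * B = Y * (1 - 3 * D)" using nz(2) by simp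
  have "Y ^ 4 * u ^ 4 * (27 * t ^ 2 * B ^ 2 + (1 - 18 * t) * B + 16 * t - 1) =
      27 * (t * Y ^ 2) ^ 2 * (u ^ 2 * B) ^ 2 + Y ^ 2 * u ^ 2 * (Y ^ 2 - 18 * (t * Y ^ 2)) * (u ^ 2 * B) +
      (16 * (t * Y ^ 2) - Y ^ 2) * Y ^ 2 * u ^ 4"
    by (simp add: power2_eq_square power4_eq_xxxx algebra_simps)
  also have "\<dots> = 0"
    unfolding tY uB unfolding Y u_def by (simp add: power2_eq_square power4_eq_xxxx algebra_simps)
  finally show ?thesis using nz(3,4) by (simp add: u_def)
qed

text \<open>The same elimination; the parametrisation is now t = D (1 - D) / (1 + D)^2, B - 1 = D (1
  - 2D) / (1 - D)^2.\<close>

lemma double_root_elim_even: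
  fixes t Y D P E B :: "'a :: idom"
  assumes Y: "Y = D + 1" and P: "P = t * Y - D" and E: "E = D - t * Y * B"
    and h: "P ^ 2 = 4 * t * Y * D * E"
    and h': "P * (t - 1) = 2 * t * ((2 * Y - 1) * E + Y * D * (1 - t * B))"
    and nz: "t * Y + D \<noteq> 0" "D \<noteq> 0" "Y \<noteq> 0" "1 - D \<noteq> 0" "(2 :: 'a) \<noteq> 0"
  shows "16 * t ^ 2 * (B - 1) ^ 2 + (24 * t ^ 2 - 12 * t + 1) * (B - 1) + 9 * t ^ 2 - t = 0"
proof -
  define Q where "Q = t * Y"
  have Q: "Q = P + D" by (simp add: Q_def P)
  have "2 * Y * D * (2 * t * ((2 * Y - 1) * E + Y * D * (1 - t * B))) =
      4 * Q * D * ((2 * Y - 1) * E + D * (Y - t * Y * B))"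
    unfolding Q_def by (simp add: algebra_simps)
  also have "Y - t * Y * B = E + 1" by (simp add: E Y)
  also have "4 * Q * D * ((2 * Y - 1) * E + D * (E + 1)) = (3 * D + 1) * (4 * t * Y * D * E) + 4 * Q * D ^ 2"
    unfolding Q_def by (simp add: Y power2_eq_square algebra_simps)
  also have "\<dots> = (3 * D + 1) * P ^ 2 + 4 * Q * D ^ 2" unfolding h ..
  finally have "2 * Y * D * (P * (t - 1)) = (3 * D + 1) * P ^ 2 + 4 * Q * D ^ 2"
    unfolding h' .
  moreover have "2 * Y * D * (P * (t - 1)) = 2 * D * P * (Q - Y)"
    unfolding Q_def by (simp add: algebra_simps)
  ultimately have "(P + 2 * D) * (Y * P + 2 * D ^ 2) = 0"
    unfolding Q Y by (simp add: power2_eq_square algebra_simps)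
  moreover have "P + 2 * D \<noteq> 0" using nz(1) by (simp add: P add.commute)
  ultimately have P2: "Y * P + 2 * D ^ 2 = 0" by simp
  define u where "u = 1 - D"
  have tY: "t * Y ^ 2 = D * u"
  proof -
    have "t * Y ^ 2 - D * u = Y * P + 2 * D ^ 2"
      by (simp add: P u_def Y power2_eq_square algebra_simps)
    then show ?thesis using P2 by simp
  qed
  have P3: "Y * P = - (2 * D ^ 2)" using P2 by (simp add: eq_neg_iff_add_eq_0)
  have four: "(4 :: 'a) \<noteq> 0"
  proof
    assume "(4 :: 'a) = 0"
    then have "(2 :: 'a) * 2 = 0" by simp
    then show False using nz(5) by (simp only: mult_eq_0_iff simp_thms)
  qed
  have "4 * D ^ 2 * (D ^ 2 - u * (Y * E)) = (Y * P) ^ 2 - 4 * (D * u) * D * (Y * E)"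
    unfolding P3 by (simp add: power2_eq_square algebra_simps)
  also have "\<dots> = Y ^ 2 * (P ^ 2 - 4 * t * Y * D * E)"
    unfolding tY[symmetric] by (simp add: power2_eq_square algebra_simps)
  also have "\<dots> = 0" unfolding h by simp
  finally have uE: "u * (Y * E) = D ^ 2" using nz(2) four by auto
  have "D * (u ^ 2 * B) = u * (t * Y ^ 2 * B)" unfolding tY by (simp add: power2_eq_square algebra_simps)
  also have "\<dots> = u * (Y * (D - E))" by (simp add: E power2_eq_square algebra_simps)
  also have "\<dots> = Y * u * D - u * (Y * E)" by (simp add: algebra_simps)
  also have "\<dots> = D * (1 - D - D ^ 2)" unfolding uE by (simp add: u_def Y power2_eq_square algebra_simps)
  finally have "u ^ 2 * B = 1 - D - D ^ 2" using nz(2) by simp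
  then have uB: "u ^ 2 * (B - 1) = D * (1 - 2 * D)"
    by (simp add: u_def power2_eq_square algebra_simps)
  define x where "x = B - 1"
  have "Y ^ 4 * u ^ 4 * (16 * t ^ 2 * x ^ 2 + (24 * t ^ 2 - 12 * t + 1) * x + 9 * t ^ 2 - t) =
      16 * (t * Y ^ 2) ^ 2 * (u ^ 2 * x) ^ 2 + (24 * (t * Y ^ 2) ^ 2 - 12 * (t * Y ^ 2) * Y ^ 2 + Y ^ 4) * u ^ 2 * (u ^ 2 * x) +
      (9 * (t * Y ^ 2) ^ 2 - t * Y ^ 2 * Y ^ 2) * u ^ 4"
    by (simp add: power2_eq_square power4_eq_xxxx algebra_simps)
  also have "\<dots> = 0"
    unfolding tY uB[folded x_def] unfolding Y u_def by (simp add: power2_eq_square power4_eq_xxxx algebra_simps)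
  finally show ?thesis using nz(3,4) by (simp add: u_def x_def)
qed

text \<open>With \<open>z = s Y\<close> the common root of the discriminant and its derivative, \<open>D = Y - 1\<close> uniformizes
  both \<open>t = s\<^bsup>2\<^esup>\<close> and \<open>B\<close>.\<close>
lemma (in planar_recursion) quadratic_all:
  assumes e: "\<And>n. e n = 1"
  defines "B \<equiv> 1 + T 1" and "t \<equiv> fps_X ^ 2"
  shows "27 * t ^ 2 * B ^ 2 + (1 - 18 * t) * B + 16 * t - 1 = 0"
proof -
  define x :: "rat fps" where "x = fps_X"
  have t: "t = x ^ 2" by (simp add: t_def x_def)
  \<comment> \<open>Constant weights make the sum geometric: splitting off its first term shifts the
    index of \<open>T\<close> by one.\<close>
  have T_rec: "T p = x * (w p + T (Suc p))" for p
  proof (rule fps_ext)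
    fix k show "fps_nth (T p) k = fps_nth (x * (w p + T (Suc p))) k"
    proof (cases k)
      case (Suc k')
      have "(\<Sum>n=1..Suc k'. fps_nth (w (p + n - 1)) (Suc k' - n)) =
          fps_nth (w p) k' + (\<Sum>n=1..k'. fps_nth (w (Suc p + n - 1)) (k' - n))"
        by (subst sum_Icc_Suc_shift) simp
      then show ?thesis by (simp add: x_def Suc T_nth e)
    qed (simp add: x_def T_nth)
  qed
  have T0: "T 0 = x * B" using T_rec[of 0] by (simp add: B_def w0)
  define W where "W = Abs_fps w"
  define U where "U = Abs_fps T"
  define s where "s = fps_const x"
  define z :: "rat fps fps" where "z = fps_X"
  define a where "a = z ^ 2 * (z - s)"
  define b where "b = s * z ^ 2 - (z - s)"
  define c where "c = (z - s) - s * z * fps_const (x * B)"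
  \<comment> \<open>The loop equations for all p at once; the inner factor z accounts for the index
    sum p - 1 of the products.\<close>
  have 1: "W - 1 = z * (z * W ^ 2 + U)"
  proof (rule fps_ext)
    fix n show "fps_nth (W - 1) n = fps_nth (z * (z * W ^ 2 + U)) n"
    proof (cases n)
      case (Suc p)
      have "fps_nth (z * W ^ 2) p = (\<Sum>i<p. w i * w (p - 1 - i))"
      proof (cases p)
        case (Suc p')
        have "fps_nth (z * W ^ 2) p = fps_nth (W ^ 2) p'" by (simp add: z_def Suc)
        also have "\<dots> = (\<Sum>i<p. w i * w (p - 1 - i))"
          by (simp add: Suc W_def power2_eq_square fps_mult_nth atLeast0AtMost lessThan_Suc_atMost)
        finally show ?thesis .
      qed (simp add: z_def)
      then have "fps_nth (z * W ^ 2 + U) p = w n" by (simp add: Suc w_Suc U_def)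
      moreover have "fps_nth (z * f) n = fps_nth f p" for f by (simp add: z_def Suc)
      ultimately show ?thesis by (simp add: W_def Suc)
    qed (simp add: z_def W_def w0)
  qed
  have 2: "z * U = s * (z * W + U - fps_const (x * B))"
  proof (rule fps_ext)
    fix n show "fps_nth (z * U) n = fps_nth (s * (z * W + U - fps_const (x * B))) n"
    proof (cases n)
      case (Suc p)
      then show ?thesis using T_rec[of p] by (simp add: z_def s_def U_def W_def)
    qed (simp add: z_def s_def U_def T0)
  qed
  \<comment> \<open>Relation 2 is linear in \<open>U\<close> with coefficient z - s, so multiplying
    relation 1 by z - s allows \<open>U\<close> to be eliminated.\<close>
  have q: "a * W ^ 2 + b * W + c = 0"
  proof -
    have "a * W ^ 2 + b * W + c = - (z - s) * ((W - 1) - z * (z * W ^ 2 + U)) -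
        z * (z * U - s * (z * W + U - fps_const (x * B)))"
      unfolding a_def b_def c_def by (simp add: power2_eq_square algebra_simps)
    then show ?thesis unfolding 1 2 by simp
  qed
  \<comment> \<open>At z = sY one has z - s = s (Y - 1), and the condition 2aW + b = 0 divided by s
    reads Y - 1 = t Y^2 (1 + 2 (Y - 1) W(sY)). The factor t on the right makes it a fixed point
    equation.\<close>
  obtain Y where Y: "Y = 1 + fps_X * (x * Y ^ 2 + 2 * x * Y ^ 2 * (Y - 1) * fps_eval W (x * Y))"
    using fps_fixed_point[of "\<lambda>Y. x * Y ^ 2 + 2 * x * Y ^ 2 * (Y - 1) * fps_eval W (x * Y)" 1]
    by (auto intro!: fps_agree_intros)
  define \<omega> where "\<omega> = fps_eval W (x * Y)"
  define D where "D = Y - 1"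
  have Z: "fps_nth (x * Y) 0 = 0" by (simp add: x_def)
  have D: "D = t * Y ^ 2 * (1 + 2 * D * \<omega>)"
    unfolding D_def \<omega>_def t
    by (subst (1) Y) (simp add: x_def[symmetric] power2_eq_square algebra_simps)
  have D0: "fps_nth D 0 = 0" by (subst D) (simp add: t_def power2_eq_square)
  have Y0: "fps_nth Y 0 = 1" using D0 by (simp add: D_def)
  have ev: "fps_eval z (x * Y) = x * Y" "fps_eval s (x * Y) = x" "fps_eval W (x * Y) = \<omega>"
    using Z by (simp_all add: z_def s_def \<omega>_def)
  note evs = fps_eval_add fps_eval_diff fps_eval_mult[OF Z] fps_eval_power[OF Z] ev
  define P where "P = t * Y ^ 2 - D"
  define E where "E = D - t * Y * B"
  have ea: "fps_eval a (x * Y) = x ^ 3 * Y ^ 2 * D"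
    unfolding a_def evs by (simp add: D_def power2_eq_square power3_eq_cube algebra_simps)
  have eb: "fps_eval b (x * Y) = x * P"
    unfolding b_def evs by (simp add: P_def D_def t power2_eq_square algebra_simps)
  have ec: "fps_eval c (x * Y) = x * E"
    unfolding c_def evs by (simp add: E_def D_def t power2_eq_square algebra_simps)
  have root: "fps_eval (2 * a * W + b) (x * Y) = 0"
  proof -
    have "fps_eval (2 * a * W + b) (x * Y) = 2 * (x ^ 3 * Y ^ 2 * D) * \<omega> + x * P"
      unfolding evs ea eb by (simp add: evs ea)
    also have "\<dots> = x * (t * Y ^ 2 * (1 + 2 * D * \<omega>) - D)"
      by (simp add: P_def t power2_eq_square power3_eq_cube algebra_simps)
    finally show ?thesis using D by simp
  qed
  note disc = discriminant_double_root[OF q Z root]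
  have x0: "x \<noteq> 0" by (simp add: x_def)
  have "x ^ 2 * (P ^ 2 - 4 * t * Y ^ 2 * D * E) = 0"
    using disc(1) unfolding evs ea eb ec
    by (simp add: t power2_eq_square power3_eq_cube algebra_simps)
  then have h: "P ^ 2 = 4 * t * Y ^ 2 * D * E" using x0 by simp
  have deriv: "fps_deriv (b ^ 2 - 4 * a * c) = 2 * b * (2 * s * z - 1) -
      4 * ((2 * z * (z - s) + z ^ 2) * c + a * (1 - s * fps_const (x * B)))"
    unfolding a_def b_def c_def z_def s_def power2_eq_square
    by (simp add: algebra_simps)
  have "0 = 2 * (x * P) * (2 * x * (x * Y) - 1) -
      4 * ((2 * (x * Y) * (x * Y - x) + (x * Y) ^ 2) * (x * E) + x ^ 3 * Y ^ 2 * D * (1 - x * (x * B)))"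
    using disc(2) unfolding deriv by (simp only: evs ea eb ec fps_eval_numeral fps_eval_1 fps_eval_const)
  also have "\<dots> = 2 * x * (P * (2 * t * Y - 1) - 2 * t * ((2 * Y * D + Y ^ 2) * E + Y ^ 2 * D * (1 - t * B)))"
    by (simp add: t D_def power2_eq_square power3_eq_cube algebra_simps)
  finally have "2 * x * (P * (2 * t * Y - 1) - 2 * t * ((2 * Y * D + Y ^ 2) * E + Y ^ 2 * D * (1 - t * B))) = 0" ..
  then have h': "P * (2 * t * Y - 1) = 2 * t * ((2 * Y * D + Y ^ 2) * E + Y ^ 2 * D * (1 - t * B))"
    using x0 by simp
  \<comment> \<open>All three series have nonzero constant terms: 1, 1 and 2.\<close>
  have Ynz: "Y \<noteq> 0" and unz: "1 - 2 * D \<noteq> 0" and wnz: "2 + 2 * D * \<omega> \<noteq> 0"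
    using Y0 D0 by (auto simp: fps_eq_iff intro!: exI[of _ 0] dest!: spec[of _ 0])
  have tnz: "t \<noteq> 0" by (simp add: t_def)
  have Dnz: "D \<noteq> 0"
  proof
    assume "D = 0"
    then have "t * Y ^ 2 = 0" using D by simp
    with tnz Ynz show False by simp
  qed
  have "t * Y ^ 2 + D = t * Y ^ 2 + t * Y ^ 2 * (1 + 2 * D * \<omega>)"
    by (rule arg_cong[OF D])
  also have "\<dots> = t * Y ^ 2 * (2 + 2 * D * \<omega>)" by (simp add: algebra_simps)
  finally have "t * Y ^ 2 + D \<noteq> 0" using tnz Ynz wnz by simp
  from double_root_elim_all[OF _ P_def E_def h h' this Dnz Ynz unz]
  show ?thesis by (simp add: D_def)
qed

text \<open>The odd moments vanish, by a double induction as for \<open>parity\<close>, so only even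
  moments enter the generating function and the outer variable replaces z^2. Every second weight is
  0, hence the geometric recursion for \<open>T\<close> advances by two with ratio t, and the double
  root is sought at t Y.\<close>

lemma (in planar_recursion) quadratic_even:
  assumes e: "\<And>n. e n = (if even n then 1 else 0)"
  defines "X \<equiv> T 1" and "t \<equiv> fps_X ^ 2"
  shows "16 * t ^ 2 * X ^ 2 + (24 * t ^ 2 - 12 * t + 1) * X + 9 * t ^ 2 - t = 0"
proof -
  define B where "B = 1 + X"
  have odd0: "fps_nth (w p) k = 0" if "odd p" for p k
    using that
  proof (induction k arbitrary: p rule: less_induct)
    case (less k)
    note IHk = less.IH
    show ?case using less.prems
    proof (induction p rule: less_induct)
      case (less p)
      then obtain p' where p: "p = Suc p'" "even p'" by (cases p) auto
      have z: "fps_nth (w i) a = 0" if "odd i" "a \<le> k" "i < p" for i a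
        using that IHk[of a i] less.IH[of i] by (cases "a = k") auto
      have "fps_nth (w i * w (p' - 1 - i)) k = 0" if "i < p'" for i
      proof (cases "odd i")
        case True
        then show ?thesis unfolding fps_mult_nth using that p by (intro sum.neutral) (auto intro!: z)
      next
        case False
        then have "odd (p' - 1 - i)" using that p by auto
        then show ?thesis unfolding fps_mult_nth using that p by (intro sum.neutral) (auto intro!: z)
      qed
      moreover have "fps_nth (T p') k = 0"
        unfolding T_nth using p by (intro sum.neutral) (auto simp: e intro!: IHk)
      ultimately show ?case unfolding p(1) w_Suc by (simp add: fps_sum_nth)
    qed
  qed
  then have w_odd: "w p = 0" if "odd p" for p using that by (intro fps_ext) simp
  have T_rec: "T p = t * (w (Suc p) + T (Suc (Suc p)))" for p
  proof (rule fps_ext)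
    fix k show "fps_nth (T p) k = fps_nth (t * (w (Suc p) + T (Suc (Suc p)))) k"
    proof (cases "k < 2")
      case True
      then have "k = 0 \<or> k = 1" by auto
      then show ?thesis by (auto simp: t_def fps_X_power_mult_nth T_nth e)
    next
      case False
      then obtain k' where k: "k = Suc (Suc k')" by (metis Suc_1 add_2_eq_Suc le_Suc_ex not_less)
      have "(\<Sum>n=1..k. e n * fps_nth (w (p + n - 1)) (k - n)) =
          fps_nth (w (Suc p)) k' + (\<Sum>n=1..k'. e n * fps_nth (w (Suc (Suc p) + n - 1)) (k' - n))"
        unfolding k sum_Icc_Suc_shift by (simp add: e)
      then show ?thesis by (simp add: t_def fps_X_power_mult_nth k T_nth)
    qed
  qed
  define W where "W = Abs_fps (\<lambda>q. w (2 * q))"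
  define U where "U = Abs_fps (\<lambda>q. T (Suc (2 * q)))"
  define s where "s = fps_const t"
  define z :: "rat fps fps" where "z = fps_X"
  define a where "a = z * (z - s)"
  define b where "b = s * z - (z - s)"
  define c where "c = (z - s) - s * z * fps_const B"
  have 1: "W - 1 = z * (W ^ 2 + U)"
  proof (rule fps_ext)
    fix n show "fps_nth (W - 1) n = fps_nth (z * (W ^ 2 + U)) n"
    proof (cases n)
      case (Suc q)
      have "(\<Sum>i<Suc (2 * q). w i * w (2 * q - i)) = (\<Sum>i\<in>(\<lambda>j. 2 * j) ` {..q}. w i * w (2 * q - i))"
      proof (rule sum.mono_neutral_right)
        show "\<forall>i\<in>{..<Suc (2 * q)} - (\<lambda>j. 2 * j) ` {..q}. w i * w (2 * q - i) = 0"
        proof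
          fix i assume i: "i \<in> {..<Suc (2 * q)} - (\<lambda>j. 2 * j) ` {..q}"
          have "odd i"
          proof
            assume "even i"
            then obtain j where "i = 2 * j" by (elim evenE)
            with i show False by auto
          qed
          then show "w i * w (2 * q - i) = 0" by (simp add: w_odd)
        qed
      qed auto
      also have "\<dots> = (\<Sum>j\<le>q. w (2 * j) * w (2 * (q - j)))"
        by (subst sum.reindex) (auto simp: inj_on_def right_diff_distrib' intro!: sum.cong)
      also have "\<dots> = fps_nth (W ^ 2) q"
        by (simp add: W_def power2_eq_square fps_mult_nth atLeast0AtMost)
      finally have "w (2 * n) = fps_nth (W ^ 2) q + T (Suc (2 * q))"
        using w_Suc[of "Suc (2 * q)"] by (simp add: Suc)
      then show ?thesis by (simp add: z_def W_def U_def Suc)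
    qed (simp add: z_def W_def w0)
  qed
  have 2: "z * U = s * (W - 1 + U - fps_const X)"
  proof (rule fps_ext)
    fix n show "fps_nth (z * U) n = fps_nth (s * (W - 1 + U - fps_const X)) n"
    proof (cases n)
      case (Suc p)
      then show ?thesis using T_rec[of "Suc (2 * p)"] by (simp add: z_def s_def U_def W_def)
    qed (simp add: z_def s_def U_def W_def X_def w0)
  qed
  have q: "a * W ^ 2 + b * W + c = 0"
  proof -
    have "a * W ^ 2 + b * W + c = - (z - s) * ((W - 1) - z * (W ^ 2 + U)) -
        z * (z * U - s * (W - 1 + U - fps_const X))"
      unfolding a_def b_def c_def B_def
      by (simp add: power2_eq_square algebra_simps flip: fps_const_add)
    then show ?thesis unfolding 1 2 by simp
  qed
  define x :: "rat fps" where "x = fps_X"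
  have t: "t = x * x" by (simp add: t_def x_def power2_eq_square)
  obtain Y where Y: "Y = 1 + fps_X * (x * Y + 2 * x * Y * (Y - 1) * fps_eval W (t * Y))"
    using fps_fixed_point[of "\<lambda>Y. x * Y + 2 * x * Y * (Y - 1) * fps_eval W (t * Y)" 1]
    by (auto intro!: fps_agree_intros)
  define \<omega> where "\<omega> = fps_eval W (t * Y)"
  define D where "D = Y - 1"
  have Z: "fps_nth (t * Y) 0 = 0" by (simp add: t x_def)
  have D: "D = t * Y * (1 + 2 * D * \<omega>)"
    unfolding D_def \<omega>_def
    by (subst (1) Y) (simp add: x_def[symmetric] t power2_eq_square algebra_simps)
  have D0: "fps_nth D 0 = 0" by (subst D) (simp add: t x_def)
  have Y0: "fps_nth Y 0 = 1" using D0 by (simp add: D_def)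
  have ev: "fps_eval z (t * Y) = t * Y" "fps_eval s (t * Y) = t" "fps_eval W (t * Y) = \<omega>"
    using Z by (simp_all add: z_def s_def \<omega>_def)
  note evs = fps_eval_add fps_eval_diff fps_eval_mult[OF Z] fps_eval_power[OF Z] ev
  define P where "P = t * Y - D"
  define E where "E = D - t * Y * B"
  have ea: "fps_eval a (t * Y) = t ^ 2 * Y * D"
    unfolding a_def evs by (simp add: D_def power2_eq_square algebra_simps)
  have eb: "fps_eval b (t * Y) = t * P"
    unfolding b_def evs by (simp add: P_def D_def power2_eq_square algebra_simps)
  have ec: "fps_eval c (t * Y) = t * E"
    unfolding c_def evs by (simp add: E_def D_def power2_eq_square algebra_simps)
  have root: "fps_eval (2 * a * W + b) (t * Y) = 0"
  proof -
    have "fps_eval (2 * a * W + b) (t * Y) = 2 * (t ^ 2 * Y * D) * \<omega> + t * P"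
      unfolding evs ea eb by (simp add: evs ea)
    also have "\<dots> = t * (t * Y * (1 + 2 * D * \<omega>) - D)"
      by (simp add: P_def power2_eq_square algebra_simps)
    finally show ?thesis using D by simp
  qed
  note disc = discriminant_double_root[OF q Z root]
  have tnz: "t \<noteq> 0" by (simp add: t_def)
  have "t ^ 2 * (P ^ 2 - 4 * t * Y * D * E) = 0"
    using disc(1) unfolding evs ea eb ec
    by (simp add: power2_eq_square algebra_simps)
  then have h: "P ^ 2 = 4 * t * Y * D * E" using tnz by simp
  have deriv: "fps_deriv (b ^ 2 - 4 * a * c) = 2 * b * (s - 1) -
      4 * ((2 * z - s) * c + a * (1 - s * fps_const B))"
    unfolding a_def b_def c_def z_def s_def power2_eq_square
    by (simp add: algebra_simps)
  have "0 = 2 * (t * P) * (t - 1) - 4 * ((2 * (t * Y) - t) * (t * E) + t ^ 2 * Y * D * (1 - t * B))"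
    using disc(2) unfolding deriv by (simp only: evs ea eb ec fps_eval_numeral fps_eval_1 fps_eval_const)
  also have "\<dots> = 2 * t * (P * (t - 1) - 2 * t * ((2 * Y - 1) * E + Y * D * (1 - t * B)))"
    by (simp add: power2_eq_square algebra_simps)
  finally have "2 * t * (P * (t - 1) - 2 * t * ((2 * Y - 1) * E + Y * D * (1 - t * B))) = 0" ..
  then have h': "P * (t - 1) = 2 * t * ((2 * Y - 1) * E + Y * D * (1 - t * B))"
    using tnz by simp
  have Ynz: "Y \<noteq> 0" and unz: "1 - D \<noteq> 0" and wnz: "2 + 2 * D * \<omega> \<noteq> 0"
    using Y0 D0 by (auto simp: fps_eq_iff intro!: exI[of _ 0] dest!: spec[of _ 0])
  have Dnz: "D \<noteq> 0"
  proof
    assume "D = 0"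
    then have "t * Y = 0" using D by simp
    with tnz Ynz show False by simp
  qed
  have "t * Y + D = t * Y + t * Y * (1 + 2 * D * \<omega>)"
    by (rule arg_cong[OF D])
  also have "\<dots> = t * Y * (2 + 2 * D * \<omega>)" by (simp add: algebra_simps)
  finally have "t * Y + D \<noteq> 0" using tnz Ynz wnz by simp
  from double_root_elim_even[OF _ P_def E_def h h' this Dnz Ynz unz]
  show ?thesis by (simp add: D_def B_def)
qed

section \<open>Coefficients and asymptotics\<close>

lemma fps_nth_compose_X2:
  "fps_nth (f oo (fps_X ^ 2 :: 'a :: comm_ring_1 fps)) k = (if even k then fps_nth f (k div 2) else 0)"
proof -
  have "fps_nth (f oo fps_X ^ 2) k = (\<Sum>i=0..k. fps_nth f i * (if k = 2 * i then 1 else 0))"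
    by (simp add: fps_compose_nth fps_X_power_nth flip: power_mult)
  also have "\<dots> = (\<Sum>i\<in>(if even k then {k div 2} else {}). fps_nth f i)"
    by (rule sum.mono_neutral_cong_right) (auto split: if_splits)
  finally show ?thesis by simp
qed

lemma fps_even_compose:
  "(\<And>k. odd k \<Longrightarrow> fps_nth f k = 0) \<Longrightarrow> Abs_fps (\<lambda>n. fps_nth f (2 * n)) oo fps_X ^ 2 = (f :: 'a :: comm_ring_1 fps)"
  by (intro fps_ext) (simp add: fps_nth_compose_X2)

text \<open>Lets an equation in s^2 descend to an equation in t.\<close>

lemma fps_compose_X2_eq_0: "f oo (fps_X ^ 2 :: 'a :: comm_ring_1 fps) = 0 \<Longrightarrow> f = 0"
proof (rule fps_ext)
  fix n assume "f oo (fps_X ^ 2 :: 'a fps) = 0"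
  then have "fps_nth (f oo fps_X ^ 2) (2 * n) = 0" by simp
  then show "fps_nth f n = fps_nth 0 n" by (simp add: fps_nth_compose_X2)
qed

lemma fps_X_mult_deriv_compose_X2:
  fixes f :: "'a :: idom fps"
  shows "fps_X * fps_deriv (f oo fps_X ^ 2) = 2 * fps_X ^ 2 * (fps_deriv f oo fps_X ^ 2)"
  by (subst fps_compose_deriv) (simp_all add: power2_eq_square algebra_simps)

text \<open>The discriminant of the quadratic equation for \<open>G\<close> is \<open>4 (1 - 12 t)\<^bsup>3\<^esup>\<close>, so its square root \<open>H\<close>
  satisfies a first-order linear equation.\<close>
lemma ode_all:
  fixes G :: "rat fps"
  defines "t \<equiv> fps_X :: rat fps"
  assumes q: "108 * t ^ 3 * G ^ 2 + (108 * t ^ 2 - 36 * t + 2) * G + 27 * t - 2 = 0"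
  shows "3 + 3 * (6 * t - 1) * G + t * (12 * t - 1) * fps_deriv G = 0"
proof -
  \<comment> \<open>\<open>H\<close> is 2aG + b for the quadratic equation a G^2 + b G + c = 0,
    formally 2 r^(3/2); the number 18 below is 3/2 times 12.\<close>
  define H where "H = 216 * t ^ 3 * G + 108 * t ^ 2 - 36 * t + 2"
  define r where "r = 1 - 12 * t"
  have "H * H = 4 * r ^ 3 + 432 * t ^ 3 * (108 * t ^ 3 * G ^ 2 + (108 * t ^ 2 - 36 * t + 2) * G + 27 * t - 2)"
    by (simp add: H_def r_def power2_eq_square power3_eq_cube algebra_simps)
  then have HH: "H * H = 4 * r ^ 3" unfolding q by simp
  have "2 * (H * fps_deriv H) = fps_deriv (H * H)" by (simp add: algebra_simps)
  also have "\<dots> = 2 * (- (72 * r ^ 2))"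
    unfolding HH by (simp add: r_def t_def power2_eq_square power3_eq_cube algebra_simps)
  finally have dH: "H * fps_deriv H = - (72 * r ^ 2)"
    by (rule mult_left_cancel[THEN iffD1, rotated]) simp
  have "H * (r * fps_deriv H + 18 * H) = r * (H * fps_deriv H) + 18 * (H * H)" by (simp add: algebra_simps)
  also have "\<dots> = 0" unfolding HH dH by (simp add: power2_eq_square power3_eq_cube)
  finally have "H * (r * fps_deriv H + 18 * H) = 0" .
  moreover have "fps_nth H 0 = 2" by (simp add: H_def t_def power3_eq_cube power2_eq_square)
  then have "H \<noteq> 0" by auto
  ultimately have 0: "r * fps_deriv H + 18 * H = 0" by simp
  have H': "fps_deriv H = 648 * t ^ 2 * G + 216 * t ^ 3 * fps_deriv G + 216 * t - 36"
    by (simp add: H_def t_def power2_eq_square power3_eq_cube algebra_simps)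
  have "r * fps_deriv H + 18 * H = - (216 * t ^ 2 * (3 + 3 * (6 * t - 1) * G + t * (12 * t - 1) * fps_deriv G))"
    unfolding H' by (simp add: H_def r_def power2_eq_square power3_eq_cube algebra_simps)
  then have "216 * t ^ 2 * (3 + 3 * (6 * t - 1) * G + t * (12 * t - 1) * fps_deriv G) = 0"
    unfolding 0 by simp
  then show ?thesis by (simp add: t_def)
qed

text \<open>As in \<open>ode_all\<close>, now with discriminant 4 (1 - 8t)^3; the number 12 in the
  equation for \<open>H\<close> is 3/2 times 8.\<close>

lemma ode_even:
  fixes G :: "rat fps"
  defines "t \<equiv> fps_X :: rat fps"
  assumes q: "64 * t ^ 3 * G ^ 2 + (48 * t ^ 2 - 24 * t + 2) * G + 9 * t - 1 = 0"
  shows "3 + 6 * (4 * t - 1) * G + 2 * t * (8 * t - 1) * fps_deriv G = 0"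
proof -
  define H where "H = 128 * t ^ 3 * G + 48 * t ^ 2 - 24 * t + 2"
  define r where "r = 1 - 8 * t"
  have "H * H = 4 * r ^ 3 + 256 * t ^ 3 * (64 * t ^ 3 * G ^ 2 + (48 * t ^ 2 - 24 * t + 2) * G + 9 * t - 1)"
    by (simp add: H_def r_def power2_eq_square power3_eq_cube algebra_simps)
  then have HH: "H * H = 4 * r ^ 3" unfolding q by simp
  have "2 * (H * fps_deriv H) = fps_deriv (H * H)" by (simp add: algebra_simps)
  also have "\<dots> = 2 * (- (48 * r ^ 2))"
    unfolding HH by (simp add: r_def t_def power2_eq_square power3_eq_cube algebra_simps)
  finally have dH: "H * fps_deriv H = - (48 * r ^ 2)"
    by (rule mult_left_cancel[THEN iffD1, rotated]) simp
  have "H * (r * fps_deriv H + 12 * H) = r * (H * fps_deriv H) + 12 * (H * H)" by (simp add: algebra_simps)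
  also have "\<dots> = 0" unfolding HH dH by (simp add: power2_eq_square power3_eq_cube)
  finally have "H * (r * fps_deriv H + 12 * H) = 0" .
  moreover have "fps_nth H 0 = 2" by (simp add: H_def t_def power3_eq_cube power2_eq_square)
  then have "H \<noteq> 0" by auto
  ultimately have 0: "r * fps_deriv H + 12 * H = 0" by simp
  have H': "fps_deriv H = 384 * t ^ 2 * G + 128 * t ^ 3 * fps_deriv G + 96 * t - 24"
    by (simp add: H_def t_def power2_eq_square power3_eq_cube algebra_simps)
  have "r * fps_deriv H + 12 * H = - (64 * t ^ 2 * (3 + 6 * (4 * t - 1) * G + 2 * t * (8 * t - 1) * fps_deriv G))"
    unfolding H' by (simp add: H_def r_def power2_eq_square power3_eq_cube algebra_simps)
  then have "64 * t ^ 2 * (3 + 6 * (4 * t - 1) * G + 2 * t * (8 * t - 1) * fps_deriv G) = 0"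
    unfolding 0 by simp
  then show ?thesis by (simp add: t_def)
qed

section \<open>Recursion and closed form of the coefficients\<close>

lemma fps_nth_first_order_ode:
  fixes G :: "rat fps"
  assumes "fps_const a + fps_const b * G + fps_const c * (fps_X * G) + fps_const d * (fps_X * fps_deriv G) +
    fps_const k * (fps_X * (fps_X * fps_deriv G)) = 0"
  shows "a + b * fps_nth G 0 = 0"
    "(b + d * of_nat (Suc n)) * fps_nth G (Suc n) + (c + k * of_nat n) * fps_nth G n = 0"
proof -
  have *: "fps_nth (fps_const a + fps_const b * G + fps_const c * (fps_X * G) + fps_const d * (fps_X * fps_deriv G) +
    fps_const k * (fps_X * (fps_X * fps_deriv G))) i = 0" for i
    unfolding assms by simp
  show "a + b * fps_nth G 0 = 0" using *[of 0] by simp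
  show "(b + d * of_nat (Suc n)) * fps_nth G (Suc n) + (c + k * of_nat n) * fps_nth G n = 0"
    using *[of "Suc n"] by (cases n) (simp_all add: algebra_simps)
qed

lemma free_energy_all_coeffs:
  fixes F0 :: "rat fps"
  assumes ode: "3 + 3 * (6 * fps_X - 1) * fps_deriv F0 + fps_X * (12 * fps_X - 1) * fps_deriv (fps_deriv F0) = 0"
  defines "f \<equiv> fps_nth F0"
  shows "f 1 = 1"
    and "\<And>n. n \<ge> 1 \<Longrightarrow> (of_nat n + 3) * (of_nat n + 1) * f (n + 1) - 6 * of_nat n * (1 + 2 * of_nat n) * f n = 0"
    and "\<And>n. n \<ge> 1 \<Longrightarrow> f n = 2 * fact (2 * n - 1) * 3 ^ n / (fact n * fact (n + 2))"
proof -
  have "fps_const 3 + fps_const (- 3) * fps_deriv F0 + fps_const 18 * (fps_X * fps_deriv F0) +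
      fps_const (- 1) * (fps_X * fps_deriv (fps_deriv F0)) + fps_const 12 * (fps_X * (fps_X * fps_deriv (fps_deriv F0))) =
      3 + 3 * (6 * fps_X - 1) * fps_deriv F0 + fps_X * (12 * fps_X - 1) * fps_deriv (fps_deriv F0)"
    by (simp add: algebra_simps flip: numeral_fps_const neg_numeral_fps_const fps_const_neg)
  note * = fps_nth_first_order_ode[OF trans[OF this ode]]
  show f1: "f 1 = 1" using *(1) by (simp add: f_def)
  have rec: "(of_nat n + 3) * (of_nat n + 1) * f (n + 1) = 6 * of_nat n * (1 + 2 * of_nat n) * f n" if "n \<ge> 1" for n
  proof -
    \<comment> \<open>The coefficient of index k of the derivative is (k + 1)
      \<open>f (k + 1)\<close>; this causes the shift n = k + 1 and the factors n + 1 and n of the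
      recursion.\<close>
    obtain k where "n = Suc k" using \<open>n \<ge> 1\<close> by (cases n) auto
    then show ?thesis using *(2)[of k] by (simp add: f_def algebra_simps)
  qed
  then show "(of_nat n + 3) * (of_nat n + 1) * f (n + 1) - 6 * of_nat n * (1 + 2 * of_nat n) * f n = 0" if "n \<ge> 1" for n
    using that by simp
  show "f n = 2 * fact (2 * n - 1) * 3 ^ n / (fact n * fact (n + 2))" if "n \<ge> 1" for n
    using that
  proof (induction n rule: dec_induct)
    case base
    show ?case using f1 by (simp add: fact_numeral)
  next
    case (step n)
    obtain k where k: "n = Suc k" using step(1) by (cases n) auto
    have 1: "fact (2 * Suc n - 1) = (2 * of_nat n + 1) * (2 * of_nat n) * (fact (2 * n - 1) :: rat)"
      by (simp add: k algebra_simps)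
    have 2: "fact (Suc n) * fact (Suc n + 2) = (of_nat n + 3) * (of_nat n + 1) * (fact n * fact (n + 2) :: rat)"
      by (simp add: algebra_simps)
    have nz: "(of_nat n + 3) * (of_nat n + 1) \<noteq> (0 :: rat)"
      using of_nat_0_le_iff[of n, where 'a = rat] by (simp add: add_nonneg_eq_0_iff)
    have "(of_nat n + 3) * (of_nat n + 1) * f (Suc n) =
        6 * of_nat n * (1 + 2 * of_nat n) * (2 * fact (2 * n - 1) * 3 ^ n / (fact n * fact (n + 2)))"
      using rec[of n] step by simp
    also have "\<dots> = (of_nat n + 3) * (of_nat n + 1) *
        (2 * fact (2 * Suc n - 1) * 3 ^ Suc n / (fact (Suc n) * fact (Suc n + 2)))"
      unfolding 1 2 using nz by (simp add: divide_simps) 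
    finally show ?case using nz by (simp only: mult_cancel_left) simp
  qed
qed

lemma free_energy_even_coeffs:
  fixes F0 :: "rat fps"
  assumes ode: "3 + 6 * (4 * fps_X - 1) * fps_deriv F0 + 2 * fps_X * (8 * fps_X - 1) * fps_deriv (fps_deriv F0) = 0"
  defines "f \<equiv> fps_nth F0"
  shows "f 1 = 1 / 2"
    and "\<And>n. n \<ge> 1 \<Longrightarrow> (of_nat n + 3) * (of_nat n + 1) * f (n + 1) - 4 * of_nat n * (1 + 2 * of_nat n) * f n = 0"
    and "\<And>n. n \<ge> 1 \<Longrightarrow> f n = 3 * fact (2 * n - 1) * 2 ^ (n - 1) / (fact n * fact (n + 2))"
proof -
  have "fps_const 3 + fps_const (- 6) * fps_deriv F0 + fps_const 24 * (fps_X * fps_deriv F0) +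
      fps_const (- 2) * (fps_X * fps_deriv (fps_deriv F0)) + fps_const 16 * (fps_X * (fps_X * fps_deriv (fps_deriv F0))) =
      3 + 6 * (4 * fps_X - 1) * fps_deriv F0 + 2 * fps_X * (8 * fps_X - 1) * fps_deriv (fps_deriv F0)"
    by (simp add: algebra_simps flip: numeral_fps_const neg_numeral_fps_const fps_const_neg)
  note * = fps_nth_first_order_ode[OF trans[OF this ode]]
  show f1: "f 1 = 1 / 2" using *(1) by (simp add: f_def)
  have rec: "(of_nat n + 3) * (of_nat n + 1) * f (n + 1) = 4 * of_nat n * (1 + 2 * of_nat n) * f n" if "n \<ge> 1" for n
  proof -
    obtain k where "n = Suc k" using \<open>n \<ge> 1\<close> by (cases n) auto
    then show ?thesis using *(2)[of k] by (simp add: f_def algebra_simps)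
  qed
  then show "(of_nat n + 3) * (of_nat n + 1) * f (n + 1) - 4 * of_nat n * (1 + 2 * of_nat n) * f n = 0" if "n \<ge> 1" for n
    using that by simp
  show "f n = 3 * fact (2 * n - 1) * 2 ^ (n - 1) / (fact n * fact (n + 2))" if "n \<ge> 1" for n
    using that
  proof (induction n rule: dec_induct)
    case base
    show ?case using f1 by (simp add: fact_numeral)
  next
    case (step n)
    obtain k where k: "n = Suc k" using step(1) by (cases n) auto
    have 1: "fact (2 * Suc n - 1) = (2 * of_nat n + 1) * (2 * of_nat n) * (fact (2 * n - 1) :: rat)"
      by (simp add: k algebra_simps)
    have 2: "fact (Suc n) * fact (Suc n + 2) = (of_nat n + 3) * (of_nat n + 1) * (fact n * fact (n + 2) :: rat)"
      by (simp add: algebra_simps)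
    have 3: "(2 :: rat) ^ (Suc n - 1) = 2 * 2 ^ (n - 1)" by (simp add: k)
    have nz: "(of_nat n + 3) * (of_nat n + 1) \<noteq> (0 :: rat)"
      using of_nat_0_le_iff[of n, where 'a = rat] by (simp add: add_nonneg_eq_0_iff)
    have "(of_nat n + 3) * (of_nat n + 1) * f (Suc n) =
        4 * of_nat n * (1 + 2 * of_nat n) * (3 * fact (2 * n - 1) * 2 ^ (n - 1) / (fact n * fact (n + 2)))"
      using rec[of n] step by simp
    also have "\<dots> = (of_nat n + 3) * (of_nat n + 1) *
        (3 * fact (2 * Suc n - 1) * 2 ^ (Suc n - 1) / (fact (Suc n) * fact (Suc n + 2)))"
      unfolding 1 2 3 using nz by (simp add: divide_simps) 
    finally show ?case using nz by (simp only: mult_cancel_left) simp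
  qed
qed

section \<open>Asymptotic expansion of the coefficients\<close>

lemma bigo_tail_of_differences:
  fixes u :: "nat \<Rightarrow> real"
  assumes d: "(\<lambda>n. u (Suc n) - u n) \<in> O(\<lambda>n. 1 / real n ^ 5)" and L: "u \<longlonglongrightarrow> L"
  shows "(\<lambda>n. u n - L) \<in> O(\<lambda>n. 1 / real n ^ 4)"
proof -
  obtain C where C: "C > 0" "eventually (\<lambda>n. norm (u (Suc n) - u n) \<le> C * norm (1 / real n ^ 5)) sequentially"
    using landau_o.bigE[OF d] by blast
  \<comment> \<open>Domination by a telescoping difference: u(n) - C/n^4 is increasing and u(n) +
    C/n^4 is decreasing for large n, and both tend to \<open>L\<close>, so \<open>L\<close> lies
    between them.\<close>
  have "eventually (\<lambda>n. 1 / real n ^ 5 \<le> 1 / real n ^ 4 - 1 / real (Suc n) ^ 4) sequentially"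
    by real_asymp
  with C(2) have "eventually (\<lambda>n. \<bar>u (Suc n) - u n\<bar> \<le> C * (1 / real n ^ 4 - 1 / real (Suc n) ^ 4)) sequentially"
  proof eventually_elim
    case (elim n)
    have "\<bar>u (Suc n) - u n\<bar> \<le> C * (1 / real n ^ 5)" using elim(1) by simp
    also have "\<dots> \<le> C * (1 / real n ^ 4 - 1 / real (Suc n) ^ 4)"
      using elim(2) C(1) by (intro mult_left_mono) auto
    finally show ?case .
  qed
  then obtain n0 where n0: "\<And>n. n \<ge> n0 \<Longrightarrow> \<bar>u (Suc n) - u n\<bar> \<le> C * (1 / real n ^ 4 - 1 / real (Suc n) ^ 4)"
    by (auto simp: eventually_sequentially)
  have z: "(\<lambda>n. C * (1 / real n ^ 4)) \<longlonglongrightarrow> 0" by real_asymp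
  have "norm (u n - L) \<le> C * norm (1 / real n ^ 4)" if "n \<ge> n0" for n
  proof -
    define v where "v i = u (i + n) - C * (1 / real (i + n) ^ 4)" for i
    define w where "w i = u (i + n) + C * (1 / real (i + n) ^ 4)" for i
    have "incseq v"
    proof (rule incseq_SucI)
      fix i show "v i \<le> v (Suc i)"
        using n0[of "i + n"] that unfolding v_def by (simp add: right_diff_distrib abs_le_iff)
    qed
    moreover have "v \<longlonglongrightarrow> L - 0" unfolding v_def
      by (intro tendsto_diff LIMSEQ_ignore_initial_segment[OF L] LIMSEQ_ignore_initial_segment[OF z])
    ultimately have "v 0 \<le> L" using incseq_le[of v L 0] by simp
    have "decseq w"
    proof (rule decseq_SucI)
      fix i show "w (Suc i) \<le> w i"
        using n0[of "i + n"] that unfolding w_def by (simp add: right_diff_distrib abs_le_iff)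
    qed
    moreover have "w \<longlonglongrightarrow> L + 0" unfolding w_def
      by (intro tendsto_add LIMSEQ_ignore_initial_segment[OF L] LIMSEQ_ignore_initial_segment[OF z])
    ultimately have "L \<le> w 0" using decseq_ge[of w L 0] by simp
    with \<open>v 0 \<le> L\<close> show ?thesis by (simp add: v_def w_def abs_le_iff)
  qed
  then show ?thesis
    by (intro landau_o.bigI[OF C(1)] eventually_sequentiallyI[of n0])
qed

text \<open>The limit formula for Gamma at 1/2: its Pochhammer product is a factorial quotient up to
  a power of 4, and the factor n / (n + 1/2) removes the last factor of that product.\<close>

lemma central_binomial_limit:
  "(\<lambda>n. (fact (2 * n) / (fact n * fact n)) * sqrt (real n) / 4 ^ n) \<longlonglongrightarrow> 1 / sqrt pi"
proof -
  have "Gamma_series (1 / 2 :: real) \<longlonglongrightarrow> sqrt pi"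
    using Gamma_series_LIMSEQ[of "1 / 2 :: real"] by (simp add: Gamma_one_half_real)
  then have "(\<lambda>n. inverse (Gamma_series (1 / 2 :: real) n) * (real n / (real n + 1 / 2)) ) \<longlonglongrightarrow> inverse (sqrt pi) * 1"
    by (intro tendsto_mult tendsto_inverse) (simp, simp, real_asymp)
  then have "(\<lambda>n. inverse (Gamma_series (1 / 2 :: real) n) * (real n / (real n + 1 / 2)) ) \<longlonglongrightarrow> 1 / sqrt pi"
    by (simp add: inverse_eq_divide)
  then show ?thesis
  proof (rule Lim_transform_eventually, intro eventually_sequentiallyI[of 1])
    fix n :: nat assume n: "1 \<le> n"
    have p: "pochhammer (1 / 2 :: real) (Suc n) = fact (2 * n) / (4 ^ n * fact n) * (real n + 1 / 2)"
      by (simp add: pochhammer_Suc fact_double power_mult)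
    have e: "exp (ln (real n) / 2) = sqrt (real n)"
      using n by (simp add: ln_sqrt[symmetric])
    have s: "sqrt (real n) * sqrt (real n) = real n" by simp
    have "inverse (Gamma_series (1 / 2 :: real) n) * (real n / (real n + 1 / 2)) =
       fact (2 * n) / (4 ^ n * fact n) * (real n + 1 / 2) / (fact n * sqrt (real n)) * (sqrt (real n) * sqrt (real n) / (real n + 1 / 2))"
      unfolding s by (simp add: Gamma_series_def p e)
    also have "\<dots> = (fact (2 * n) / (fact n * fact n)) * sqrt (real n) / 4 ^ n"
      using n by (simp add: divide_simps)
    finally show "inverse (Gamma_series (1 / 2 :: real) n) * (real n / (real n + 1 / 2)) =
      (fact (2 * n) / (fact n * fact n)) * sqrt (real n) / 4 ^ n" .
  qed
qed

text \<open>The quotient \<open>q\<close> of the two sides tends to 1 and \<open>q (n + 1) / q n = 1 + O (n\<^bsup>-5\<^esup>)\<close>, which determines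
  \<open>q\<close> up to \<open>O (n\<^bsup>-4\<^esup>)\<close>.\<close>
lemma map_count_asymptotics:
  "\<exists>\<epsilon> :: nat \<Rightarrow> real. \<epsilon> \<in> O(\<lambda>n. 1 / real n ^ 4) \<and>
     (\<forall>n\<ge>1. 2 * fact (2 * n - 1) / (fact n * fact (n + 2)) =
        4 ^ n / (sqrt pi * real n powr (7 / 2)) *
        (1 - 25 / (8 * real n) + 945 / (128 * real n ^ 2) - 16275 / (1024 * real n ^ 3) + \<epsilon> n))"
proof -
  define g :: "nat \<Rightarrow> real" where "g n = 2 * fact (2 * n - 1) / (fact n * fact (n + 2))" for n
  define h :: "nat \<Rightarrow> real" where
    "h n = 1 - 25 / (8 * real n) + 945 / (128 * real n ^ 2) - 16275 / (1024 * real n ^ 3)" for n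
  define r where "r n = g n * (sqrt pi * real n powr (7 / 2)) / 4 ^ n" for n
  define q where "q n = r n / h n" for n
  \<comment> \<open>The ratio of consecutive values of \<open>q\<close> for large n, written without
    factorials so that it can be expanded.\<close>
  define \<rho> where "\<rho> n = real n * (2 * real n + 1) / (2 * (real n + 1) * (real n + 3)) * (1 + 1 / real n) powr (7 / 2) *
    (h n / h (Suc n))" for n
  have h1: "h \<longlonglongrightarrow> 1" unfolding h_def by real_asymp
  have hpos: "eventually (\<lambda>n. h n > 0) sequentially" using order_tendstoD(1)[OF h1, of 0] by simp
  have r_lim: "r \<longlonglongrightarrow> 1"
  proof -
    have "(\<lambda>n. (fact (2 * n) / (fact n * fact n)) * sqrt (real n) / 4 ^ n * sqrt pi *
        (real n ^ 2 / ((real n + 1) * (real n + 2)))) \<longlonglongrightarrow> 1 / sqrt pi * sqrt pi * 1"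
      by (intro tendsto_mult central_binomial_limit tendsto_const) real_asymp
    then have "(\<lambda>n. (fact (2 * n) / (fact n * fact n)) * sqrt (real n) / 4 ^ n * sqrt pi *
        (real n ^ 2 / ((real n + 1) * (real n + 2)))) \<longlonglongrightarrow> 1" by simp
    then show ?thesis
    proof (rule Lim_transform_eventually, intro eventually_sequentiallyI[of 1])
      fix n :: nat assume "1 \<le> n"
      then obtain k where k: "n = Suc k" by (cases n) auto
      have 1: "fact (2 * n) = 2 * real n * fact (2 * n - 1)" by (simp add: k algebra_simps)
      have 2: "fact (n + 2) = (real n + 1) * (real n + 2) * fact n" by (simp add: algebra_simps)
      have "real n powr (7 / 2) = real n powr (3 + 1 / 2)" by simp
      also have "\<dots> = real n ^ 3 * sqrt (real n)"
        by (subst powr_add) (simp add: k powr_half_sqrt powr_numeral del: of_nat_Suc)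
      finally have 3: "real n powr (7 / 2) = real n ^ 3 * sqrt (real n)" .
      show "(fact (2 * n) / (fact n * fact n)) * sqrt (real n) / 4 ^ n * sqrt pi *
        (real n ^ 2 / ((real n + 1) * (real n + 2))) = r n"
        unfolding r_def g_def 1 2 3 by (simp add: divide_simps power2_eq_square power3_eq_cube)
    qed
  qed
  have q_lim: "q \<longlonglongrightarrow> 1" unfolding q_def using tendsto_divide[OF r_lim h1] by simp
  have qO: "q \<in> O(\<lambda>_. 1)" using q_lim by (intro bigoI_tendsto[of _ _ 1]) auto
  have r_Suc: "r (Suc n) = r n * (real n * (2 * real n + 1) / (2 * (real n + 1) * (real n + 3)) * (1 + 1 / real n) powr (7 / 2))"
    if "n \<ge> 1" for n
  proof -
    obtain k where k: "n = Suc k" using \<open>n \<ge> 1\<close> by (cases n) auto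
    have 1: "fact (2 * Suc n - 1) = (2 * real n + 1) * (2 * real n) * fact (2 * n - 1)"
      by (simp add: k algebra_simps)
    have 2: "fact (Suc n) * fact (Suc n + 2) = (real n + 1) * (real n + 3) * (fact n * fact (n + 2))"
      by (simp add: algebra_simps)
    have "real (Suc n) = real n * (1 + 1 / real n)" using that by (simp add: field_simps)
    then have 3: "real (Suc n) powr (7 / 2) = real n powr (7 / 2) * (1 + 1 / real n) powr (7 / 2)"
      using that by (simp only: powr_mult)
    show ?thesis
      unfolding r_def g_def 1 2 3 by (simp add: divide_simps)
  qed
  \<comment> \<open>The constants are tested here: the exponent 7/2 cancels the term of order 1/n in
    \<open>\<rho> n - 1\<close>, and the three coefficients of \<open>h\<close> cancel those of
    order n^(-2), n^(-3) and n^(-4).\<close>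
  have qO': "(\<lambda>n. q n * (\<rho> n - 1)) \<in> O(\<lambda>n. 1 * (1 / real n ^ 5))"
    by (rule landau_o.big.mult[OF qO]) (unfold \<rho>_def h_def, real_asymp)
  have ev: "eventually (\<lambda>n. q n * (\<rho> n - 1) = q (Suc n) - q n) sequentially"
    using hpos eventually_ge_at_top[of 1]
  proof eventually_elim
    case (elim n)
    have *: "a / b * (c * (b / b')) = a * c / b'" if "b \<noteq> 0" for a b b' c :: real
      using that by simp
    have "q n * \<rho> n = q (Suc n)"
      unfolding q_def \<rho>_def r_Suc[OF elim(2)] by (rule *) (use elim(1) in simp)
    then show ?case by (simp add: right_diff_distrib)
  qed
  have "(\<lambda>n. q (Suc n) - q n) \<in> O(\<lambda>n. 1 / real n ^ 5)"
    using iffD1[OF landau_o.big.in_cong[OF ev] qO'] by simp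
  from bigo_tail_of_differences[OF this q_lim] have "(\<lambda>n. q n - 1) \<in> O(\<lambda>n. 1 / real n ^ 4)" .
  moreover have "h \<in> O(\<lambda>_. 1)" using h1 by (intro bigoI_tendsto[of _ _ 1]) auto
  ultimately have hO: "(\<lambda>n. h n * (q n - 1)) \<in> O(\<lambda>n. 1 * (1 / real n ^ 4))"
    by (intro landau_o.big.mult)
  have ev': "eventually (\<lambda>n. h n * (q n - 1) = r n - h n) sequentially"
    using hpos by eventually_elim (simp add: q_def algebra_simps)
  have "(\<lambda>n. r n - h n) \<in> O(\<lambda>n. 1 / real n ^ 4)"
    using iffD1[OF landau_o.big.in_cong[OF ev'] hO] by simp
  moreover have "2 * fact (2 * n - 1) / (fact n * fact (n + 2)) =
        4 ^ n / (sqrt pi * real n powr (7 / 2)) *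
        (1 - 25 / (8 * real n) + 945 / (128 * real n ^ 2) - 16275 / (1024 * real n ^ 3) + (r n - h n))" if "n \<ge> 1" for n
  proof -
    have "g n = 4 ^ n / (sqrt pi * real n powr (7 / 2)) * r n" using that by (simp add: r_def)
    then show ?thesis by (simp add: g_def h_def)
  qed
  ultimately show ?thesis by (intro exI[of _ "\<lambda>n. r n - h n"]) blast
qed

section \<open>The free energy as a series in t\<close>

lemma planar_recursion_subst:
  assumes "genus_expansion F"
  defines "w e n \<equiv> mfps_subst (power_weights e) (planar_moment F n)"
  defines "T e p \<equiv> Abs_fps (\<lambda>k. \<Sum>n=1..k. e n * fps_nth (w e (p + n - 1)) (k - n))"
  shows "planar_recursion e (w e) (T e)"
    and "fps_X * fps_deriv (mfps_subst (power_weights e) (F 0)) = T e 1"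
proof -
  show "planar_recursion e (w e) (T e)"
  proof
    show "w e 0 = 1" by (simp add: w_def planar_moment_def mfps_subst_1)
    show "w e (Suc p) = (\<Sum>i<p. w e i * w e (p - 1 - i)) + T e p" for p
    proof -
      have "mfps_subst (power_weights e) (mfps_infsum (\<lambda>n. indet n * planar_moment F (p + n - 1)) {1..}) = T e p"
        by (rule fps_ext) (simp only: fps_nth_subst_infsum T_def w_def fps_nth_Abs_fps)
      then show ?thesis
        unfolding w_def planar_loop_equation[OF assms(1)] mfps_subst_add mfps_subst_sum mfps_subst_mult
        by simp
    qed
  qed (simp add: T_def)
  show "fps_X * fps_deriv (mfps_subst (power_weights e) (F 0)) = T e 1"
  proof (rule fps_ext)
    fix k
    have "fps_nth (fps_X * fps_deriv (mfps_subst (power_weights e) (F 0))) k =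
        of_nat k * fps_nth (mfps_subst (power_weights e) (F 0)) k"
      by (cases k) simp_all
    also have "\<dots> = fps_nth (T e 1) k"
      unfolding mfps_subst_euler T_def fps_nth_Abs_fps w_def
      by (intro sum.cong refl) (simp add: planar_moment_def)
    finally show "fps_nth (fps_X * fps_deriv (mfps_subst (power_weights e) (F 0))) k = fps_nth (T e 1) k" .
  qed
qed

text \<open>By \<open>parity_T\<close> the substituted free energy is even in s, so it equals
  F0(s^2) for a series \<open>F0\<close> in t, and the Euler identity turns \<open>T 1\<close> into
  2 t F0'(t).\<close>

lemma mfps_subst_free_energy:
  assumes "genus_expansion F"
  obtains F0 T w where "F0 oo fps_X ^ 2 = mfps_subst (power_weights e) (F 0)" "fps_nth F0 0 = 0"
    "planar_recursion e w T" "T 1 = 2 * fps_X ^ 2 * (fps_deriv F0 oo fps_X ^ 2)"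
proof -
  define f where "f = mfps_subst (power_weights e) (F 0)"
  define F0 where "F0 = Abs_fps (\<lambda>n. fps_nth f (2 * n))"
  obtain w T where wT: "planar_recursion e w T" "fps_X * fps_deriv f = T 1"
    using planar_recursion_subst[OF assms, of e] unfolding f_def by blast
  have "fps_nth f k = 0" if "odd k" for k
  proof -
    obtain j where k: "k = Suc j" using \<open>odd k\<close> by (cases k) auto
    have "fps_nth (fps_X * fps_deriv f) k = 0"
      unfolding wT(2) by (rule planar_recursion.parity_T[OF wT(1) \<open>odd k\<close>])
    then show ?thesis by (simp add: k del: of_nat_Suc)
  qed
  then have F0: "F0 oo fps_X ^ 2 = f" unfolding F0_def by (rule fps_even_compose)
  have "{m. mweight m = 0} = {{#}}"
  proof -
    have "mweight m = 0 \<longleftrightarrow> m = {#}" for m by (cases m) auto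
    then show ?thesis by auto
  qed
  then have "fps_nth F0 0 = 0"
    by (simp add: F0_def f_def fps_nth_subst planar_empty[OF assms])
  moreover have "T 1 = 2 * fps_X ^ 2 * (fps_deriv F0 oo fps_X ^ 2)"
    unfolding wT(2)[symmetric] F0[symmetric] by (rule fps_X_mult_deriv_compose_X2)
  ultimately show thesis using that F0 wT(1) unfolding f_def by blast
qed

lemma fps_compose_X2_simps:
  fixes f g :: "rat fps"
  shows "(f * g) oo fps_X ^ 2 = (f oo fps_X ^ 2) * (g oo fps_X ^ 2)"
    "(f ^ n) oo fps_X ^ 2 = (f oo fps_X ^ 2) ^ n"
    "fps_X oo (fps_X ^ 2 :: rat fps) = fps_X ^ 2"
  by (simp_all add: fps_compose_mult_distrib fps_compose_power)

text \<open>Inserting 2 t F0' for \<open>T 1\<close> into the quadratic equation leaves a common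
  factor t; its removal gives the equation for F0'.\<close>

lemma free_energy_even:
  assumes "genus_expansion F"
  obtains F0 where "F0 oo fps_X ^ 2 = mfps_subst even_weights (F 0)" "fps_nth F0 0 = 0"
    "64 * fps_X ^ 3 * fps_deriv F0 ^ 2 + (48 * fps_X ^ 2 - 24 * fps_X + 2) * fps_deriv F0 + 9 * fps_X - 1 = 0"
proof -
  obtain F0 T w where *: "F0 oo fps_X ^ 2 = mfps_subst even_weights (F 0)" "fps_nth F0 0 = 0"
    "planar_recursion (\<lambda>n. if even n then 1 else 0) w T" "T 1 = 2 * fps_X ^ 2 * (fps_deriv F0 oo fps_X ^ 2)"
    unfolding even_weights_eq by (rule mfps_subst_free_energy[OF assms])
  define G where "G = fps_deriv F0"
  define g where "g = G oo fps_X ^ 2"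
  define t :: "rat fps" where "t = fps_X ^ 2"
  have "0 = 16 * t ^ 2 * (2 * t * g) ^ 2 + (24 * t ^ 2 - 12 * t + 1) * (2 * t * g) + 9 * t ^ 2 - t"
    using planar_recursion.quadratic_even[OF *(3) refl] unfolding *(4) by (simp only: t_def g_def G_def)
  also have "\<dots> = t * (64 * t ^ 3 * g ^ 2 + (48 * t ^ 2 - 24 * t + 2) * g + 9 * t - 1)"
    by (simp add: power2_eq_square power3_eq_cube algebra_simps)
  finally have "64 * t ^ 3 * g ^ 2 + (48 * t ^ 2 - 24 * t + 2) * g + 9 * t - 1 = 0"
    by (simp add: t_def)
  then have "(64 * fps_X ^ 3 * G ^ 2 + (48 * fps_X ^ 2 - 24 * fps_X + 2) * G + 9 * fps_X - 1) oo fps_X ^ 2 = 0"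
    by (simp only: fps_compose_add_distrib fps_compose_sub_distrib fps_compose_X2_simps numeral_compose
        fps_compose_1 t_def g_def)
  from fps_compose_X2_eq_0[OF this] show thesis using that *(1,2) by (simp add: G_def)
qed

lemma free_energy_all:
  assumes "genus_expansion F"
  obtains F0 where "F0 oo fps_X ^ 2 = mfps_subst all_weights (F 0)" "fps_nth F0 0 = 0"
    "108 * fps_X ^ 3 * fps_deriv F0 ^ 2 + (108 * fps_X ^ 2 - 36 * fps_X + 2) * fps_deriv F0 + 27 * fps_X - 2 = 0"
proof -
  obtain F0 T w where *: "F0 oo fps_X ^ 2 = mfps_subst all_weights (F 0)" "fps_nth F0 0 = 0"
    "planar_recursion (\<lambda>_. 1) w T" "T 1 = 2 * fps_X ^ 2 * (fps_deriv F0 oo fps_X ^ 2)"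
    unfolding all_weights_eq by (rule mfps_subst_free_energy[OF assms])
  define G where "G = fps_deriv F0"
  define g where "g = G oo fps_X ^ 2"
  define t :: "rat fps" where "t = fps_X ^ 2"
  have "0 = 27 * t ^ 2 * (1 + 2 * t * g) ^ 2 + (1 - 18 * t) * (1 + 2 * t * g) + 16 * t - 1"
    using planar_recursion.quadratic_all[OF *(3) refl] unfolding *(4) by (simp only: t_def g_def G_def)
  also have "\<dots> = t * (108 * t ^ 3 * g ^ 2 + (108 * t ^ 2 - 36 * t + 2) * g + 27 * t - 2)"
    by (simp add: power2_eq_square power3_eq_cube algebra_simps)
  finally have "108 * t ^ 3 * g ^ 2 + (108 * t ^ 2 - 36 * t + 2) * g + 27 * t - 2 = 0"
    by (simp add: t_def)
  then have "(108 * fps_X ^ 3 * G ^ 2 + (108 * fps_X ^ 2 - 36 * fps_X + 2) * G + 27 * fps_X - 2) oo fps_X ^ 2 = 0"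
    by (simp only: fps_compose_add_distrib fps_compose_sub_distrib fps_compose_X2_simps numeral_compose
        t_def g_def)
  from fps_compose_X2_eq_0[OF this] show thesis using that *(1,2) by (simp add: G_def)
qed

lemma of_rat_fact: "real_of_rat (fact n) = fact n"
  by (metis of_nat_fact of_rat_of_nat_eq)

text \<open>\<open>f n\<close> is 3/4 * 2^n times the sequence of
  \<open>map_count_asymptotics\<close>.\<close>

lemma map_count_asymptotics_even:
  assumes f: "\<And>n. n \<ge> 1 \<Longrightarrow> f n = (3 * fact (2 * n - 1) * 2 ^ (n - 1) / (fact n * fact (n + 2)) :: rat)"
  shows "\<exists>\<epsilon> :: nat \<Rightarrow> real. \<epsilon> \<in> O(\<lambda>n. 1 / real n ^ 4) \<and>
             (\<forall>n\<ge>1. real_of_rat (f n) =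
                3 / (4 * sqrt pi) * (8 ^ n / real n powr (7 / 2))
                * (1 - 25 / (8 * real n) + 945 / (128 * real n ^ 2)
                     - 16275 / (1024 * real n ^ 3) + \<epsilon> n))"
proof -
  obtain \<epsilon> :: "nat \<Rightarrow> real" where \<epsilon>: "\<epsilon> \<in> O(\<lambda>n. 1 / real n ^ 4)"
    "\<And>n. n \<ge> 1 \<Longrightarrow> 2 * fact (2 * n - 1) / (fact n * fact (n + 2)) =
        4 ^ n / (sqrt pi * real n powr (7 / 2)) *
        (1 - 25 / (8 * real n) + 945 / (128 * real n ^ 2) - 16275 / (1024 * real n ^ 3) + \<epsilon> n)"
    using map_count_asymptotics by auto
  have "real_of_rat (f n) = 3 / (4 * sqrt pi) * (8 ^ n / real n powr (7 / 2))
                * (1 - 25 / (8 * real n) + 945 / (128 * real n ^ 2)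
                     - 16275 / (1024 * real n ^ 3) + \<epsilon> n)" if n: "n \<ge> 1" for n
  proof -
    have *: "3 / 4 * a * (b / (c * d) * e) = 3 / (4 * c) * ((a * b) / d) * e" for a b c d e :: real
      by simp
    have 2: "(2 :: real) * 2 ^ (n - 1) = 2 ^ n" using n by (cases n) auto
    have "real_of_rat (f n) = 3 * fact (2 * n - 1) * 2 ^ (n - 1) / (fact n * fact (n + 2))"
      by (simp only: f[OF n] of_rat_divide of_rat_mult of_rat_power of_rat_fact of_rat_numeral_eq)
    also have "\<dots> = 3 / 4 * (2 * 2 ^ (n - 1)) * (2 * fact (2 * n - 1) / (fact n * fact (n + 2)))"
      by (simp only: times_divide_eq_right times_divide_eq_left) simp
    also have "\<dots> = 3 / 4 * 2 ^ n * (2 * fact (2 * n - 1) / (fact n * fact (n + 2)))"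
      unfolding 2 ..
    also have "\<dots> = 3 / (4 * sqrt pi) * ((2 ^ n * 4 ^ n) / real n powr (7 / 2))
                * (1 - 25 / (8 * real n) + 945 / (128 * real n ^ 2)
                     - 16275 / (1024 * real n ^ 3) + \<epsilon> n)"
      unfolding \<epsilon>(2)[OF n] by (rule *)
    also have "(2 ^ n * 4 ^ n :: real) = 8 ^ n" by (simp flip: power_mult_distrib)
    finally show ?thesis .
  qed
  with \<epsilon>(1) show ?thesis by blast
qed

text \<open>\<open>f n\<close> is 3^n times the sequence of \<open>map_count_asymptotics\<close>.
  With the prefactor \<open>2 / sqrt pi\<close> the bracket is half the common one, so it starts
  with \<open>1 / 2\<close>.\<close>

lemma map_count_asymptotics_all:
  assumes f: "\<And>n. n \<ge> 1 \<Longrightarrow> f n = (2 * fact (2 * n - 1) * 3 ^ n / (fact n * fact (n + 2)) :: rat)"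
  shows "\<exists>\<epsilon> :: nat \<Rightarrow> real. \<epsilon> \<in> O(\<lambda>n. 1 / real n ^ 4) \<and>
             (\<forall>n\<ge>1. real_of_rat (f n) =
                2 / sqrt pi * (12 ^ n / real n powr (7 / 2))
                * (1 / 2 - 25 / (16 * real n) + 945 / (256 * real n ^ 2)
                     - 16275 / (2048 * real n ^ 3) + \<epsilon> n))"
proof -
  obtain \<epsilon> :: "nat \<Rightarrow> real" where \<epsilon>: "\<epsilon> \<in> O(\<lambda>n. 1 / real n ^ 4)"
    "\<And>n. n \<ge> 1 \<Longrightarrow> 2 * fact (2 * n - 1) / (fact n * fact (n + 2)) =
        4 ^ n / (sqrt pi * real n powr (7 / 2)) *
        (1 - 25 / (8 * real n) + 945 / (128 * real n ^ 2) - 16275 / (1024 * real n ^ 3) + \<epsilon> n)"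
    using map_count_asymptotics by auto
  have "real_of_rat (f n) = 2 / sqrt pi * (12 ^ n / real n powr (7 / 2))
                * (1 / 2 - 25 / (16 * real n) + 945 / (256 * real n ^ 2)
                     - 16275 / (2048 * real n ^ 3) + \<epsilon> n / 2)" if n: "n \<ge> 1" for n
  proof -
    have *: "a * (b / (c * d) * e) = 2 / c * ((a * b) / d) * (1 / 2 * e)" for a b c d e :: real
      by simp
    have "real_of_rat (f n) = 2 * fact (2 * n - 1) * 3 ^ n / (fact n * fact (n + 2))"
      by (simp only: f[OF n] of_rat_divide of_rat_mult of_rat_power of_rat_fact of_rat_numeral_eq)
    also have "\<dots> = 3 ^ n * (2 * fact (2 * n - 1) / (fact n * fact (n + 2)))"
      by (simp only: times_divide_eq_right mult_ac)
    also have "\<dots> = 2 / sqrt pi * ((3 ^ n * 4 ^ n) / real n powr (7 / 2)) * (1 / 2 *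
                (1 - 25 / (8 * real n) + 945 / (128 * real n ^ 2)
                     - 16275 / (1024 * real n ^ 3) + \<epsilon> n))"
      unfolding \<epsilon>(2)[OF n] by (rule *)
    also have "(3 ^ n * 4 ^ n :: real) = 12 ^ n" by (simp flip: power_mult_distrib)
    finally show ?thesis by (simp add: distrib_left right_diff_distrib)
  qed
  moreover have "(\<lambda>n. \<epsilon> n / 2) \<in> O(\<lambda>n. 1 / real n ^ 4)" using \<epsilon>(1) by simp
  ultimately show ?thesis by blast
qed

text \<open>Substituted series live in the square root of t, so \<open>F0\<close> as a series in t
  is tied to the free energy by \<open>fps_compose F0 (fps_X ^ 2)\<close>, which determines it. In
  the second case the expansion R = 1 + t + ... fixes the constant term \<open>4 * s ^ 2 + 1\<close>
  of the equation for R, and the closed form of the coefficients fixes the leading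
  \<open>1 / 2\<close> of the asymptotic bracket.\<close>

theorem proposition8p3:
  fixes R S :: "rat mfps" and F :: "nat \<Rightarrow> rat mfps"
  assumes "RS_solution R S" and "genus_expansion F"
  shows
   "(let s = fps_X :: rat fps;
         Rt = mfps_subst even_weights R
     in 4 * Rt ^ 2 * s ^ 2 - Rt * (1 + 4 * s ^ 2) + s ^ 2 + 1 = 0)
    \<and>
    (\<exists>F0 :: rat fps.
       let t = fps_X; f = fps_nth F0; G0 = fps_deriv F0
       in fps_compose F0 (fps_X ^ 2) = mfps_subst even_weights (F 0)
        \<and> 64 * t ^ 3 * G0 ^ 2 + (48 * t ^ 2 - 24 * t + 2) * G0 + 9 * t - 1 = 0
        \<and> 3 + 6 * (4 * t - 1) * fps_deriv F0 + 2 * t * (8 * t - 1) * fps_deriv (fps_deriv F0) = 0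
        \<and> fps_nth F0 0 = 0 \<and> fps_nth (fps_deriv F0) 0 = 1 / 2
        \<and> (\<forall>n\<ge>1. (of_nat n + 3) * (of_nat n + 1) * f (n + 1)
                    - 4 * of_nat n * (1 + 2 * of_nat n) * f n = 0)
        \<and> f 1 = 1 / 2
        \<and> (\<forall>n\<ge>1. f n = 3 * fact (2 * n - 1) * 2 ^ (n - 1) / (fact n * fact (n + 2)))
        \<and> (\<exists>\<epsilon> :: nat \<Rightarrow> real. \<epsilon> \<in> O(\<lambda>n. 1 / real n ^ 4) \<and>
             (\<forall>n\<ge>1. real_of_rat (f n) =
                3 / (4 * sqrt pi) * (8 ^ n / real n powr (7 / 2))
                * (1 - 25 / (8 * real n) + 945 / (128 * real n ^ 2)
                     - 16275 / (1024 * real n ^ 3) + \<epsilon> n))))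
    \<and>
    (let s = fps_X :: rat fps;
         Rt = mfps_subst all_weights R;
         St = mfps_subst all_weights S
     in 3 * s * St ^ 2 - St + s = 0
      \<and> 9 * s ^ 2 * Rt ^ 2 - (12 * s ^ 2 + 1) * Rt + 4 * s ^ 2 + 1 = 0)
    \<and>
    (\<exists>F0 :: rat fps.
       let t = fps_X; f = fps_nth F0; G0 = fps_deriv F0
       in fps_compose F0 (fps_X ^ 2) = mfps_subst all_weights (F 0)
        \<and> 108 * t ^ 3 * G0 ^ 2 + (108 * t ^ 2 - 36 * t + 2) * G0 + 27 * t - 2 = 0
        \<and> 3 + 3 * (6 * t - 1) * fps_deriv F0 + t * (12 * t - 1) * fps_deriv (fps_deriv F0) = 0
        \<and> fps_nth F0 0 = 0 \<and> fps_nth (fps_deriv F0) 0 = 1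
        \<and> (\<forall>n\<ge>1. (of_nat n + 3) * (of_nat n + 1) * f (n + 1)
                    - 6 * of_nat n * (1 + 2 * of_nat n) * f n = 0)
        \<and> f 1 = 1
        \<and> (\<forall>n\<ge>1. f n = 2 * fact (2 * n - 1) * 3 ^ n / (fact n * fact (n + 2)))
        \<and> (\<exists>\<epsilon> :: nat \<Rightarrow> real. \<epsilon> \<in> O(\<lambda>n. 1 / real n ^ 4) \<and>
             (\<forall>n\<ge>1. real_of_rat (f n) =
                2 / sqrt pi * (12 ^ n / real n powr (7 / 2))
                * (1 / 2 - 25 / (16 * real n) + 945 / (256 * real n ^ 2)
                     - 16275 / (2048 * real n ^ 3) + \<epsilon> n))))"
proof (intro conjI, goal_cases)
  case 1
  show ?case
    unfolding Let_def by (rule RS_even[OF assms(1)])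
next
  case 3
  show ?case
    unfolding Let_def by (intro conjI RS_all[OF assms(1)])
next
  case 2
  obtain F0 where F0: "F0 oo fps_X ^ 2 = mfps_subst even_weights (F 0)" "fps_nth F0 0 = 0"
    "64 * fps_X ^ 3 * fps_deriv F0 ^ 2 + (48 * fps_X ^ 2 - 24 * fps_X + 2) * fps_deriv F0 + 9 * fps_X - 1 = 0"
    by (rule free_energy_even[OF assms(2)])
  note ode = ode_even[OF F0(3)]
  note coeffs = free_energy_even_coeffs[OF ode]
  have d0: "fps_nth (fps_deriv F0) 0 = 1 / 2" using coeffs(1) by simp
  show ?case
    unfolding Let_def
    by (intro exI[of _ F0] conjI allI impI F0 ode d0 coeffs(1)
        map_count_asymptotics_even[of "fps_nth F0", OF coeffs(3)])
      (rule coeffs(2) coeffs(3), assumption)+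
next
  case 4
  obtain F0 where F0: "F0 oo fps_X ^ 2 = mfps_subst all_weights (F 0)" "fps_nth F0 0 = 0"
    "108 * fps_X ^ 3 * fps_deriv F0 ^ 2 + (108 * fps_X ^ 2 - 36 * fps_X + 2) * fps_deriv F0 + 27 * fps_X - 2 = 0"
    by (rule free_energy_all[OF assms(2)])
  note ode = ode_all[OF F0(3)]
  note coeffs = free_energy_all_coeffs[OF ode]
  have d0: "fps_nth (fps_deriv F0) 0 = 1" using coeffs(1) by simp
  show ?case
    unfolding Let_def
    by (intro exI[of _ F0] conjI allI impI F0 ode d0 coeffs(1)
        map_count_asymptotics_all[of "fps_nth F0", OF coeffs(3)])
      (rule coeffs(2) coeffs(3), assumption)+
qed

end
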